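(* Let $T>0$. A strong solution $u$ of the Navier--Stokes equations on $(0,T)$ satisfies $$\|u(t_2)\|^2+2\int_{t_1}^{t_2}\|\nabla u(s)\|^2\,ds=\|u(t_1)\|^2$$ for all $t_1,t_2\in(0,T)$.
   Context: All function spaces are over $\mathbb{R}^3$; $\int=\int_{\mathbb{R}^3}$; $\|\cdot\|$ is the $L^2$ norm. A vector field $v$ is weakly divergence free if $\int v\cdot\nabla g=0$ for all $g\in C_0^\infty(\mathbb{R}^3)$. The Navier--Stokes equations (viscosity $1$) are $\partial_tu-\Delta u+\nabla p=-(u\cdot\nabla)u$, $\operatorname{div}u=0$. A function $u$ is a strong solution of the Navier--Stokes equations on $(0,T)$ if $u\in C((0,T);L^2)\cap C((0,T);L^\infty)$, $u(t)$ is weakly divergence free for each $t\in(0,T)$, and for some $p\in L^1_{loc}(\mathbb{R}^3\times(0,T))$ $$\int_0^T\!\!\int\big(u\cdot(f_t+\Delta f)+p\,\operatorname{div}f\big)=-\int_0^T\!\!\int u\cdot(u\cdot\nabla)f\qquad\text{for all }f\in C_0^\infty(\mathbb{R}^3\times(0,T);\mathbb{R}^3).$$ *)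

theory Defs
  imports "HOL-Analysis.Analysis" "HOL-Probability.Essential_Supremum"
begin

section \<open>Test functions\<close>

fun C_k :: "nat \<Rightarrow> ('a::real_normed_vector \<Rightarrow> 'b::real_normed_vector) \<Rightarrow> bool" where
  "C_k 0 f \<longleftrightarrow> continuous_on UNIV f"
| "C_k (Suc k) f \<longleftrightarrow>
     (\<forall>x. f differentiable (at x)) \<and> (\<forall>h. C_k k (\<lambda>x. frechet_derivative f (at x) h))"

text \<open>
  \<open>C\<^sub>0\<^sup>\<infinity>(\<Omega>)\<close>; its members are represented by their extension by zero to the whole space.
\<close>

definition test_function ::
  "'a::real_normed_vector set \<Rightarrow> ('a \<Rightarrow> 'b::real_normed_vector) \<Rightarrow> bool" where
  "test_function \<Omega> f \<longleftrightarrow>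
     (\<forall>k. C_k k f) \<and> compact (closure {x. f x \<noteq> 0}) \<and> closure {x. f x \<noteq> 0} \<subseteq> \<Omega>"

section \<open>Classical differential operators in three space variables\<close>

definition pd :: "3 \<Rightarrow> (real^3 \<Rightarrow> 'b::real_normed_vector) \<Rightarrow> real^3 \<Rightarrow> 'b" where
  "pd i g x = frechet_derivative g (at x) (axis i 1)"

definition grad :: "(real^3 \<Rightarrow> real) \<Rightarrow> real^3 \<Rightarrow> real^3" where
  "grad g x = (\<chi> i. pd i g x)"

definition divergence :: "(real^3 \<Rightarrow> real^3) \<Rightarrow> real^3 \<Rightarrow> real" where
  "divergence w x = (\<Sum>i\<in>UNIV. pd i w x $ i)"

definition laplacian :: "(real^3 \<Rightarrow> 'b::real_normed_vector) \<Rightarrow> real^3 \<Rightarrow> 'b" where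
  "laplacian w x = (\<Sum>i\<in>UNIV. pd i (pd i w) x)"

text \<open>\<open>convect v w = (v \<cdot> \<nabla>) w\<close>.\<close>

definition convect :: "(real^3 \<Rightarrow> real^3) \<Rightarrow> (real^3 \<Rightarrow> real^3) \<Rightarrow> real^3 \<Rightarrow> real^3" where
  "convect v w x = (\<Sum>i\<in>UNIV. v x $ i *\<^sub>R pd i w x)"

section \<open>Function spaces\<close>

text \<open>
  Elements of \<open>L\<^sup>2\<close> and \<open>L\<^sup>\<infinity>\<close> are represented by Lebesgue measurable functions. For matrix fields,
  \<^const>\<open>norm\<close> on \<^typ>\<open>real^3^3\<close> is the Frobenius norm.
\<close>

definition in_L2 :: "(real^3 \<Rightarrow> 'b::euclidean_space) \<Rightarrow> bool" where
  "in_L2 v \<longleftrightarrow> v \<in> borel_measurable lebesgue \<and> integrable lebesgue (\<lambda>x. (norm (v x))\<^sup>2)"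

definition L2_norm :: "(real^3 \<Rightarrow> 'b::euclidean_space) \<Rightarrow> real" where
  "L2_norm v = sqrt (LINT x|lebesgue. (norm (v x))\<^sup>2)"

definition Linf_norm :: "(real^3 \<Rightarrow> 'b::euclidean_space) \<Rightarrow> ennreal" where
  "Linf_norm v = esssup lebesgue (\<lambda>x. ennreal (norm (v x)))"

definition in_Linf :: "(real^3 \<Rightarrow> 'b::euclidean_space) \<Rightarrow> bool" where
  "in_Linf v \<longleftrightarrow> v \<in> borel_measurable lebesgue \<and> Linf_norm v < \<infinity>"

definition continuous_in_L2 :: "real set \<Rightarrow> (real \<Rightarrow> real^3 \<Rightarrow> 'b::euclidean_space) \<Rightarrow> bool" where
  "continuous_in_L2 I u \<longleftrightarrow>
     (\<forall>t\<in>I. in_L2 (u t)) \<and>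
     (\<forall>t\<in>I. ((\<lambda>s. L2_norm (\<lambda>x. u s x - u t x)) \<longlongrightarrow> 0) (at t within I))"

definition continuous_in_Linf :: "real set \<Rightarrow> (real \<Rightarrow> real^3 \<Rightarrow> 'b::euclidean_space) \<Rightarrow> bool" where
  "continuous_in_Linf I u \<longleftrightarrow>
     (\<forall>t\<in>I. in_Linf (u t)) \<and>
     (\<forall>t\<in>I. ((\<lambda>s. Linf_norm (\<lambda>x. u s x - u t x)) \<longlongrightarrow> 0) (at t within I))"

definition in_L1_loc :: "'a::euclidean_space set \<Rightarrow> ('a \<Rightarrow> real) \<Rightarrow> bool" where
  "in_L1_loc \<Omega> p \<longleftrightarrow> (\<forall>K. compact K \<and> K \<subseteq> \<Omega> \<longrightarrow> set_integrable lebesgue K p)"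

section \<open>Weak derivatives\<close>

definition weakly_div_free :: "(real^3 \<Rightarrow> real^3) \<Rightarrow> bool" where
  "weakly_div_free v \<longleftrightarrow>
     (\<forall>g. test_function UNIV g \<longrightarrow> (LINT x|lebesgue. v x \<bullet> grad g x) = 0)"

text \<open>\<open>G x $ i $ j\<close> is the weak derivative of the \<open>i\<close>-th component of \<open>v\<close> in direction \<open>j\<close>.\<close>

definition has_L2_gradient :: "(real^3 \<Rightarrow> real^3) \<Rightarrow> (real^3 \<Rightarrow> real^3^3) \<Rightarrow> bool" where
  "has_L2_gradient v G \<longleftrightarrow>
     in_L2 G \<and>
     (\<forall>g i j. test_function UNIV g \<longrightarrow>
        (LINT x|lebesgue. v x $ i * pd j g x) = - (LINT x|lebesgue. G x $ i $ j * g x))"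

definition in_H1 :: "(real^3 \<Rightarrow> real^3) \<Rightarrow> bool" where
  "in_H1 v \<longleftrightarrow> in_L2 v \<and> (\<exists>G. has_L2_gradient v G)"

text \<open>Unique up to null sets for \<open>v\<close> in \<open>H\<^sup>1\<close>, unspecified otherwise.\<close>

definition weak_grad :: "(real^3 \<Rightarrow> real^3) \<Rightarrow> real^3 \<Rightarrow> real^3^3" where
  "weak_grad v = (SOME G. has_L2_gradient v G)"

section \<open>Strong solutions of the Navier--Stokes equations\<close>

text \<open>
  The velocity is a curve \<open>u\<close> with \<open>u t\<close> a vector field; pressure and test functions are functions
  on space-time, with the space variable first. The space-time integrals are iterated ones, so they
  depend only on the classes of \<open>u t\<close> modulo null sets and need no jointly measurable representative
  of \<open>u\<close>. By Fubini the inner integrals exist for almost every \<open>t\<close>.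
\<close>

definition strong_solution :: "real \<Rightarrow> (real \<Rightarrow> real^3 \<Rightarrow> real^3) \<Rightarrow> bool" where
  "strong_solution T u \<longleftrightarrow>
     continuous_in_L2 {0<..<T} u \<and>
     continuous_in_Linf {0<..<T} u \<and>
     (\<forall>t\<in>{0<..<T}. weakly_div_free (u t)) \<and>
     (\<exists>p :: (real^3) \<times> real \<Rightarrow> real.
        in_L1_loc (UNIV \<times> {0<..<T}) p \<and>
        (\<forall>f :: (real^3) \<times> real \<Rightarrow> real^3. test_function (UNIV \<times> {0<..<T}) f \<longrightarrow>
           (LINT t:{0<..<T}|lebesgue. LINT x|lebesgue.
              u t x \<bullet> (vector_derivative (\<lambda>s. f (x, s)) (at t) + laplacian (\<lambda>y. f (y, t)) x)
              + p (x, t) * divergence (\<lambda>y. f (y, t)) x)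
           = - (LINT t:{0<..<T}|lebesgue. LINT x|lebesgue.
              u t x \<bullet> convect (u t) (\<lambda>y. f (y, t)) x)))"

end

theory Submission
  imports Defs
begin

text \<open>
  Convolve the solution in space with an even test function \<open>k\<close>. Testing the equation with
  \<open>\<theta>(t) (k * w)(x)\<close> for a compactly supported divergence-free field \<open>w\<close> removes the pressure
  and gives the evolution of \<open>k * u\<close> in duality with such fields. Let \<open>A\<close> be the radial vector
  potential of a smooth divergence-free \<open>v\<close> in \<open>L\<^sup>2\<close>. The fields \<open>curl (\<chi>\<^sub>R A)\<close> converge
  to \<open>v\<close> in \<open>L\<^sup>2\<close>: the error term \<open>\<nabla>\<chi>\<^sub>R \<times> A\<close> tends to \<open>0\<close> pointwise and is
  dominated by an \<open>L\<^sup>2\<close> function independent of \<open>R\<close>, because \<open>\<bar>x\<bar> \<bar>\<nabla>\<chi>\<^sub>R\<bar>\<close> is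
  bounded. So \<open>v = k * u\<close> itself may be used as a test field, without any Helmholtz projection,
  and this yields an energy balance for \<open>k * u\<close>.

  For \<open>k = \<eta>\<^sub>m - \<eta>\<^sub>n\<close>, a difference of two mollifiers, the balance shows that the gradients of
  \<open>\<eta>\<^sub>n * u\<close> form a Cauchy sequence in \<open>L\<^sup>2\<close> of space-time; along a subsequence they converge for
  almost every \<open>t\<close>, whence \<open>u(t) \<in> H\<^sup>1\<close>. For \<open>k = \<eta>\<^sub>n\<close> the balance passes to the limit:
  since \<open>u\<close> is divergence free, its transport term only involves the commutators
  \<open>\<eta>\<^sub>n * (u\<^sub>i u) - u\<^sub>i (\<eta>\<^sub>n * u)\<close>, which tend to \<open>0\<close> in \<open>L\<^sup>2\<close>.
\<close>

section \<open>Calculus of smooth functions\<close>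

text \<open>The pressure is only locally integrable, so the admissible test fields are compactly
  supported and divergence free. Neither \<open>u\<close> nor \<open>k * u\<close> is of that kind,
  and the whole energy balance hinges on approximating \<open>k * u\<close> by such fields.
  Boundedness of \<open>u\<close> on compact time intervals makes each product of a component of
  \<open>u\<close> with \<open>u\<close> a continuous curve in L2. As all space derivatives fall on
  \<open>k\<close>, the velocity of \<open>k * u\<close> is, modulo gradients, continuous in L2 as
  well, and the energy of \<open>k * u\<close> is differentiable at every time.

  For the Cauchy property the transport term is estimated by
  \<open>2 a b \<le> a\<^sup>2 + b\<^sup>2\<close>: the gradient half is absorbed by the
  dissipation, which enters the balance with factor 2, and the other half tends to 0 because the
  mollified products converge in L2. In the final limit the mollified gradients are dominated by a
  fixed integrable function of time, so mere convergence of the commutators to 0, without a rate, is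
  enough.\<close>

lemma frechet_derivative_eq: "(f has_derivative f') (at x) \<Longrightarrow> frechet_derivative f (at x) = f'"
  by (rule frechet_derivative_at[symmetric])

lemma C_k_SucI:
  assumes "\<And>x. (f has_derivative f' x) (at x)" and "\<And>h. C_k k (\<lambda>x. f' x h)"
  shows "C_k (Suc k) f"
  using assms by (auto simp: differentiable_def frechet_derivative_eq[OF assms(1)])

lemma C_k_Suc_has_derivative:
  "C_k (Suc k) f \<Longrightarrow> (f has_derivative frechet_derivative f (at x)) (at x)"
  by (simp add: frechet_derivative_works)

lemma C_k_SucD: "C_k (Suc k) f \<Longrightarrow> C_k k f"
proof (induction k arbitrary: f)
  case 0
  then show ?case
    by (auto intro!: differentiable_imp_continuous_on simp: differentiable_on_def differentiable_at_withinI)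
next
  case (Suc k)
  then show ?case by (metis C_k.simps(2))
qed

lemma C_k_continuous: "C_k k f \<Longrightarrow> continuous_on UNIV f"
  by (induction k) (auto dest: C_k_SucD simp del: C_k.simps(2))

lemma C_k_const: "C_k k (\<lambda>x. c)"
proof (induction k arbitrary: c)
  case (Suc k)
  show ?case by (rule C_k_SucI[where f' = "\<lambda>x h. 0"]) (auto intro: Suc)
qed auto

lemma C_k_bounded_linear: "bounded_linear L \<Longrightarrow> C_k k L"
proof (cases k)
  case 0
  assume "bounded_linear L"
  with 0 show ?thesis by (simp add: linear_continuous_on)
next
  case (Suc j)
  assume "bounded_linear L"
  then show ?thesis unfolding Suc
    by (intro C_k_SucI[where f' = "\<lambda>x. L"] C_k_const bounded_linear_imp_has_derivative)
qed

lemma C_k_add: "C_k k f \<Longrightarrow> C_k k g \<Longrightarrow> C_k k (\<lambda>x. f x + g x)"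
proof (induction k arbitrary: f g)
  case 0
  then show ?case by (auto intro: continuous_on_add)
next
  case (Suc k)
  show ?case
    by (rule C_k_SucI[where f' = "\<lambda>x h. frechet_derivative f (at x) h + frechet_derivative g (at x) h"])
      (use Suc in \<open>auto intro!: has_derivative_add simp: frechet_derivative_works[symmetric]\<close>)
qed

lemma C_k_bilinear:
  assumes "bounded_bilinear B"
  shows "C_k k f \<Longrightarrow> C_k k g \<Longrightarrow> C_k k (\<lambda>x. B (f x) (g x))"
proof (induction k arbitrary: f g)
  case 0
  then show ?case by (auto intro: bounded_bilinear.continuous_on[OF assms])
next
  case (Suc k)
  show ?case
  proof (rule C_k_SucI)
    show "((\<lambda>x. B (f x) (g x)) has_derivative
       (\<lambda>h. B (f x) (frechet_derivative g (at x) h) + B (frechet_derivative f (at x) h) (g x))) (at x)" for x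
      using Suc.prems by (intro bounded_bilinear.FDERIV[OF assms] C_k_Suc_has_derivative)
    show "C_k k (\<lambda>x. B (f x) (frechet_derivative g (at x) h) + B (frechet_derivative f (at x) h) (g x))" for h
      using C_k_SucD[OF Suc.prems(1)] C_k_SucD[OF Suc.prems(2)] Suc by (intro C_k_add Suc.IH) auto
  qed
qed

lemma C_k_affine:
  assumes L: "bounded_linear L"
  shows "C_k k f \<Longrightarrow> C_k k (\<lambda>x. f (c + L x))"
proof (induction k arbitrary: f)
  case 0
  have "continuous_on UNIV (\<lambda>x. c + L x)"
    using L by (intro continuous_intros linear_continuous_on)
  then show ?case using 0 by (auto intro: continuous_on_compose2)
next
  case (Suc k)
  show ?case
  proof (rule C_k_SucI)
    fix x
    have "((\<lambda>x. c + L x) has_derivative L) (at x)"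
      using L by (auto intro!: derivative_eq_intros bounded_linear_imp_has_derivative)
    from has_derivative_compose[OF this C_k_Suc_has_derivative[OF Suc.prems]]
    show "((\<lambda>x. f (c + L x)) has_derivative (\<lambda>h. frechet_derivative f (at (c + L x)) (L h))) (at x)" .
    show "C_k k (\<lambda>x. frechet_derivative f (at (c + L x)) (L h))" for h
      using Suc by (intro Suc.IH) auto
  qed
qed

text \<open>For a real outer function the chain rule is a product: the derivative of
  \<open>g\<close> in direction \<open>h\<close> times the scalar derivative of
  \<open>\<phi>\<close> at \<open>g x\<close>. The induction therefore closes with the product rule
  and the same claim for the derivative of \<open>\<phi>\<close>.\<close>

lemma C_k_compose_real:
  fixes \<phi> :: "real \<Rightarrow> real"
  shows "C_k k \<phi> \<Longrightarrow> C_k k g \<Longrightarrow> C_k k (\<lambda>x. \<phi> (g x))"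
proof (induction k arbitrary: \<phi>)
  case 0
  then show ?case by (auto intro: continuous_on_compose2)
next
  case (Suc k)
  show ?case
  proof (rule C_k_SucI)
    fix x
    have lin: "linear (frechet_derivative \<phi> (at (g x)))"
      using Suc.prems by (intro linear_frechet_derivative) auto
    have eq: "frechet_derivative \<phi> (at (g x)) r = r *\<^sub>R frechet_derivative \<phi> (at (g x)) 1" for r
      using linear_cmul[OF lin, of r 1] by (simp only: real_scaleR_def mult_1_right)
    show "((\<lambda>x. \<phi> (g x)) has_derivative
        (\<lambda>h. frechet_derivative g (at x) h *\<^sub>R frechet_derivative \<phi> (at (g x)) 1)) (at x)"
      unfolding eq[symmetric]
      by (rule has_derivative_compose[OF C_k_Suc_has_derivative[OF Suc.prems(2)] C_k_Suc_has_derivative[OF Suc.prems(1)]])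
    show "C_k k (\<lambda>x. frechet_derivative g (at x) h *\<^sub>R frechet_derivative \<phi> (at (g x)) 1)" for h
      by (rule C_k_bilinear[OF bounded_bilinear_scaleR _
            Suc.IH[of "\<lambda>y. frechet_derivative \<phi> (at y) 1", OF _ C_k_SucD[OF Suc.prems(2)]]])
        (use Suc.prems in auto)
  qed
qed

definition smooth :: "('a::real_normed_vector \<Rightarrow> 'b::real_normed_vector) \<Rightarrow> bool" where
  "smooth f \<longleftrightarrow> (\<forall>k. C_k k f)"

lemma smooth_has_derivative: "smooth f \<Longrightarrow> (f has_derivative frechet_derivative f (at x)) (at x)"
  unfolding smooth_def using C_k_Suc_has_derivative by blast

lemma smooth_frechet_derivative: "smooth f \<Longrightarrow> smooth (\<lambda>x. frechet_derivative f (at x) h)"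
  unfolding smooth_def by (metis C_k.simps(2))

lemma smooth_continuous: "smooth f \<Longrightarrow> continuous_on UNIV f"
  unfolding smooth_def using C_k_continuous by blast

lemma smooth_const: "smooth (\<lambda>x. c)"
  by (simp add: smooth_def C_k_const)

lemma smooth_bounded_linear: "bounded_linear L \<Longrightarrow> smooth L"
  by (simp add: smooth_def C_k_bounded_linear)

lemma smooth_add: "smooth f \<Longrightarrow> smooth g \<Longrightarrow> smooth (\<lambda>x. f x + g x)"
  by (simp add: smooth_def C_k_add)

lemma smooth_bilinear:
  "bounded_bilinear B \<Longrightarrow> smooth f \<Longrightarrow> smooth g \<Longrightarrow> smooth (\<lambda>x. B (f x) (g x))"
  by (simp add: smooth_def C_k_bilinear)

lemmas smooth_scaleR = smooth_bilinear[OF bounded_bilinear_scaleR]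
lemmas smooth_mult = smooth_bilinear[OF bounded_bilinear_mult]
lemmas smooth_inner = smooth_bilinear[OF bounded_bilinear_inner]

lemma smooth_diff: "smooth f \<Longrightarrow> smooth g \<Longrightarrow> smooth (\<lambda>x. f x - g x)"
  using smooth_add[of f "\<lambda>x. (-1) *\<^sub>R g x"] smooth_scaleR[OF smooth_const, of g "-1"] by simp

lemma smooth_affine: "bounded_linear L \<Longrightarrow> smooth f \<Longrightarrow> smooth (\<lambda>x. f (c + L x))"
  by (simp add: smooth_def C_k_affine)

lemma smooth_compose_real:
  "smooth (\<phi>::real \<Rightarrow> real) \<Longrightarrow> smooth g \<Longrightarrow> smooth (\<lambda>x. \<phi> (g x))"
  by (simp add: smooth_def C_k_compose_real)

text \<open>Heine-Borel turns the topological condition on the support into a norm bound, so later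
  constructions of test functions only exhibit smoothness and a radius.\<close>

lemma test_function_iff:
  fixes f :: "'a::euclidean_space \<Rightarrow> 'b::real_normed_vector"
  shows "test_function UNIV f \<longleftrightarrow> smooth f \<and> (\<exists>R. \<forall>x. f x \<noteq> 0 \<longrightarrow> norm x \<le> R)"
proof -
  have "compact (closure S) \<longleftrightarrow> (\<exists>R. \<forall>x\<in>S. norm x \<le> R)" for S :: "'a set"
    by (metis bounded_closure_image bounded_iff bounded_subset closure_subset compact_closure)
  then show ?thesis
    unfolding test_function_def smooth_def by auto
qed

lemma test_functionI:
  fixes f :: "'a::euclidean_space \<Rightarrow> 'b::real_normed_vector"
  assumes "smooth f" and "\<And>x. f x \<noteq> 0 \<Longrightarrow> norm x \<le> R"
  shows "test_function UNIV f"
  using assms test_function_iff by blast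

lemma test_function_smooth: "test_function \<Omega> f \<Longrightarrow> smooth f"
  by (simp add: test_function_def smooth_def)

lemma test_function_supportE:
  fixes f :: "'a::euclidean_space \<Rightarrow> 'b::real_normed_vector"
  assumes "test_function UNIV f"
  obtains R where "R > 0" "\<And>x. norm x > R \<Longrightarrow> f x = 0" "\<And>x h. norm x > R \<Longrightarrow> frechet_derivative f (at x) h = 0"
proof -
  obtain R0 where R0: "\<And>x. f x \<noteq> 0 \<Longrightarrow> norm x \<le> R0"
    using assms test_function_iff by blast
  define R where "R = max 1 R0"
  have z: "f x = 0" if "norm x > R" for x using R0[of x] that by (auto simp: R_def)
  have "frechet_derivative f (at x) h = 0" if "norm x > R" for x h
  proof -
    have "open {x::'a. norm x > R}" by (intro open_Collect_less continuous_intros)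
    then have "(f has_derivative (\<lambda>h. 0)) (at x)"
      using that z by (intro has_derivative_transform_within_open[OF has_derivative_const, where s = "{x. norm x > R}"]) auto
    then show ?thesis by (simp add: frechet_derivative_eq)
  qed
  with z show ?thesis by (intro that[of R]) (auto simp: R_def)
qed

lemma test_function_frechet_derivative:
  fixes f :: "'a::euclidean_space \<Rightarrow> 'b::real_normed_vector"
  assumes "test_function UNIV f"
  shows "test_function UNIV (\<lambda>x. frechet_derivative f (at x) h)"
proof -
  obtain R where R: "R > 0" "\<And>x. norm x > R \<Longrightarrow> frechet_derivative f (at x) h = 0"
    using test_function_supportE[OF assms] by metis
  show ?thesis
    using R(2) not_le
    by (intro test_functionI[where R=R] smooth_frechet_derivative test_function_smooth[OF assms]) blast
qed

lemma test_function_bounded: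
  fixes f :: "'a::euclidean_space \<Rightarrow> 'b::real_normed_vector"
  assumes "test_function UNIV f"
  obtains C where "C \<ge> 0" "\<And>x. norm (f x) \<le> C"
proof -
  obtain R where R: "R > 0" "\<And>x. norm x > R \<Longrightarrow> f x = 0"
    using test_function_supportE[OF assms] by metis
  have "compact (f ` cball 0 R)"
    by (intro compact_continuous_image continuous_on_subset[OF smooth_continuous[OF test_function_smooth[OF assms]]]) auto
  then obtain C where C: "\<And>x. x \<in> cball 0 R \<Longrightarrow> norm (f x) \<le> C"
    by (metis bounded_iff compact_imp_bounded imageI)
  have "norm (f x) \<le> max 0 C" for x
    using C[of x] R(2)[of x] by (cases "norm x \<le> R") (auto simp: dist_norm)
  then show ?thesis by (intro that[of "max 0 C"]) auto
qed

lemma test_function_reflect: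
  fixes f :: "'a::euclidean_space \<Rightarrow> 'b::real_normed_vector"
  assumes "test_function UNIV f"
  shows "test_function UNIV (\<lambda>y. f (x - y))"
proof -
  obtain R where R: "R > 0" "\<And>x. norm x > R \<Longrightarrow> f x = 0"
    using test_function_supportE[OF assms] by metis
  have "smooth (\<lambda>y. f (x + - y))"
    using test_function_smooth[OF assms] by (intro smooth_affine bounded_linear_minus bounded_linear_ident)
  moreover have "norm y \<le> R + norm x" if "f (x - y) \<noteq> 0" for y
    using R(2)[of "x-y"] that norm_triangle_ineq2[of y x] by (smt (verit) norm_minus_commute)
  ultimately show ?thesis
    by (intro test_functionI[where R = "R + norm x"]) auto
qed

lemma test_function_diff:
  fixes f :: "'a::euclidean_space \<Rightarrow> 'b::real_normed_vector"
  assumes "test_function UNIV f" "test_function UNIV g"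
  shows "test_function UNIV (\<lambda>x. f x - g x)"
proof -
  obtain R where R: "\<And>x. norm x > R \<Longrightarrow> f x = 0"
    using test_function_supportE[OF assms(1)] by metis
  obtain R' where R': "\<And>x. norm x > R' \<Longrightarrow> g x = 0"
    using test_function_supportE[OF assms(2)] by metis
  have "norm x \<le> max R R'" if "f x - g x \<noteq> 0" for x
    using that R[of x] R'[of x] by (smt (verit) diff_self)
  then show ?thesis
    using assms by (intro test_functionI[where R = "max R R'"] smooth_diff test_function_smooth)
qed

lemma test_function_scaleR:
  fixes f :: "'a::euclidean_space \<Rightarrow> 'b::real_normed_vector"
  assumes "smooth q" "test_function UNIV f"
  shows "test_function UNIV (\<lambda>x. q x *\<^sub>R f x)"
  using assms unfolding test_function_iff by (auto intro: smooth_scaleR)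

section \<open>Bump functions\<close>

text \<open>The polynomial factor in \<open>1/t\<close> makes the family closed under
  differentiation: with \<open>y = 1/t\<close>, the derivative of \<open>p(y) exp(-y)\<close> in
  \<open>t\<close> is \<open>y\<^sup>2 (p(y) - p'(y)) exp(-y)\<close>. Smoothness at 0 then follows
  by induction over the whole family.\<close>

definition flat :: "real poly \<Rightarrow> real \<Rightarrow> real" where
  "flat p t = (if t > 0 then poly p (1/t) * exp (- (1/t)) else 0)"

lemma flat_tendsto_0: "(flat p \<longlongrightarrow> 0) (at_right 0)"
proof -
  have "((\<lambda>y. \<Sum>i\<le>degree p. coeff p i * (y ^ i / exp y)) \<longlongrightarrow> (\<Sum>i\<le>degree p. coeff p i * 0)) at_top"
    by (intro tendsto_intros tendsto_power_div_exp_0)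
  then have "((\<lambda>y::real. poly p y * exp (-y)) \<longlongrightarrow> 0) at_top"
    by (simp add: poly_altdef sum_distrib_right exp_minus sum_divide_distrib divide_inverse mult.assoc)
  then have "((\<lambda>t. poly p (inverse t) * exp (- inverse t)) \<longlongrightarrow> 0) (at_right 0)"
    by (rule filterlim_compose[OF _ filterlim_inverse_at_top_right])
  then show ?thesis
    by (rule Lim_transform_eventually)
      (auto simp: eventually_at_right_field flat_def divide_simps intro!: exI[of _ 1])
qed

lemma flat_has_derivative: "(flat p has_real_derivative flat ([:0,0,1:] * (p - pderiv p)) t) (at t)"
proof -
  consider "t > 0" | "t < 0" | "t = 0" by linarith
  then show ?thesis
  proof cases
    case 1
    have "((\<lambda>t. poly p (1/t) * exp (- (1/t))) has_real_derivative flat ([:0,0,1:] * (p - pderiv p)) t) (at t)"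
      using 1 by (auto intro!: derivative_eq_intros DERIV_chain2[OF poly_DERIV] simp: flat_def) (simp add: field_simps power2_eq_square)
    then show ?thesis
      by (rule has_field_derivative_transform_within_open[where S = "{0<..}"]) (use 1 in \<open>auto simp: flat_def\<close>)
  next
    case 2
    have "((\<lambda>t. 0) has_real_derivative flat ([:0,0,1:] * (p - pderiv p)) t) (at t)"
      using 2 by (auto simp: flat_def)
    then show ?thesis
      by (rule has_field_derivative_transform_within_open[where S = "{..<0}"]) (use 2 in \<open>auto simp: flat_def\<close>)
  next
    case 3
    \<comment> \<open>Dividing by \<open>h\<close> multiplies the polynomial in \<open>1/h\<close>
      by its variable, so the right difference quotient at 0 is the member
      \<open>flat (pCons 0 p)\<close> of the same family, whose limit is known.\<close>
    have "((\<lambda>h. flat p h / h) \<longlongrightarrow> 0) (at_right 0)"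
      by (rule Lim_transform_eventually[OF flat_tendsto_0[of "pCons 0 p"]])
        (auto simp: eventually_at_right_field flat_def divide_simps intro!: exI[of _ 1])
    moreover have "((\<lambda>h. flat p h / h) \<longlongrightarrow> 0) (at_left 0)"
      by (rule Lim_transform_eventually[OF tendsto_const])
        (auto simp: eventually_at_left_field flat_def intro!: exI[of _ "-1"])
    ultimately have "((\<lambda>h. flat p h / h) \<longlongrightarrow> 0) (at 0)"
      using filterlim_split_at by blast
    then show ?thesis
      unfolding 3 by (simp add: has_field_derivative_iff flat_def)
  qed
qed

lemma smooth_flat: "smooth (flat p)"
proof -
  \<comment> \<open>The constant \<open>c\<close> takes up the direction \<open>h\<close>, which
    appears as a factor of the directional derivative.\<close>
  have "C_k k (\<lambda>t. c * flat p t)" for k c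
  proof (induction k arbitrary: p c)
    case 0
    show ?case
      using DERIV_isCont[OF flat_has_derivative] by (auto intro!: continuous_intros continuous_at_imp_continuous_on)
  next
    case (Suc k)
    show ?case
    proof (rule C_k_SucI)
      show "((\<lambda>t. c * flat p t) has_derivative (\<lambda>h. c * h * flat ([:0,0,1:] * (p - pderiv p)) t)) (at t)" for t
        using flat_has_derivative[of p t]
        by (auto intro!: derivative_eq_intros simp: has_field_derivative_def fun_eq_iff)
      show "C_k k (\<lambda>t. c * h * flat ([:0,0,1:] * (p - pderiv p)) t)" for h
        by (rule Suc)
    qed
  qed
  from this[of _ 1] show ?thesis by (simp add: smooth_def)
qed

definition bump :: "'a::euclidean_space \<Rightarrow> real" where
  "bump x = flat 1 (1 - x \<bullet> x)"

lemma bump_nonneg: "bump x \<ge> 0"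
  by (simp add: bump_def flat_def)

lemma bump_pos_iff: "bump x > 0 \<longleftrightarrow> norm x < 1"
  by (auto simp: bump_def flat_def norm_eq_sqrt_inner)

lemma bump_eq_0: "norm x \<ge> 1 \<Longrightarrow> bump x = 0"
  using bump_pos_iff[of x] bump_nonneg[of x] by linarith

lemma bump_minus: "bump (- x) = bump x"
  by (simp add: bump_def)

lemma test_function_bump: "test_function UNIV (bump :: 'a::euclidean_space \<Rightarrow> real)"
proof (rule test_functionI)
  show "smooth (bump :: 'a \<Rightarrow> real)"
    unfolding bump_def[abs_def]
    by (rule smooth_compose_real[OF smooth_flat smooth_diff[OF smooth_const smooth_inner]])
      (rule smooth_bounded_linear[OF bounded_linear_ident])+
  show "norm x \<le> 1" if "bump x \<noteq> 0" for x :: 'a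
    using bump_eq_0[of x] that by linarith
qed

section \<open>Square integrable functions\<close>

text \<open>Square integrability for Borel functions and \<open>lborel\<close>, not for Lebesgue
  measurable ones as in \<open>in_L2\<close>: Borel measurability survives the compositions with
  \<open>x - y\<close> or \<open>s\<^sup>2 *\<^sub>R x\<close> that the Fubini arguments need. Borel
  representatives provide the translation.\<close>

definition l2 :: "('a::euclidean_space \<Rightarrow> 'b::euclidean_space) \<Rightarrow> bool" where
  "l2 f \<longleftrightarrow> f \<in> borel_measurable borel \<and> integrable lborel (\<lambda>x. (norm (f x))\<^sup>2)"

definition ip :: "('a::euclidean_space \<Rightarrow> 'b::euclidean_space) \<Rightarrow> ('a \<Rightarrow> 'b) \<Rightarrow> real" where
  "ip f g = (LINT x|lborel. f x \<bullet> g x)"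

definition n2 :: "('a::euclidean_space \<Rightarrow> 'b::euclidean_space) \<Rightarrow> real" where
  "n2 f = sqrt (ip f f)"

lemma l2_measurable [measurable_dest]: "l2 f \<Longrightarrow> f \<in> borel_measurable borel"
  by (simp add: l2_def)

lemma l2_integrable: "l2 f \<Longrightarrow> integrable lborel (\<lambda>x. (norm (f x))\<^sup>2)"
  by (simp add: l2_def)

lemma l2I_bound:
  assumes [measurable]: "f \<in> borel_measurable borel"
    and "integrable lborel g" and "\<And>x. (norm (f x))\<^sup>2 \<le> g x"
  shows "l2 f"
  unfolding l2_def
proof
  show "integrable lborel (\<lambda>x. (norm (f x))\<^sup>2)"
    by (rule Bochner_Integration.integrable_bound[OF assms(2)])
      (use assms(3) in \<open>auto intro!: AE_I2 order_trans[OF _ abs_ge_self]\<close>)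
qed fact

lemma abs_inner_le_squares: "\<bar>a \<bullet> b\<bar> \<le> (norm a)\<^sup>2 + (norm (b::'a::real_inner))\<^sup>2"
proof -
  have "\<bar>a \<bullet> b\<bar> \<le> norm a * norm b" by (rule Cauchy_Schwarz_ineq2)
  also have "\<dots> \<le> (norm a)\<^sup>2 + (norm b)\<^sup>2"
    using sum_squares_bound[of "norm a" "norm b"] mult_nonneg_nonneg[OF norm_ge_zero[of a] norm_ge_zero[of b]]
    by linarith
  finally show ?thesis .
qed

lemma l2_inner_integrable: "l2 f \<Longrightarrow> l2 g \<Longrightarrow> integrable lborel (\<lambda>x. f x \<bullet> g x)"
  by (rule Bochner_Integration.integrable_bound[of _ "\<lambda>x. (norm (f x))\<^sup>2 + (norm (g x))\<^sup>2"])
    (auto intro!: Bochner_Integration.integrable_add l2_integrable AE_I2 abs_inner_le_squares[THEN order_trans])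

lemma ip_self: "ip f f = (LINT x|lborel. (norm (f x))\<^sup>2)"
  by (simp add: ip_def dot_square_norm)

lemma ip_self_nonneg: "ip f f \<ge> 0"
  by (simp add: ip_self)

lemma n2_nonneg [simp]: "n2 f \<ge> 0"
  by (simp add: n2_def ip_self)

lemma n2_power2: "(n2 f)\<^sup>2 = ip f f"
  by (simp add: n2_def ip_self_nonneg)

lemma n2_power2_int: "(n2 f)\<^sup>2 = (LINT x|lborel. (norm (f x))\<^sup>2)"
  by (simp add: n2_power2 ip_self)

lemma ip_commute: "ip f g = ip g f"
  by (simp add: ip_def inner_commute)

lemma l2_scaleR: "l2 f \<Longrightarrow> l2 (\<lambda>x. c *\<^sub>R f x)"
  by (auto simp: l2_def power_mult_distrib)

lemma l2_add:
  assumes "l2 f" "l2 g"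
  shows "l2 (\<lambda>x. f x + g x)"
proof (rule l2I_bound)
  show "integrable lborel (\<lambda>x. (norm (f x))\<^sup>2 + (norm (g x))\<^sup>2 + 2 * (f x \<bullet> g x))"
    using assms by (intro Bochner_Integration.integrable_add l2_integrable integrable_mult_right l2_inner_integrable)
qed (use assms in \<open>auto simp: power2_norm_eq_inner inner_simps inner_commute\<close>)

lemma l2_diff: "l2 f \<Longrightarrow> l2 g \<Longrightarrow> l2 (\<lambda>x. f x - g x)"
  using l2_add[of f "\<lambda>x. (-1) *\<^sub>R g x"] l2_scaleR[of g "-1"] by simp

lemma l2_zero: "l2 (\<lambda>x. 0)"
  by (simp add: l2_def)

lemma l2_sum: "(\<And>i. i \<in> I \<Longrightarrow> l2 (f i)) \<Longrightarrow> l2 (\<lambda>x. \<Sum>i\<in>I. f i x)"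
  by (induction I rule: infinite_finite_induct) (auto intro: l2_add l2_zero)

lemma ip_add_left: "l2 f \<Longrightarrow> l2 g \<Longrightarrow> l2 h \<Longrightarrow> ip (\<lambda>x. f x + g x) h = ip f h + ip g h"
  unfolding ip_def by (simp add: inner_add_left l2_inner_integrable)

lemma ip_diff_left: "l2 f \<Longrightarrow> l2 g \<Longrightarrow> l2 h \<Longrightarrow> ip (\<lambda>x. f x - g x) h = ip f h - ip g h"
  unfolding ip_def by (simp add: inner_diff_left l2_inner_integrable)

lemma ip_add_right: "l2 f \<Longrightarrow> l2 g \<Longrightarrow> l2 h \<Longrightarrow> ip h (\<lambda>x. f x + g x) = ip h f + ip h g"
  unfolding ip_def by (simp add: inner_add_right l2_inner_integrable)

lemma ip_diff_right: "l2 f \<Longrightarrow> l2 g \<Longrightarrow> l2 h \<Longrightarrow> ip h (\<lambda>x. f x - g x) = ip h f - ip h g"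
  unfolding ip_def by (simp add: inner_diff_right l2_inner_integrable)

lemma ip_scaleR_left: "ip (\<lambda>x. c *\<^sub>R f x) g = c * ip f g"
  unfolding ip_def by simp

lemma ip_scaleR_right: "ip f (\<lambda>x. c *\<^sub>R g x) = c * ip f g"
  unfolding ip_def by simp

lemma ip_sum_left:
  "(\<And>i. i \<in> I \<Longrightarrow> l2 (f i)) \<Longrightarrow> l2 h \<Longrightarrow> ip (\<lambda>x. \<Sum>i\<in>I. f i x) h = (\<Sum>i\<in>I. ip (f i) h)"
  unfolding ip_def by (simp add: inner_sum_left l2_inner_integrable)

lemma ip_Cauchy_Schwarz:
  assumes f: "l2 f" and g: "l2 g"
  shows "\<bar>ip f g\<bar> \<le> n2 f * n2 g"
proof -
  have nonneg: "0 \<le> ip f f + 2 * t * ip f g + t\<^sup>2 * ip g g" for t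
  proof -
    have "0 \<le> ip (\<lambda>x. f x + t *\<^sub>R g x) (\<lambda>x. f x + t *\<^sub>R g x)" by (rule ip_self_nonneg)
    also have "\<dots> = ip f f + 2 * t * ip f g + t\<^sup>2 * ip g g"
      using f g by (simp add: ip_add_left ip_add_right ip_scaleR_left ip_scaleR_right l2_add l2_scaleR
          ip_commute[of g f] power2_eq_square algebra_simps)
    finally show ?thesis .
  qed
  have "(ip f g)\<^sup>2 \<le> ip f f * ip g g"
  proof (cases "ip g g = 0")
    case True
    have "ip f g = 0"
    proof (rule ccontr)
      assume ne: "ip f g \<noteq> 0"
      \<comment> \<open>With this value of \<open>t\<close> the quadratic, here affine in
        \<open>t\<close>, equals \<open>-1\<close>.\<close>
      then show False
        using nonneg[of "- (ip f f + 1) / (2 * ip f g)"] True by (simp add: field_simps)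
    qed
    then show ?thesis by (simp add: True)
  next
    case False
    then have pos: "ip g g > 0" using ip_self_nonneg[of g] by linarith
    then show ?thesis
      using nonneg[of "- ip f g / ip g g"] by (simp add: field_simps power2_eq_square)
  qed
  then have "sqrt ((ip f g)\<^sup>2) \<le> sqrt (ip f f * ip g g)" by (rule real_sqrt_le_mono)
  then show ?thesis by (simp add: n2_def real_sqrt_mult)
qed

lemma n2_triangle:
  assumes "l2 f" "l2 g"
  shows "n2 (\<lambda>x. f x + g x) \<le> n2 f + n2 g"
proof (rule power2_le_imp_le)
  have "(n2 (\<lambda>x. f x + g x))\<^sup>2 = (n2 f)\<^sup>2 + 2 * ip f g + (n2 g)\<^sup>2"
    using assms by (simp add: n2_power2 ip_add_left ip_add_right l2_add ip_commute[of g f])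
  also have "\<dots> \<le> (n2 f + n2 g)\<^sup>2"
    using ip_Cauchy_Schwarz[OF assms] by (simp add: power2_sum)
  finally show "(n2 (\<lambda>x. f x + g x))\<^sup>2 \<le> (n2 f + n2 g)\<^sup>2" .
qed simp

lemma n2_scaleR: "n2 (\<lambda>x. c *\<^sub>R f x) = \<bar>c\<bar> * n2 f"
  by (simp add: n2_def ip_scaleR_left ip_scaleR_right real_sqrt_mult flip: mult.assoc)

lemma n2_diff_commute: "n2 (\<lambda>x. f x - g x) = n2 (\<lambda>x. g x - f x)"
  by (simp add: n2_def ip_self norm_minus_commute)

lemma n2_triangle_diff:
  assumes "l2 f" "l2 g"
  shows "n2 (\<lambda>x. f x - g x) \<le> n2 f + n2 g"
  using n2_triangle[OF assms(1) l2_scaleR[OF assms(2), of "-1"]] n2_scaleR[of "-1" g] by simp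

lemma n2_diff_triangle:
  assumes "l2 f" "l2 g" "l2 h"
  shows "n2 (\<lambda>x. f x - h x) \<le> n2 (\<lambda>x. f x - g x) + n2 (\<lambda>x. g x - h x)"
  using n2_triangle[OF l2_diff[OF assms(1,2)] l2_diff[OF assms(2,3)]] by simp

lemma n2_mono:
  assumes "l2 g" "\<And>x. norm (f x) \<le> norm (g x)" "f \<in> borel_measurable borel"
  shows "l2 f" "n2 f \<le> n2 g"
proof -
  have *: "(norm (f x))\<^sup>2 \<le> (norm (g x))\<^sup>2" for x
    using assms(2) by (simp add: power_mono)
  show l2f: "l2 f" by (rule l2I_bound[OF assms(3) l2_integrable[OF assms(1)]]) (rule *)
  show "n2 f \<le> n2 g"
    unfolding n2_def ip_self using * l2f assms(1)
    by (intro real_sqrt_le_mono integral_mono l2_integrable)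
qed

lemma l2_mult_bounded:
  fixes q :: "'a::euclidean_space \<Rightarrow> real"
  assumes f: "l2 f" and q: "q \<in> borel_measurable borel" "\<And>x. \<bar>q x\<bar> \<le> C"
  shows "l2 (\<lambda>x. q x *\<^sub>R f x)" "n2 (\<lambda>x. q x *\<^sub>R f x) \<le> C * n2 f"
proof -
  have C: "C \<ge> 0" using q(2)[of 0] by linarith
  have *: "norm (q x *\<^sub>R f x) \<le> norm (C *\<^sub>R f x)" for x
    using q(2)[of x] C by (simp add: mult_right_mono)
  have m: "(\<lambda>x. q x *\<^sub>R f x) \<in> borel_measurable borel" using q f by measurable
  show "l2 (\<lambda>x. q x *\<^sub>R f x)" by (rule n2_mono(1)[OF l2_scaleR[OF f] * m])
  show "n2 (\<lambda>x. q x *\<^sub>R f x) \<le> C * n2 f"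
    using n2_mono(2)[OF l2_scaleR[OF f] * m] C by (simp add: n2_scaleR)
qed

lemma n2_tendsto_0I_AE:
  assumes f: "\<And>n. l2 (f n)" and w: "integrable lborel w"
    and bound: "\<And>n. AE x in lborel. (norm (f n x))\<^sup>2 \<le> w x"
    and lim: "AE x in lborel. (\<lambda>n. f n x) \<longlonglongrightarrow> 0"
  shows "(\<lambda>n. n2 (f n)) \<longlonglongrightarrow> 0"
proof -
  have "(\<lambda>n. LINT x|lborel. (norm (f n x))\<^sup>2) \<longlonglongrightarrow> (LINT (x::'a)|lborel. 0)"
  proof (rule integral_dominated_convergence[OF _ _ w])
    show "AE x in lborel. (\<lambda>n. (norm (f n x))\<^sup>2) \<longlonglongrightarrow> 0"
      using lim by eventually_elim (auto intro!: tendsto_eq_intros)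
    show "(\<lambda>x. (norm (f n x))\<^sup>2) \<in> borel_measurable lborel" for n
      using f[of n] by measurable
  qed (use bound in auto)
  then have "(\<lambda>n. sqrt (LINT x|lborel. (norm (f n x))\<^sup>2)) \<longlonglongrightarrow> sqrt 0"
    by (intro tendsto_real_sqrt) simp
  then show ?thesis by (simp add: n2_def ip_self)
qed

lemma n2_tendsto_0I:
  assumes "\<And>n. l2 (f n)" "integrable lborel w" "\<And>n x. (norm (f n x))\<^sup>2 \<le> w x"
    and "AE x in lborel. (\<lambda>n. f n x) \<longlonglongrightarrow> 0"
  shows "(\<lambda>n. n2 (f n)) \<longlonglongrightarrow> 0"
  using assms by (intro n2_tendsto_0I_AE[where w = w]) auto

lemma ip_tendsto:
  assumes f: "\<And>n. l2 (f n)" "l2 f'" "(\<lambda>n. n2 (\<lambda>x. f n x - f' x)) \<longlonglongrightarrow> 0"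
    and g: "\<And>n. l2 (g n)" "l2 g'" "(\<lambda>n. n2 (\<lambda>x. g n x - g' x)) \<longlonglongrightarrow> 0"
  shows "(\<lambda>n. ip (f n) (g n)) \<longlonglongrightarrow> ip f' g'"
proof (rule Lim_null_comparison[THEN Lim_null[THEN iffD2]])
  show "\<forall>\<^sub>F n in sequentially. norm (ip (f n) (g n) - ip f' g') \<le>
      n2 (\<lambda>x. f n x - f' x) * (n2 (\<lambda>x. g n x - g' x) + n2 g') + n2 f' * n2 (\<lambda>x. g n x - g' x)"
  proof (intro always_eventually allI)
    fix n
    have "ip (f n) (g n) - ip f' g' = ip (\<lambda>x. f n x - f' x) (g n) + ip f' (\<lambda>x. g n x - g' x)"
      using f g by (simp add: ip_diff_left ip_diff_right)
    moreover have "\<bar>ip (\<lambda>x. f n x - f' x) (g n)\<bar> \<le> n2 (\<lambda>x. f n x - f' x) * n2 (g n)"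
      using f g by (intro ip_Cauchy_Schwarz l2_diff)
    moreover have "n2 (g n) \<le> n2 (\<lambda>x. g n x - g' x) + n2 g'"
      using n2_triangle[OF l2_diff[OF g(1)[of n] g(2)] g(2)] by simp
    then have "n2 (\<lambda>x. f n x - f' x) * n2 (g n) \<le> n2 (\<lambda>x. f n x - f' x) * (n2 (\<lambda>x. g n x - g' x) + n2 g')"
      by (rule mult_left_mono) simp
    moreover have "\<bar>ip f' (\<lambda>x. g n x - g' x)\<bar> \<le> n2 f' * n2 (\<lambda>x. g n x - g' x)"
      using f g by (intro ip_Cauchy_Schwarz l2_diff)
    ultimately show "norm (ip (f n) (g n) - ip f' g') \<le>
      n2 (\<lambda>x. f n x - f' x) * (n2 (\<lambda>x. g n x - g' x) + n2 g') + n2 f' * n2 (\<lambda>x. g n x - g' x)"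
      by simp
  qed
  show "(\<lambda>n. n2 (\<lambda>x. f n x - f' x) * (n2 (\<lambda>x. g n x - g' x) + n2 g') + n2 f' * n2 (\<lambda>x. g n x - g' x)) \<longlonglongrightarrow> 0"
    using f(3) g(3) by (auto intro!: tendsto_eq_intros)
qed

section \<open>Affine changes of variables and Fubini\<close>

lemma lborel_affine_integral:
  fixes f :: "'a::euclidean_space \<Rightarrow> 'b::{banach, second_countable_topology}"
  assumes [measurable]: "f \<in> borel_measurable borel" and c: "c \<noteq> 0"
  shows "integrable lborel (\<lambda>x. f (t + c *\<^sub>R x)) \<longleftrightarrow> integrable lborel f"
    and "(LINT x|lborel. f x) = \<bar>c\<bar> ^ DIM('a) *\<^sub>R (LINT x|lborel. f (t + c *\<^sub>R x))"
proof -
  have "integrable lborel f \<longleftrightarrow> integrable (density (distr lborel borel (\<lambda>x. t + c *\<^sub>R x)) (\<lambda>_. \<bar>c\<bar>^DIM('a))) f"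
    using lborel_affine[OF c, of t] by simp
  also have "\<dots> \<longleftrightarrow> integrable lborel (\<lambda>x. \<bar>c\<bar>^DIM('a) *\<^sub>R f (t + c *\<^sub>R x))"
    by (subst integrable_density) (auto simp: integrable_distr_eq)
  also have "\<dots> \<longleftrightarrow> integrable lborel (\<lambda>x. f (t + c *\<^sub>R x))"
    using c integrable_scaleR_right[of "inverse (\<bar>c\<bar> ^ DIM('a))" lborel "\<lambda>x. \<bar>c\<bar>^DIM('a) *\<^sub>R f (t + c *\<^sub>R x)"]
    by (auto simp: field_simps)
  finally show "integrable lborel (\<lambda>x. f (t + c *\<^sub>R x)) \<longleftrightarrow> integrable lborel f" by simp
  have "(LINT x|lborel. f x) = (LINT x|density (distr lborel borel (\<lambda>x. t + c *\<^sub>R x)) (\<lambda>_. \<bar>c\<bar>^DIM('a)). f x)"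
    using lborel_affine[OF c, of t] by simp
  also have "\<dots> = \<bar>c\<bar> ^ DIM('a) *\<^sub>R (LINT x|lborel. f (t + c *\<^sub>R x))"
    by (subst integral_density) (auto simp: integral_distr)
  finally show "(LINT x|lborel. f x) = \<bar>c\<bar> ^ DIM('a) *\<^sub>R (LINT x|lborel. f (t + c *\<^sub>R x))" .
qed

lemma lborel_translate_integral:
  fixes f :: "'a::euclidean_space \<Rightarrow> 'b::{banach, second_countable_topology}"
  assumes "f \<in> borel_measurable borel"
  shows "integrable lborel (\<lambda>x. f (x + t)) \<longleftrightarrow> integrable lborel f"
    and "(LINT x|lborel. f (x + t)) = (LINT x|lborel. f x)"
    and "integrable lborel (\<lambda>x. f (x - t)) \<longleftrightarrow> integrable lborel f"
    and "(LINT x|lborel. f (x - t)) = (LINT x|lborel. f x)"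
    and "integrable lborel (\<lambda>x. f (t - x)) \<longleftrightarrow> integrable lborel f"
    and "(LINT x|lborel. f (t - x)) = (LINT x|lborel. f x)"
  using lborel_affine_integral[OF assms, of 1 t] lborel_affine_integral[OF assms, of 1 "-t"]
    lborel_affine_integral[OF assms, of "-1" t]
  by (simp_all add: add.commute)

text \<open>By translation invariance the inner integral of the absolute value is the L1 norm of
  \<open>k\<close> times the norm of \<open>g\<close>. Both placements of the argument of
  \<open>g\<close> occur: the adjoint formula dominates a product of values at \<open>x\<close> and
  \<open>y\<close> by the sum of their squares.\<close>

lemma pair_kernel_integrable:
  fixes k :: "'a::euclidean_space \<Rightarrow> real" and g :: "'a \<Rightarrow> 'b::{banach, second_countable_topology}"
  assumes k: "integrable lborel k" and g: "integrable lborel g"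
  shows "integrable (lborel \<Otimes>\<^sub>M lborel) (\<lambda>(x, y). k (x - y) *\<^sub>R g y)"
    and "integrable (lborel \<Otimes>\<^sub>M lborel) (\<lambda>(x, y). k (x - y) *\<^sub>R g x)"
proof -
  have [measurable]: "k \<in> borel_measurable borel" "g \<in> borel_measurable borel"
    using k g by (auto dest: borel_measurable_integrable)
  have "integrable (lborel \<Otimes>\<^sub>M lborel) (\<lambda>(y, x). k (x - y) *\<^sub>R g y)"
  proof (rule lborel_pair.Fubini_integrable)
    show "(\<lambda>(y, x). k (x - y) *\<^sub>R g y) \<in> borel_measurable (lborel \<Otimes>\<^sub>M lborel)" by measurable
    have "(LINT x|lborel. norm (case (y, x) of (y, x) \<Rightarrow> k (x - y) *\<^sub>R g y)) = (LINT x|lborel. \<bar>k x\<bar>) * norm (g y)" for y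
      using lborel_translate_integral(4)[of "\<lambda>x. \<bar>k x\<bar>" y] by simp
    then show "integrable lborel (\<lambda>y. LINT x|lborel. norm (case (y, x) of (y, x) \<Rightarrow> k (x - y) *\<^sub>R g y))"
      using integrable_mult_right[OF integrable_norm[OF g]] by presburger
    show "AE y in lborel. integrable lborel (\<lambda>x. case (y, x) of (y, x) \<Rightarrow> k (x - y) *\<^sub>R g y)"
      using k by (auto simp: lborel_translate_integral)
  qed
  from lborel_pair.integrable_product_swap[OF this]
  show "integrable (lborel \<Otimes>\<^sub>M lborel) (\<lambda>(x, y). k (x - y) *\<^sub>R g y)" by (simp add: case_prod_unfold)
  show "integrable (lborel \<Otimes>\<^sub>M lborel) (\<lambda>(x, y). k (x - y) *\<^sub>R g x)"
  proof (rule lborel_pair.Fubini_integrable)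
    show "(\<lambda>(x, y). k (x - y) *\<^sub>R g x) \<in> borel_measurable (lborel \<Otimes>\<^sub>M lborel)" by measurable
    have "(LINT y|lborel. norm (case (x, y) of (x, y) \<Rightarrow> k (x - y) *\<^sub>R g x)) = (LINT x|lborel. \<bar>k x\<bar>) * norm (g x)" for x
      using lborel_translate_integral(6)[of "\<lambda>x. \<bar>k x\<bar>" x] by simp
    then show "integrable lborel (\<lambda>x. LINT y|lborel. norm (case (x, y) of (x, y) \<Rightarrow> k (x - y) *\<^sub>R g x))"
      using integrable_mult_right[OF integrable_norm[OF g]] by presburger
    show "AE x in lborel. integrable lborel (\<lambda>y. case (x, y) of (x, y) \<Rightarrow> k (x - y) *\<^sub>R g x)"
      using k by (auto simp: lborel_translate_integral)
  qed
qed

text \<open>The integral of \<open>h (x + e) - h x\<close> vanishes by translation invariance; write the difference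
  as an integral of the derivative along the segment.\<close>

lemma integral_directional_derivative_eq_0:
  fixes h :: "'a::euclidean_space \<Rightarrow> real"
  assumes der: "\<And>x. (h has_derivative h' x) (at x)"
    and int: "integrable lborel h" and int': "integrable lborel (\<lambda>x. h' x e)"
    and cont: "continuous_on UNIV (\<lambda>x. h' x e)"
  shows "(LINT x|lborel. h' x e) = 0"
proof -
  define K where "K = (\<lambda>x. h' x e)"
  have [measurable]: "h \<in> borel_measurable borel" "K \<in> borel_measurable borel"
    using int int' by (auto dest: borel_measurable_integrable simp: K_def)
  have seg: "(LINT t|lborel. indicat_real {0..1} t *\<^sub>R K (x + t *\<^sub>R e)) = h (x + e) - h x" for x
  proof -
    have lin: "linear (h' y)" for y using der by (rule has_derivative_linear)
    have "((\<lambda>t. h (x + t *\<^sub>R e)) has_vector_derivative K (x + t *\<^sub>R e)) (at t)" for t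
    proof -
      have "((\<lambda>t. x + t *\<^sub>R e) has_derivative (\<lambda>s. s *\<^sub>R e)) (at t)"
        by (auto intro!: derivative_eq_intros)
      from has_derivative_compose[OF this der]
      show ?thesis
        by (simp add: has_vector_derivative_def linear_cmul[OF lin] K_def)
    qed
    moreover have "continuous_on {0..1} (\<lambda>t. K (x + t *\<^sub>R e))"
      unfolding K_def by (rule continuous_on_compose2[OF cont]) (auto intro!: continuous_intros)
    ultimately have "has_bochner_integral lborel (\<lambda>t. indicat_real {0..1} t *\<^sub>R K (x + t *\<^sub>R e)) (h (x + 1 *\<^sub>R e) - h (x + 0 *\<^sub>R e))"
      by (intro has_bochner_integral_FTC_Icc[where F = "\<lambda>t. h (x + t *\<^sub>R e)"]) (auto intro: has_vector_derivative_at_within)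
    then show ?thesis by (auto dest: has_bochner_integral_integral_eq)
  qed
  have "integrable (lborel \<Otimes>\<^sub>M lborel) (\<lambda>(t, x). indicat_real {0..1} t *\<^sub>R K (x + t *\<^sub>R e))"
  proof (rule lborel_pair.Fubini_integrable)
    show "(\<lambda>(t, x). indicat_real {0..1} t *\<^sub>R K (x + t *\<^sub>R e)) \<in> borel_measurable (lborel \<Otimes>\<^sub>M lborel)"
      by measurable
    have "(LINT x|lborel. norm (case (t, x) of (t, x) \<Rightarrow> indicat_real {0..1} t *\<^sub>R K (x + t *\<^sub>R e)))
        = indicat_real {0..1} t * (LINT x|lborel. \<bar>K x\<bar>)" for t
      using lborel_translate_integral(2)[of "\<lambda>x. \<bar>K x\<bar>" "t *\<^sub>R e"] by (simp add: abs_mult)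
    then show "integrable lborel (\<lambda>t. LINT x|lborel. norm (case (t, x) of (t, x) \<Rightarrow> indicat_real {0..1} t *\<^sub>R K (x + t *\<^sub>R e)))"
      by (simp add: borel_integrable_atLeastAtMost')
    show "AE t in lborel. integrable lborel (\<lambda>x. case (t, x) of (t, x) \<Rightarrow> indicat_real {0..1} t *\<^sub>R K (x + t *\<^sub>R e))"
      using int' lborel_translate_integral(1)[of K] by (auto simp: K_def[symmetric])
  qed
  from lborel_pair.Fubini_integral[OF this]
  have "(LINT x|lborel. LINT t|lborel. indicat_real {0..1} t *\<^sub>R K (x + t *\<^sub>R e))
      = (LINT t|lborel. LINT x|lborel. indicat_real {0..1} t *\<^sub>R K (x + t *\<^sub>R e))" .
  also have "\<dots> = (LINT t::real|lborel. indicat_real {0..1} t * (LINT x|lborel. K x))"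
    by (simp add: lborel_translate_integral)
  also have "\<dots> = (LINT x|lborel. K x)" by simp
  finally have "(LINT x|lborel. K x) = (LINT x|lborel. h (x + e) - h x)"
    by (simp only: seg)
  also have "\<dots> = 0"
    using int by (simp add: lborel_translate_integral)
  finally show ?thesis by (simp add: K_def)
qed

section \<open>Convolution with test functions\<close>

definition conv :: "('a::euclidean_space \<Rightarrow> real) \<Rightarrow> ('a \<Rightarrow> 'b::euclidean_space) \<Rightarrow> 'a \<Rightarrow> 'b" where
  "conv k f x = (LINT y|lborel. k (x - y) *\<^sub>R f y)"

text \<open>Integrability on balls is what convolution with a compactly supported kernel requires.
  It covers square integrable fields as well as functions that are merely bounded, such as a
  constant continuation in time.\<close>

definition loc_int :: "('a::euclidean_space \<Rightarrow> 'b::euclidean_space) \<Rightarrow> bool" where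
  "loc_int f \<longleftrightarrow> f \<in> borel_measurable borel \<and> (\<forall>R. integrable lborel (\<lambda>x. indicat_real (cball 0 R) x *\<^sub>R norm (f x)))"

lemma integrable_cball_const: "integrable lborel (\<lambda>x::'a::euclidean_space. indicat_real (cball 0 R) x *\<^sub>R (c::real))"
proof -
  have "integrable lborel (indicat_real (cball 0 R :: 'a set))"
    using emeasure_lborel_cball_finite[of "0::'a" R] by (intro integrable_real_indicator) auto
  then show ?thesis by simp
qed

lemma loc_int_l2:
  assumes "l2 f" shows "loc_int f"
  unfolding loc_int_def
proof (intro conjI allI)
  show [measurable]: "f \<in> borel_measurable borel" using assms by (simp add: l2_def)
  fix R
  show "integrable lborel (\<lambda>x. indicat_real (cball 0 R) x *\<^sub>R norm (f x))"
  proof (rule Bochner_Integration.integrable_bound)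
    show "integrable lborel (\<lambda>x. indicat_real (cball 0 R) x *\<^sub>R 1 + (norm (f x))\<^sup>2)"
      using assms by (intro Bochner_Integration.integrable_add integrable_cball_const l2_integrable)
    have "norm (f x) \<le> 1 + (norm (f x))\<^sup>2" for x
      using sum_squares_bound[of 1 "norm (f x)"] norm_ge_zero[of "f x"] unfolding power_one mult_1_right by linarith
    then show "AE x in lborel. norm (indicat_real (cball 0 R) x *\<^sub>R norm (f x)) \<le> norm (indicat_real (cball 0 R) x *\<^sub>R 1 + (norm (f x))\<^sup>2)"
      by (auto simp: indicator_def)
  qed (measurable, use assms in \<open>auto simp: l2_def\<close>)
qed

lemma loc_int_bounded:
  assumes [measurable]: "f \<in> borel_measurable borel" and "\<And>x. norm (f x) \<le> M"
  shows "loc_int f"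
  unfolding loc_int_def
proof (intro conjI allI)
  fix R
  show "integrable lborel (\<lambda>x. indicat_real (cball 0 R) x *\<^sub>R norm (f x))"
    by (rule Bochner_Integration.integrable_bound[OF integrable_cball_const[of R M]])
      (use assms(2) in \<open>auto simp: indicator_def intro!: AE_I2 order_trans[OF _ abs_ge_self]\<close>)
qed fact

lemma test_function_measurable:
  "test_function UNIV k \<Longrightarrow> k \<in> borel_measurable borel"
  by (intro borel_measurable_continuous_onI smooth_continuous test_function_smooth)

lemma test_function_bound_indicator:
  fixes k :: "'a::euclidean_space \<Rightarrow> 'b::real_normed_vector"
  assumes "test_function UNIV k"
  obtains C R where "C \<ge> 0" "R > 0" "\<And>x. norm (k x) \<le> indicat_real (cball 0 R) x * C"
proof -
  obtain C where C: "C \<ge> 0" "\<And>x. norm (k x) \<le> C" using test_function_bounded[OF assms] by metis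
  obtain R where R: "R > 0" "\<And>x. norm x > R \<Longrightarrow> k x = 0" using test_function_supportE[OF assms] by metis
  show ?thesis
    by (rule that[OF C(1) R(1)]) (use C R(2) in \<open>auto simp: indicator_def\<close>)
qed

lemma test_function_integrable:
  fixes k :: "'a::euclidean_space \<Rightarrow> 'b::euclidean_space"
  assumes "test_function UNIV k"
  shows "integrable lborel k"
proof -
  obtain C R where C: "C \<ge> 0" "\<And>x. norm (k x) \<le> indicat_real (cball 0 R) x * C"
    using test_function_bound_indicator[OF assms] by metis
  show ?thesis
    by (rule Bochner_Integration.integrable_bound[OF integrable_cball_const[of R C]])
      (use C test_function_measurable[OF assms] in auto)
qed

lemma test_function_l2:
  fixes k :: "'a::euclidean_space \<Rightarrow> 'b::euclidean_space"
  assumes "test_function UNIV k"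
  shows "l2 k"
proof -
  obtain C R where C: "C \<ge> 0" "\<And>x. norm (k x) \<le> indicat_real (cball 0 R) x * C"
    using test_function_bound_indicator[OF assms] by metis
  have "(norm (k x))\<^sup>2 \<le> indicat_real (cball 0 R) x *\<^sub>R C\<^sup>2" for x
    using power_mono[OF C(2)[of x], of 2] by (auto simp: indicator_def split: if_splits)
  then show ?thesis
    by (rule l2I_bound[OF test_function_measurable[OF assms] integrable_cball_const])
qed

text \<open>Applied with \<open>q\<close> a test function, and with \<open>q\<close> the first-order
  remainder of one. In the second case \<open>C\<close> is small while the ball stays fixed, which
  is how differentiability of a convolution is obtained.\<close>

lemma kernel_bound:
  fixes q :: "'a::euclidean_space \<Rightarrow> real"
  assumes f: "loc_int f" and q: "q \<in> borel_measurable borel" "\<And>z. \<bar>q z\<bar> \<le> indicat_real (cball 0 R) z * C"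
    and C: "C \<ge> 0" and x: "norm x \<le> N"
  shows "integrable lborel (\<lambda>y. q (x - y) *\<^sub>R f y)"
    and "norm (LINT y|lborel. q (x - y) *\<^sub>R f y) \<le> C * (LINT y|lborel. indicat_real (cball 0 (R + N)) y *\<^sub>R norm (f y))"
proof -
  have *: "norm (q (x - y) *\<^sub>R f y) \<le> C * (indicat_real (cball 0 (R + N)) y *\<^sub>R norm (f y))" for y
  proof (cases "norm (x - y) \<le> R")
    case True
    then have "norm y \<le> R + N" using x norm_triangle_ineq2[of y x] by (simp add: norm_minus_commute)
    then show ?thesis using q(2)[of "x - y"] True by (simp add: mult_right_mono)
  next
    case False
    then show ?thesis using q(2)[of "x - y"] C by (simp add: indicator_def)
  qed
  have [measurable]: "f \<in> borel_measurable borel" "q \<in> borel_measurable borel"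
    using f q by (auto simp: loc_int_def)
  have i: "integrable lborel (\<lambda>y. C * (indicat_real (cball 0 (R + N)) y *\<^sub>R norm (f y)))"
    using f by (intro integrable_mult_right) (simp add: loc_int_def)
  show "integrable lborel (\<lambda>y. q (x - y) *\<^sub>R f y)"
    by (rule Bochner_Integration.integrable_bound[OF i]) (use * in \<open>auto intro!: AE_I2 order_trans[OF _ abs_ge_self]\<close>)
  have "norm (LINT y|lborel. q (x - y) *\<^sub>R f y) \<le> (LINT y|lborel. norm (q (x - y) *\<^sub>R f y))" by (rule integral_norm_bound)
  also have "\<dots> \<le> (LINT y|lborel. C * (indicat_real (cball 0 (R + N)) y *\<^sub>R norm (f y)))"
    by (rule integral_mono') (use i * C in auto)
  finally show "norm (LINT y|lborel. q (x - y) *\<^sub>R f y) \<le> C * (LINT y|lborel. indicat_real (cball 0 (R + N)) y *\<^sub>R norm (f y))"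
    by simp
qed

lemma conv_integrable:
  assumes k: "test_function UNIV k" and f: "loc_int f"
  shows "integrable lborel (\<lambda>y. k (x - y) *\<^sub>R f y)"
proof -
  obtain C R where C: "C \<ge> 0" "\<And>z. norm (k z) \<le> indicat_real (cball 0 R) z * C"
    using test_function_bound_indicator[OF k] by metis
  then show ?thesis
    using kernel_bound(1)[OF f test_function_measurable[OF k], of R C x "norm x"] by simp
qed

lemma conv_diff_kernel:
  assumes "test_function UNIV k" "test_function UNIV k'" "loc_int f"
  shows "conv (\<lambda>z. k z - k' z) f x = conv k f x - conv k' f x"
  unfolding conv_def using assms by (simp add: scaleR_left_diff_distrib conv_integrable)

lemma conv_diff:
  assumes "test_function UNIV k" "loc_int f" "loc_int g"
  shows "conv k (\<lambda>y. f y - g y) x = conv k f x - conv k g x"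
  unfolding conv_def using assms by (simp add: scaleR_right_diff_distrib conv_integrable)

lemma conv_add:
  assumes "test_function UNIV k" "loc_int f" "loc_int g"
  shows "conv k (\<lambda>y. f y + g y) x = conv k f x + conv k g x"
  unfolding conv_def using assms by (simp add: scaleR_right_distrib conv_integrable)

section \<open>Differentiability and smoothness of convolutions\<close>

lemma test_function_uniformly_continuous:
  fixes f :: "'a::euclidean_space \<Rightarrow> 'b::real_normed_vector"
  assumes f: "test_function UNIV f" and e: "e > 0"
  obtains d where "d > 0" "\<And>x y. norm (x - y) < d \<Longrightarrow> norm (f x - f y) < e"
proof -
  obtain R where R: "R > 0" "\<And>x. norm x > R \<Longrightarrow> f x = 0"
    using test_function_supportE[OF f] by metis
  have "uniformly_continuous_on (cball 0 (R + 1)) f"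
    by (intro compact_uniformly_continuous continuous_on_subset[OF smooth_continuous[OF test_function_smooth[OF f]]]) auto
  then obtain d where d: "d > 0"
    "\<And>x y. x \<in> cball 0 (R+1) \<Longrightarrow> y \<in> cball 0 (R+1) \<Longrightarrow> dist y x < d \<Longrightarrow> dist (f y) (f x) < e"
    unfolding uniformly_continuous_on_def using e by metis
  have "norm (f x - f y) < e" if "norm (x - y) < min d 1" for x y
  proof (cases "norm x \<le> R + 1 \<and> norm y \<le> R + 1")
    case True
    then show ?thesis using d(2)[of y x] that by (auto simp: dist_norm)
  next
    case False
    then have "norm x > R" "norm y > R"
      using that norm_triangle_ineq2[of x y] norm_triangle_ineq2[of y x] by (auto simp: norm_minus_commute)
    then show ?thesis using R(2) e by simp
  qed
  then show ?thesis using d(1) by (intro that[of "min d 1"]) auto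
qed

text \<open>The directional derivatives along the finitely many basis vectors are test functions,
  hence uniformly continuous; so the derivative is uniformly continuous in operator norm and the
  mean value inequality applies on a ball of fixed radius. The operator norm is estimated by a sum
  over the basis, whence the division of \<open>e\<close> by the dimension.\<close>

lemma test_function_uniformly_differentiable:
  fixes f :: "'a::euclidean_space \<Rightarrow> 'b::real_normed_vector"
  assumes f: "test_function UNIV f" and e: "e > 0"
  obtains d where "d > 0"
    "\<And>z h. norm h < d \<Longrightarrow> norm (f (z + h) - f z - frechet_derivative f (at z) h) \<le> e * norm h"
proof -
  define D where "D = (\<lambda>z. frechet_derivative f (at z))"
  have der: "(f has_derivative D z) (at z)" for z
    unfolding D_def by (intro smooth_has_derivative test_function_smooth[OF f])
  have lin: "linear (D z)" for z using der by (rule has_derivative_linear)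
  define e' where "e' = e / DIM('a)"
  have e': "e' > 0" using e by (simp add: e'_def)
  have "\<exists>d>0. \<forall>x y. norm (x - y) < d \<longrightarrow> norm (D x b - D y b) < e'" for b
    using test_function_uniformly_continuous[OF test_function_frechet_derivative[OF f, of b] e']
    unfolding D_def by metis
  then obtain d where d: "\<And>b. d b > 0" "\<And>b x y. norm (x - y) < d b \<Longrightarrow> norm (D x b - D y b) < e'"
    by metis
  define d0 where "d0 = Min (d ` Basis)"
  have d0: "d0 > 0" "\<And>b. b \<in> Basis \<Longrightarrow> d0 \<le> d b"
    using d(1) by (auto simp: d0_def)
  have "norm (f (z + h) - f z - D z h) \<le> e * norm h" if h: "norm h < d0" for z h
  proof -
    have "norm (f (z + h) - f z - D z (z + h - z)) \<le> norm (z + h - z) * e"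
    proof (rule differentiable_bound_linearization[where S = "ball z d0"])
      show "z + t *\<^sub>R (z + h - z) \<in> ball z d0" if "t \<in> {0..1}" for t :: real
        using that h mult_left_le_one_le[of "norm h" t] by (auto simp: dist_norm)
      show "(f has_derivative D x) (at x within ball z d0)" for x
        using der by (rule has_derivative_at_withinI)
      show "z \<in> ball z d0" using d0 by simp
      fix x assume x: "x \<in> ball z d0"
      show "onorm (D x - D z) \<le> e"
      proof (rule onorm_le)
        fix v :: 'a
        have ev: "D y v = (\<Sum>b\<in>Basis. (v \<bullet> b) *\<^sub>R D y b)" for y
          using linear_sum[OF lin[of y], of "\<lambda>b. (v \<bullet> b) *\<^sub>R b" Basis]
          by (simp add: euclidean_representation linear_cmul[OF lin])
        have "norm ((D x - D z) v) = norm (\<Sum>b\<in>Basis. (v \<bullet> b) *\<^sub>R (D x b - D z b))"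
          unfolding fun_diff_def ev[of x] ev[of z] by (simp add: sum_subtractf scaleR_diff_right)
        also have "\<dots> \<le> (\<Sum>b\<in>(Basis::'a set). norm v * e')"
        proof (rule sum_norm_le)
          fix b :: 'a assume b: "b \<in> Basis"
          have "norm (x - z) < d b" using x d0(2)[OF b] by (simp add: dist_norm norm_minus_commute)
          then have "norm (D x b - D z b) \<le> e'" using d(2) by (simp add: less_imp_le)
          then show "norm ((v \<bullet> b) *\<^sub>R (D x b - D z b)) \<le> norm v * e'"
            using Basis_le_norm[OF b, of v] by (simp add: mult_mono)
        qed
        also have "\<dots> = e * norm v" by (simp add: e'_def)
        finally show "norm ((D x - D z) v) \<le> e * norm v" .
      qed
    qed
    then show ?thesis by (simp add: mult.commute)
  qed
  then show ?thesis using d0(1) by (intro that[of d0]) (auto simp: D_def)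
qed

lemma linear_conv_derivative:
  assumes k: "test_function UNIV k" and f: "loc_int f"
  shows "linear (\<lambda>h. conv (\<lambda>z. frechet_derivative k (at z) h) f x)"
proof -
  have lin: "linear (frechet_derivative k (at z))" for z
    using smooth_has_derivative[OF test_function_smooth[OF k]] has_derivative_linear by blast
  have i: "integrable lborel (\<lambda>y. frechet_derivative k (at (x - y)) h *\<^sub>R f y)" for h
    using conv_integrable[OF test_function_frechet_derivative[OF k] f] .
  show ?thesis
    by (rule linearI) (use i in \<open>auto simp: conv_def linear_add[OF lin] linear_cmul[OF lin] scaleR_left_distrib
        simp flip: scaleR_scaleR\<close>)
qed

text \<open>For an increment \<open>h\<close> of norm below 1 the remainder of \<open>k\<close>
  vanishes outside the ball of radius \<open>R + 1\<close> and is at most \<open>e' * norm h\<close>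
  everywhere. Integrated against \<open>f\<close> it costs at most the mass \<open>I\<close> of
  \<open>f\<close> on a fixed ball; the choice \<open>e / (I + 1)\<close> keeps the quotient defined
  when that mass is 0.\<close>

lemma conv_has_derivative:
  assumes k: "test_function UNIV k" and f: "loc_int f"
  shows "(conv k f has_derivative (\<lambda>h. conv (\<lambda>z. frechet_derivative k (at z) h) f x)) (at x)"
proof -
  define D where "D = (\<lambda>z. frechet_derivative k (at z))"
  obtain R where R: "R > 0" "\<And>z. norm z > R \<Longrightarrow> k z = 0" "\<And>z h. norm z > R \<Longrightarrow> D z h = 0"
    unfolding D_def using test_function_supportE[OF k] by metis
  define I where "I = (LINT y|lborel. indicat_real (cball 0 (R + 1 + norm x)) y *\<^sub>R norm (f y))"
  have I: "I \<ge> 0" unfolding I_def by (intro integral_nonneg_AE AE_I2) simp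
  have main: "\<exists>d>0. \<forall>y. norm (y - x) < d \<longrightarrow>
      norm (conv k f y - conv k f x - conv (\<lambda>z. D z (y - x)) f x) \<le> e * norm (y - x)"
    if e: "e > 0" for e
  proof -
    define e' where "e' = e / (I + 1)"
    have e': "e' > 0" "e' * I \<le> e" using e I by (auto simp: e'_def field_simps)
    obtain d where d: "d > 0" "\<And>z h. norm h < d \<Longrightarrow> norm (k (z + h) - k z - D z h) \<le> e' * norm h"
      using test_function_uniformly_differentiable[OF k e'(1)] unfolding D_def by metis
    have "norm (conv k f y - conv k f x - conv (\<lambda>z. D z (y - x)) f x) \<le> e * norm (y - x)"
      if y: "norm (y - x) < min d 1" for y
    proof -
      define h where "h = y - x"
      define q where "q = (\<lambda>z. k (z + h) - k z - D z h)"
      have h: "norm h < d" "norm h < 1" "y = x + h" using y by (auto simp: h_def)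
      have [measurable]: "k \<in> borel_measurable borel" "(\<lambda>z. D z h) \<in> borel_measurable borel"
        using test_function_measurable k test_function_frechet_derivative[OF k] unfolding D_def by auto
      have q: "q \<in> borel_measurable borel" unfolding q_def by measurable
      have qb: "\<bar>q z\<bar> \<le> indicat_real (cball 0 (R+1)) z * (e' * norm h)" for z
      proof (cases "norm z \<le> R + 1")
        case True
        then show ?thesis using d(2)[OF h(1), of z] by (simp add: q_def)
      next
        case False
        then have "norm (z + h) > R" using h(2) norm_triangle_ineq4[of "z + h" h] by simp
        then show ?thesis using R(2,3) False by (simp add: q_def)
      qed
      have "conv k f y - conv k f x - conv (\<lambda>z. D z h) f x = (LINT w|lborel. q (x - w) *\<^sub>R f w)"
      proof -
        have "conv k f y = (LINT w|lborel. k (x - w + h) *\<^sub>R f w)"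
          unfolding conv_def h(3) by (simp add: algebra_simps)
        moreover have "integrable lborel (\<lambda>w. k (x - w + h) *\<^sub>R f w)"
          using conv_integrable[OF k f, of y] unfolding h(3) by (simp add: algebra_simps)
        moreover have "integrable lborel (\<lambda>w. D (x - w) h *\<^sub>R f w)"
          unfolding D_def by (rule conv_integrable[OF test_function_frechet_derivative[OF k] f])
        ultimately show ?thesis
          using conv_integrable[OF k f, of x] unfolding q_def conv_def by (simp add: scaleR_left_diff_distrib)
      qed
      moreover have "norm (LINT w|lborel. q (x - w) *\<^sub>R f w) \<le> (e' * norm h) * I"
        unfolding I_def using kernel_bound(2)[OF f q qb, of x "norm x"] e'(1) by simp
      moreover have "(e' * norm h) * I \<le> e * norm h"
        using mult_right_mono[OF e'(2), of "norm h"] by (simp add: mult_ac)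
      ultimately show ?thesis unfolding h_def by simp
    qed
    then show ?thesis using d(1) by (intro exI[of _ "min d 1"]) auto
  qed
  have "bounded_linear (\<lambda>h. conv (\<lambda>z. D z h) f x)"
    using linear_conv_derivative[OF k f] unfolding D_def linear_conv_bounded_linear .
  then show ?thesis
    unfolding has_derivative_at_alt using main unfolding D_def by blast
qed

lemma frechet_derivative_conv:
  assumes "test_function UNIV k" and "loc_int f"
  shows "frechet_derivative (conv k f) (at x) h = conv (\<lambda>z. frechet_derivative k (at z) h) f x"
  using frechet_derivative_eq[OF conv_has_derivative[OF assms]] by simp

lemma smooth_conv:
  assumes "test_function UNIV k" and f: "loc_int f"
  shows "smooth (conv k f)"
proof -
  have "C_k n (conv k f)" if "test_function UNIV k" for n k
    using that
  proof (induction n arbitrary: k)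
    case 0
    then show ?case
      using has_derivative_continuous[OF conv_has_derivative[OF _ f]]
      by (auto intro!: continuous_at_imp_continuous_on)
  next
    case (Suc n)
    show ?case
      by (rule C_k_SucI[OF conv_has_derivative[OF Suc.prems f] Suc.IH[OF test_function_frechet_derivative[OF Suc.prems]]])
  qed
  then show ?thesis using assms by (simp add: smooth_def)
qed

lemma conv_measurable:
  "test_function UNIV k \<Longrightarrow> loc_int f \<Longrightarrow> conv k f \<in> borel_measurable borel"
  by (intro borel_measurable_continuous_onI smooth_continuous smooth_conv)

lemma test_function_conv:
  assumes k: "test_function UNIV k" and f: "loc_int f" and R: "\<And>x. norm x > R \<Longrightarrow> f x = 0"
  shows "test_function UNIV (conv k f)"
proof -
  obtain R' where R': "\<And>z. norm z > R' \<Longrightarrow> k z = 0"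
    using test_function_supportE[OF k] by metis
  have "conv k f x = 0" if "norm x > R + R'" for x
  proof -
    have "k (x - y) *\<^sub>R f y = 0" for y
    proof (cases "norm y > R")
      case False
      then have "norm (x - y) > R'" using that norm_triangle_ineq2[of x y] by simp
      then show ?thesis using R' by simp
    qed (simp add: R)
    then have "(\<lambda>y. k (x - y) *\<^sub>R f y) = (\<lambda>y. 0)" by blast
    then show ?thesis unfolding conv_def by (simp only: integral_zero)
  qed
  then show ?thesis
    by (intro test_functionI[where R = "R + R'"] smooth_conv k f) (meson not_le)
qed

lemma conv_bounded:
  assumes k: "test_function UNIV k" and f: "f \<in> borel_measurable borel" "\<And>x. norm (f x) \<le> M"
  shows "norm (conv k f x) \<le> M * (LINT z|lborel. \<bar>k z\<bar>)"
proof -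
  have [measurable]: "k \<in> borel_measurable borel" by (rule test_function_measurable[OF k])
  have ik: "integrable lborel (\<lambda>y. M * \<bar>k (x - y)\<bar>)"
    using lborel_translate_integral(5)[of "\<lambda>y. \<bar>k y\<bar>" x] test_function_integrable[OF k] by simp
  have "norm (conv k f x) \<le> (LINT y|lborel. norm (k (x - y) *\<^sub>R f y))"
    unfolding conv_def by (rule integral_norm_bound)
  also have "\<dots> \<le> (LINT y|lborel. M * \<bar>k (x - y)\<bar>)"
    using integrable_norm[OF conv_integrable[OF k loc_int_bounded[OF f], of x]] ik f(2)
    by (intro integral_mono) (auto simp: mult.commute[of M] intro!: mult_left_mono)
  also have "\<dots> = M * (LINT z|lborel. \<bar>k z\<bar>)"
    using lborel_translate_integral(6)[of "\<lambda>y. \<bar>k y\<bar>" x] by simp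
  finally show ?thesis .
qed

text \<open>Split the kernel as the product of two factors \<open>sqrt \<bar>k\<bar>\<close>, one of
  them kept with \<open>f\<close>. Cauchy-Schwarz bounds the squared convolution pointwise by the
  mass of \<open>k\<close> times the convolution of its absolute value with the squared norm of
  \<open>f\<close>, and Fubini integrates this bound.\<close>

theorem conv_Young:
  fixes f :: "'a::euclidean_space \<Rightarrow> 'b::euclidean_space"
  assumes k: "test_function UNIV k" and f: "l2 f"
  shows "l2 (conv k f)" and "n2 (conv k f) \<le> (LINT z|lborel. \<bar>k z\<bar>) * n2 f"
proof -
  define K where "K = (LINT z|lborel. \<bar>k z\<bar>)"
  have K: "K \<ge> 0" by (simp add: K_def)
  have [measurable]: "k \<in> borel_measurable borel" by (rule test_function_measurable[OF k])
  have [measurable]: "f \<in> borel_measurable borel" using f by (simp add: l2_def)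
  have ik: "integrable lborel (\<lambda>z. \<bar>k z\<bar>)" using test_function_integrable[OF k] by simp
  obtain C where C: "\<And>z. \<bar>k z\<bar> \<le> C" using test_function_bounded[OF k] by (metis real_norm_def)
  define g where "g = (\<lambda>x. LINT y|lborel. \<bar>k (x - y)\<bar> *\<^sub>R (norm (f y))\<^sup>2)"
  have pair: "integrable (lborel \<Otimes>\<^sub>M lborel) (\<lambda>(x, y). \<bar>k (x - y)\<bar> *\<^sub>R (norm (f y))\<^sup>2)"
    by (rule pair_kernel_integrable(1)[OF ik l2_integrable[OF f]])
  have int_g: "integrable lborel g"
    unfolding g_def using lborel_pair.integrable_fst'[OF pair] by simp
  have "(LINT x|lborel. g x) = (LINT y|lborel. LINT x|lborel. \<bar>k (x - y)\<bar> *\<^sub>R (norm (f y))\<^sup>2)"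
    unfolding g_def by (rule lborel_pair.Fubini_integral[OF pair, symmetric])
  also have "\<dots> = (LINT y|lborel. K *\<^sub>R (norm (f y))\<^sup>2)"
    using lborel_translate_integral(4)[of "\<lambda>y. \<bar>k y\<bar>"] by (simp add: K_def)
  finally have g_eq: "(LINT x|lborel. g x) = K * (n2 f)\<^sup>2" by (simp add: n2_power2_int)
  have pt: "(norm (conv k f x))\<^sup>2 \<le> K * g x" for x
  proof -
    define a where "a = (\<lambda>y. sqrt \<bar>k (x - y)\<bar>)"
    define b where "b = (\<lambda>y. sqrt \<bar>k (x - y)\<bar> * norm (f y))"
    have ik': "integrable lborel (\<lambda>y. \<bar>k (x - y)\<bar>)"
      using lborel_translate_integral(5)[of "\<lambda>y. \<bar>k y\<bar>" x] ik by simp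
    have a: "l2 a" unfolding l2_def a_def using ik' by simp
    have "integrable lborel (\<lambda>y. \<bar>k (x - y)\<bar> *\<^sub>R (norm (f y))\<^sup>2)"
      by (rule Bochner_Integration.integrable_bound[OF integrable_mult_right[OF l2_integrable[OF f], of C]])
        (use C in \<open>auto simp: abs_mult intro!: mult_right_mono order_trans[OF _ abs_ge_self]\<close>)
    then have b: "l2 b" unfolding l2_def b_def by (simp add: power_mult_distrib)
    have "norm (conv k f x) \<le> (LINT y|lborel. norm (k (x - y) *\<^sub>R f y))"
      unfolding conv_def by (rule integral_norm_bound)
    also have "\<dots> = ip a b"
      unfolding ip_def a_def b_def by (simp flip: mult.assoc)
    also have "\<dots> \<le> n2 a * n2 b" using ip_Cauchy_Schwarz[OF a b] by simp
    finally have "(norm (conv k f x))\<^sup>2 \<le> (n2 a)\<^sup>2 * (n2 b)\<^sup>2"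
      by (metis norm_ge_zero power_mono power_mult_distrib)
    also have "(n2 a)\<^sup>2 = K"
      using lborel_translate_integral(6)[of "\<lambda>y. \<bar>k y\<bar>" x] by (simp add: n2_power2_int a_def K_def)
    also have "(n2 b)\<^sup>2 = g x" by (simp add: n2_power2_int b_def g_def power_mult_distrib)
    finally show ?thesis .
  qed
  show l2c: "l2 (conv k f)"
    by (rule l2I_bound[OF conv_measurable[OF k loc_int_l2[OF f]] integrable_mult_right[OF int_g, of K]]) (use pt in auto)
  have "(n2 (conv k f))\<^sup>2 \<le> (LINT x|lborel. K * g x)"
    unfolding n2_power2_int using pt int_g by (intro integral_mono l2_integrable[OF l2c]) auto
  also have "\<dots> = (K * n2 f)\<^sup>2" by (simp add: g_eq power2_eq_square)
  finally have "n2 (conv k f) \<le> K * n2 f"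
    by (rule power2_le_imp_le) (rule mult_nonneg_nonneg[OF K n2_nonneg])
  then show "n2 (conv k f) \<le> (LINT z|lborel. \<bar>k z\<bar>) * n2 f"
    by (simp only: K_def)
qed

text \<open>Fubini; absolute integrability of the double integrand comes from \<open>\<bar>a
  \<bullet> b\<bar> \<le> (norm a)\<^sup>2 + (norm b)\<^sup>2\<close>, with the weight
  \<open>\<bar>k\<bar>\<close> kept on both summands.\<close>

lemma conv_adjoint:
  assumes k: "test_function UNIV k" and f: "l2 f" and g: "l2 g"
  shows "ip (conv k f) g = ip f (conv (\<lambda>z. k (- z)) g)"
proof -
  have [measurable]: "k \<in> borel_measurable borel" by (rule test_function_measurable[OF k])
  have [measurable]: "f \<in> borel_measurable borel" "g \<in> borel_measurable borel" using f g by (simp_all add: l2_def)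
  have ik: "integrable lborel (\<lambda>z. \<bar>k z\<bar>)" using test_function_integrable[OF k] by simp
  have k': "test_function UNIV (\<lambda>z. k (- z))" using test_function_reflect[OF k, of 0] by simp
  have pair: "integrable (lborel \<Otimes>\<^sub>M lborel) (\<lambda>(x, y). k (x - y) * (f y \<bullet> g x))"
  proof (rule Bochner_Integration.integrable_bound)
    show "integrable (lborel \<Otimes>\<^sub>M lborel)
      (\<lambda>p. (case p of (x, y) \<Rightarrow> \<bar>k (x - y)\<bar> *\<^sub>R (norm (f y))\<^sup>2) + (case p of (x, y) \<Rightarrow> \<bar>k (x - y)\<bar> *\<^sub>R (norm (g x))\<^sup>2))"
      by (intro Bochner_Integration.integrable_add pair_kernel_integrable ik l2_integrable f g)
    show "AE p in lborel \<Otimes>\<^sub>M lborel. norm (case p of (x, y) \<Rightarrow> k (x - y) * (f y \<bullet> g x)) \<le>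
      norm ((case p of (x, y) \<Rightarrow> \<bar>k (x - y)\<bar> *\<^sub>R (norm (f y))\<^sup>2) + (case p of (x, y) \<Rightarrow> \<bar>k (x - y)\<bar> *\<^sub>R (norm (g x))\<^sup>2))"
      by (auto intro!: AE_I2 mult_left_mono abs_inner_le_squares simp: abs_mult simp flip: distrib_left)
  qed measurable
  have "ip (conv k f) g = (LINT x|lborel. LINT y|lborel. k (x - y) * (f y \<bullet> g x))"
    unfolding ip_def conv_def
  proof (rule Bochner_Integration.integral_cong[OF refl])
    fix x
    show "(LINT y|lborel. k (x - y) *\<^sub>R f y) \<bullet> g x = (LINT y|lborel. k (x - y) * (f y \<bullet> g x))"
      using conv_integrable[OF k loc_int_l2[OF f], of x]
      by (subst integral_inner_left[symmetric]) auto
  qed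
  also have "\<dots> = (LINT y|lborel. LINT x|lborel. k (x - y) * (f y \<bullet> g x))"
    by (rule lborel_pair.Fubini_integral[OF pair, symmetric])
  also have "\<dots> = ip f (conv (\<lambda>z. k (- z)) g)"
    unfolding ip_def conv_def
  proof (rule Bochner_Integration.integral_cong[OF refl])
    fix y
    show "(LINT x|lborel. k (x - y) * (f y \<bullet> g x)) = f y \<bullet> (LINT ya|lborel. k (- (y - ya)) *\<^sub>R g ya)"
      using conv_integrable[OF k' loc_int_l2[OF g], of y]
      by (subst integral_inner_right[symmetric]) auto
  qed
  finally show ?thesis .
qed

text \<open>The product of the two fields and its directional derivative are integrable, and the
  derivative has integral 0 by translation invariance. Integrability thus takes the place of decay
  at infinity, so the formula applies to convolutions of L2 fields.\<close>

lemma l2_integration_by_parts: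
  fixes a b :: "'a::euclidean_space \<Rightarrow> 'b::euclidean_space"
  assumes a: "smooth a" "l2 a" "l2 (\<lambda>x. frechet_derivative a (at x) e)"
    and b: "smooth b" "l2 b" "l2 (\<lambda>x. frechet_derivative b (at x) e)"
  shows "ip (\<lambda>x. frechet_derivative a (at x) e) b = - ip a (\<lambda>x. frechet_derivative b (at x) e)"
proof -
  have "(LINT x|lborel. a x \<bullet> frechet_derivative b (at x) e + frechet_derivative a (at x) e \<bullet> b x) = 0"
  proof (rule integral_directional_derivative_eq_0[where h = "\<lambda>x. a x \<bullet> b x"
        and h' = "\<lambda>x e. a x \<bullet> frechet_derivative b (at x) e + frechet_derivative a (at x) e \<bullet> b x"])
    show "((\<lambda>x. a x \<bullet> b x) has_derivative
        (\<lambda>e. a x \<bullet> frechet_derivative b (at x) e + frechet_derivative a (at x) e \<bullet> b x)) (at x)" for x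
      by (intro has_derivative_inner smooth_has_derivative a b)
    show "continuous_on UNIV (\<lambda>x. a x \<bullet> frechet_derivative b (at x) e + frechet_derivative a (at x) e \<bullet> b x)"
      by (intro continuous_intros smooth_continuous smooth_frechet_derivative a b)
  qed (use a b in \<open>auto intro: l2_inner_integrable\<close>)
  then show ?thesis
    using a b by (simp add: ip_def l2_inner_integrable)
qed

section \<open>Mollification\<close>

definition bump_mass :: "'a::euclidean_space itself \<Rightarrow> real" where
  "bump_mass _ = (LINT z::'a|lborel. bump z)"

definition moll :: "nat \<Rightarrow> 'a::euclidean_space \<Rightarrow> real" where
  "moll n z = real (Suc n) ^ DIM('a) / bump_mass TYPE('a) * bump (real (Suc n) *\<^sub>R z)"

lemma bump_measurable [measurable]: "bump \<in> borel_measurable borel"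
  by (rule test_function_measurable[OF test_function_bump])

lemma bump_mass_pos: "bump_mass TYPE('a::euclidean_space) > 0"
proof -
  have "bump_mass TYPE('a) \<noteq> 0"
  proof
    assume "bump_mass TYPE('a) = 0"
    then have "AE z::'a in lborel. bump z = 0"
      unfolding bump_mass_def
      using integral_nonneg_eq_0_iff_AE[OF test_function_integrable[OF test_function_bump]] bump_nonneg by auto
    then have "AE z::'a in lborel. z \<notin> ball 0 1"
      by eventually_elim (auto simp: bump_pos_iff[symmetric])
    then have "emeasure lborel (ball (0::'a) 1) = 0"
      by (subst (asm) AE_iff_measurable[of "ball 0 1"]) auto
    then show False using unit_ball_vol_pos[of "real DIM('a)"] by (simp add: emeasure_ball)
  qed
  moreover have "bump_mass TYPE('a) \<ge> 0"
    unfolding bump_mass_def using bump_nonneg by (intro integral_nonneg_AE) auto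
  ultimately show ?thesis by linarith
qed

lemma moll_nonneg: "moll n z \<ge> 0"
  unfolding moll_def using bump_mass_pos[where 'a='a] bump_nonneg
  by (intro mult_nonneg_nonneg divide_nonneg_nonneg zero_le_power) auto

lemma moll_minus: "moll n (- z) = moll n z"
  by (simp add: moll_def bump_minus)

lemma moll_eq_0: "norm z \<ge> inverse (real (Suc n)) \<Longrightarrow> moll n z = 0"
  unfolding moll_def by (subst bump_eq_0) (auto simp: field_simps simp del: of_nat_Suc)

lemma test_function_moll: "test_function UNIV (moll n :: 'a::euclidean_space \<Rightarrow> real)"
proof (rule test_functionI)
  have "smooth (\<lambda>z::'a. bump (0 + real (Suc n) *\<^sub>R z))"
    by (rule smooth_affine[OF bounded_linear_scaleR_right test_function_smooth[OF test_function_bump]])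
  then show "smooth (moll n :: 'a \<Rightarrow> real)"
    unfolding moll_def[abs_def] by (intro smooth_mult smooth_const) simp
  show "norm z \<le> inverse (real (Suc n))" if "moll n z \<noteq> 0" for z :: 'a
    using moll_eq_0[of n z] that by linarith
qed

lemma moll_integral: "(LINT z::'a::euclidean_space|lborel. moll n z) = 1"
  using lborel_affine_integral(2)[OF bump_measurable, of "real (Suc n)" "0::'a"] bump_mass_pos[where 'a='a]
  unfolding moll_def bump_mass_def by (auto simp: field_simps simp del: of_nat_Suc)

lemma moll_abs_integral: "(LINT z::'a::euclidean_space|lborel. \<bar>moll n z\<bar>) = 1"
  using moll_integral[where 'a='a and n=n] by (simp add: moll_nonneg)

lemma conv_moll_tendsto:
  fixes g :: "'a::euclidean_space \<Rightarrow> 'b::euclidean_space"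
  assumes g: "continuous_on UNIV g" and l: "loc_int g"
  shows "(\<lambda>n. conv (moll n) g x) \<longlonglongrightarrow> g x"
proof (rule LIMSEQ_I)
  fix e :: real assume e: "e > 0"
  have "continuous (at x) g" using g by (simp add: continuous_on_eq_continuous_at)
  then obtain d where d: "d > 0" "\<And>y. norm (y - x) < d \<Longrightarrow> norm (g y - g x) < e / 2"
    unfolding continuous_at_eps_delta dist_norm using e by (metis half_gt_zero)
  obtain N where N: "inverse (real (Suc N)) < d" using reals_Archimedean[OF d(1)] by blast
  have "norm (conv (moll n) g x - g x) < e" if "n \<ge> N" for n
  proof -
    have m: "integrable lborel (\<lambda>y::'a. moll n (x - y))" "(LINT y|lborel. moll n (x - y)) = 1"
      using lborel_translate_integral(5,6)[OF test_function_measurable[OF test_function_moll[of n]], of x]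
        test_function_integrable[OF test_function_moll[of n]] moll_integral[of n, where 'a='a] by simp_all
    have gx: "g x = (LINT y|lborel. moll n (x - y) *\<^sub>R g x)" using m by simp
    have i: "integrable lborel (\<lambda>y. moll n (x - y) *\<^sub>R g y)"
      by (rule conv_integrable[OF test_function_moll l])
    have i2: "integrable lborel (\<lambda>y. moll n (x - y) *\<^sub>R (g y - g x))"
      using i m by (simp add: scaleR_diff_right)
    have "conv (moll n) g x - g x = (LINT y|lborel. moll n (x - y) *\<^sub>R (g y - g x))"
      by (subst gx) (use i m in \<open>simp add: conv_def scaleR_diff_right\<close>)
    also have "norm \<dots> \<le> (LINT y|lborel. norm (moll n (x - y) *\<^sub>R (g y - g x)))"
      by (rule integral_norm_bound)
    also have "\<dots> \<le> (LINT y|lborel. moll n (x - y) * (e / 2))"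
    proof (rule integral_mono)
      fix y
      show "norm (moll n (x - y) *\<^sub>R (g y - g x)) \<le> moll n (x - y) * (e / 2)"
      proof (cases "norm (x - y) < d")
        case True
        then show ?thesis
          using less_imp_le[OF d(2)[of y]] moll_nonneg[of n "x - y"]
          unfolding norm_minus_commute[of x y] norm_scaleR abs_of_nonneg[OF moll_nonneg]
          by (intro mult_left_mono)
      next
        case False
        have "inverse (real (Suc n)) \<le> inverse (real (Suc N))" using that by (simp add: field_simps)
        then have "moll n (x - y) = 0" using False N by (intro moll_eq_0) linarith
        then show ?thesis by simp
      qed
    qed (rule integrable_norm[OF i2], use m in auto)
    also have "\<dots> = e / 2" using m by simp
    finally show ?thesis using e by simp
  qed
  then show "\<exists>no. \<forall>n\<ge>no. norm (conv (moll n) g x - g x) < e" by blast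
qed

text \<open>Truncate \<open>f\<close> in space and in size, take continuous functions converging
  almost everywhere to the truncation, and reshape them so that one multiple of the indicator of a
  ball dominates all of them; dominated convergence does the rest.\<close>

lemma l2_approx_continuous:
  fixes f :: "'a::euclidean_space \<Rightarrow> 'b::euclidean_space"
  assumes f: "l2 f" and e: "e > 0"
  obtains g R M where "continuous_on UNIV g" "\<And>x. norm x > R \<Longrightarrow> g x = 0" "\<And>x. norm (g x) \<le> M" "l2 g"
    "n2 (\<lambda>x. f x - g x) < e"
proof -
  have [measurable]: "f \<in> borel_measurable borel" using f by (simp add: l2_def)
  define F where "F = (\<lambda>(k::nat) x. if norm x \<le> real (Suc k) \<and> norm (f x) \<le> real (Suc k) then f x else 0)"
  have Fm [measurable]: "F k \<in> borel_measurable borel" for k unfolding F_def by measurable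
  have Fl2: "l2 (F k)" for k
    by (rule l2I_bound[OF Fm l2_integrable[OF f]]) (simp add: F_def)
  have "(\<lambda>k. n2 (\<lambda>x. F k x - f x)) \<longlonglongrightarrow> 0"
  proof (rule n2_tendsto_0I[OF l2_diff[OF Fl2 f] l2_integrable[OF f]])
    show "(norm (F k x - f x))\<^sup>2 \<le> (norm (f x))\<^sup>2" for k x by (simp add: F_def)
    show "AE x in lborel. (\<lambda>k. F k x - f x) \<longlonglongrightarrow> 0"
    proof (rule AE_I2)
      fix x
      obtain K :: nat where "max (norm x) (norm (f x)) \<le> real K" using real_arch_simple by blast
      then have "\<forall>\<^sub>F k in sequentially. F k x - f x = 0"
        unfolding eventually_sequentially F_def by (intro exI[of _ K]) auto
      then show "(\<lambda>k. F k x - f x) \<longlonglongrightarrow> 0" by (rule tendsto_eventually)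
    qed
  qed
  then have "\<forall>\<^sub>F k in sequentially. n2 (\<lambda>x. F k x - f x) < e / 2"
    using e by (intro order_tendstoD) auto
  then obtain k where k: "n2 (\<lambda>x. F k x - f x) < e / 2" by (auto simp: eventually_sequentially)
  define m where "m = real (Suc k)"
  have m: "m > 0" "\<And>x. norm (F k x) \<le> m" "\<And>x. norm x > m \<Longrightarrow> F k x = 0" by (auto simp: m_def F_def)
  have "F k \<in> borel_measurable lebesgue" using Fm[of k] by (simp add: measurable_completion)
  then have "F k measurable_on UNIV" by (subst measurable_on_iff_borel_measurable) auto
  then obtain N g where N: "negligible N" and g: "\<And>n. continuous_on UNIV (g n)"
    "\<And>x. x \<notin> N \<Longrightarrow> (\<lambda>n. g n x) \<longlonglongrightarrow> F k x"
    unfolding measurable_on_def by auto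
  \<comment> \<open>The factor with \<open>max m\<close> is the radial retraction onto the ball of
    radius \<open>m\<close> in the range; the tent factor is 1 on the ball of radius
    \<open>m\<close> in space and 0 beyond \<open>m + 1\<close>. Both leave the limit
    \<open>F k\<close> unchanged, as it is bounded by \<open>m\<close> and vanishes beyond radius
    \<open>m\<close>.\<close>
  define h where "h = (\<lambda>n x. max 0 (min 1 (m + 1 - norm x)) *\<^sub>R ((m / max m (norm (g n x))) *\<^sub>R g n x))"
  have hc: "continuous_on UNIV (h n)" for n
    unfolding h_def using m(1) by (intro continuous_intros g(1)) (auto simp: max_def)
  have h0: "h n x = 0" if "norm x > m + 1" for n x using that by (simp add: h_def)
  have hb: "norm (h n x) \<le> m" for n x
  proof -
    have "norm ((m / max m (norm (g n x))) *\<^sub>R g n x) \<le> m"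
      using m(1) by (auto simp: max_def field_simps)
    moreover have "norm (h n x) \<le> 1 * norm ((m / max m (norm (g n x))) *\<^sub>R g n x)"
      unfolding h_def norm_scaleR[of "max 0 (min 1 (m + 1 - norm x))"] by (intro mult_right_mono) auto
    ultimately show ?thesis by linarith
  qed
  have hm [measurable]: "h n \<in> borel_measurable borel" for n by (rule borel_measurable_continuous_onI[OF hc])
  have hl2: "l2 (h n)" for n
  proof (rule l2I_bound[OF hm integrable_cball_const[of "m+1" "m\<^sup>2"]])
    show "(norm (h n x))\<^sup>2 \<le> indicat_real (cball 0 (m + 1)) x *\<^sub>R m\<^sup>2" for x
      using h0[of x n] hb[of n x] by (cases "norm x > m + 1") (auto intro: power_mono)
  qed
  have "(\<lambda>n. n2 (\<lambda>x. h n x - F k x)) \<longlonglongrightarrow> 0"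
  proof (rule n2_tendsto_0I[OF l2_diff[OF hl2 Fl2] integrable_cball_const[of "m+1" "(2 * m)\<^sup>2"]])
    show "(norm (h n x - F k x))\<^sup>2 \<le> indicat_real (cball 0 (m + 1)) x *\<^sub>R (2 * m)\<^sup>2" for n x
    proof (cases "norm x > m + 1")
      case False
      have "norm (h n x - F k x) \<le> 2 * m"
        using norm_triangle_ineq4[of "h n x" "F k x"] hb[of n x] m(2)[of x] by linarith
      then have "(norm (h n x - F k x))\<^sup>2 \<le> (2 * m)\<^sup>2" by (rule power_mono) simp
      then show ?thesis using False by simp
    qed (use h0 m(3) in auto)
    have "AE x in lebesgue. x \<notin> N"
      using N by (simp add: negligible_iff_null_sets AE_not_in)
    then have "AE x in lborel. x \<notin> N"
      by (simp add: AE_completion_iff)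
    then show "AE x in lborel. (\<lambda>n. h n x - F k x) \<longlonglongrightarrow> 0"
    proof eventually_elim
      case (elim x)
      have "(\<lambda>n. h n x) \<longlonglongrightarrow> max 0 (min 1 (m + 1 - norm x)) *\<^sub>R ((m / max m (norm (F k x))) *\<^sub>R F k x)"
        unfolding h_def using m(1) by (intro tendsto_intros g(2)[OF elim]) (auto simp: max_def)
      also have "max 0 (min 1 (m + 1 - norm x)) *\<^sub>R ((m / max m (norm (F k x))) *\<^sub>R F k x) = F k x"
        using m(1) m(2)[of x] m(3)[of x] by (cases "norm x > m") (auto simp: max_def min_def)
      finally show ?case by (simp add: LIM_zero)
    qed
  qed
  then have "\<forall>\<^sub>F n in sequentially. n2 (\<lambda>x. h n x - F k x) < e / 2"
    using e by (intro order_tendstoD) auto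
  then obtain n where n: "n2 (\<lambda>x. h n x - F k x) < e / 2" by (auto simp: eventually_sequentially)
  have "n2 (\<lambda>x. f x - h n x) < e"
    using n2_diff_triangle[OF f Fl2[of k] hl2[of n]] n k
    by (simp add: n2_diff_commute[of f "F k"] n2_diff_commute[of "F k" "h n"])
  then show ?thesis using hc h0 hb hl2 by (intro that[of "h n" "m+1" m])
qed

text \<open>Convolution with a mollifier is a contraction of L2 because its mass is 1, so a
  three-term estimate reduces the claim to continuous \<open>g\<close> of compact support. For
  those, pointwise convergence is dominated, since all \<open>conv (moll n) g\<close> live in one
  ball.\<close>

theorem conv_moll_l2_tendsto:
  fixes f :: "'a::euclidean_space \<Rightarrow> 'b::euclidean_space"
  assumes f: "l2 f"
  shows "(\<lambda>n. n2 (\<lambda>x. conv (moll n) f x - f x)) \<longlonglongrightarrow> 0"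
proof (rule LIMSEQ_I)
  fix e :: real assume e: "e > 0"
  obtain g R M where g: "continuous_on UNIV g" "\<And>x. norm x > R \<Longrightarrow> g x = 0" "\<And>x. norm (g x) \<le> M" "l2 g"
    "n2 (\<lambda>x. f x - g x) < e / 3"
    by (rule l2_approx_continuous[OF f, of "e / 3"]) (use e in \<open>simp, blast\<close>)
  have gb: "g \<in> borel_measurable borel" by (rule borel_measurable_continuous_onI[OF g(1)])
  have cl2: "l2 (conv (moll n) h)" if "l2 h" for n and h :: "'a \<Rightarrow> 'b"
    by (rule conv_Young(1)[OF test_function_moll that])
  have cn2: "n2 (conv (moll n) h) \<le> n2 h" if "l2 h" for n and h :: "'a \<Rightarrow> 'b"
    using conv_Young(2)[OF test_function_moll[of n] that] by (simp add: moll_abs_integral)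
  have "(\<lambda>n. n2 (\<lambda>x. conv (moll n) g x - g x)) \<longlonglongrightarrow> 0"
  proof (rule n2_tendsto_0I[OF l2_diff[OF cl2[OF g(4)] g(4)] integrable_cball_const[of "R+1" "(2 * M)\<^sup>2"]])
    show "(norm (conv (moll n) g x - g x))\<^sup>2 \<le> indicat_real (cball 0 (R + 1)) x *\<^sub>R (2 * M)\<^sup>2" for n x
    proof (cases "norm x > R + 1")
      case True
      have "(\<lambda>y. moll n (x - y) *\<^sub>R g y) = (\<lambda>y. 0)"
      proof
        fix y
        show "moll n (x - y) *\<^sub>R g y = 0"
        proof (cases "norm y > R")
          case False
          then have "norm (x - y) \<ge> 1" using True norm_triangle_ineq2[of x y] by linarith
          moreover have "inverse (real (Suc n)) \<le> 1" by (simp add: field_simps)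
          ultimately show ?thesis using moll_eq_0[of n "x - y"] by simp
        qed (simp add: g(2))
      qed
      then have "conv (moll n) g x = 0" by (simp only: conv_def integral_zero)
      then show ?thesis using True g(2) by simp
    next
      case False
      have "norm (conv (moll n) g x - g x) \<le> 2 * M"
        using norm_triangle_ineq4[of "conv (moll n) g x" "g x"] g(3)[of x]
          conv_bounded[OF test_function_moll[of n] gb g(3), of x] by (simp add: moll_abs_integral)
      then have "(norm (conv (moll n) g x - g x))\<^sup>2 \<le> (2 * M)\<^sup>2" by (rule power_mono) simp
      then show ?thesis using False by simp
    qed
    show "AE x in lborel. (\<lambda>n. conv (moll n) g x - g x) \<longlonglongrightarrow> 0"
      using conv_moll_tendsto[OF g(1) loc_int_l2[OF g(4)]] by (simp add: LIM_zero)
  qed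
  from LIMSEQ_D[OF this, of "e/3"] e obtain N where
    N: "\<And>n. n \<ge> N \<Longrightarrow> n2 (\<lambda>x. conv (moll n) g x - g x) < e / 3" by auto
  have "n2 (\<lambda>x. conv (moll n) f x - f x) < e" if "n \<ge> N" for n
  proof -
    have eq: "conv (moll n) (\<lambda>x. f x - g x) = (\<lambda>x. conv (moll n) f x - conv (moll n) g x)"
      using conv_diff[OF test_function_moll loc_int_l2[OF f] loc_int_l2[OF g(4)]] by blast
    have 1: "n2 (\<lambda>x. conv (moll n) f x - conv (moll n) g x) < e / 3"
      using cn2[OF l2_diff[OF f g(4)], of n] g(5) unfolding eq by linarith
    have 2: "n2 (\<lambda>x. g x - f x) < e / 3" using g(5) by (simp only: n2_diff_commute[of g f])
    have "n2 (\<lambda>x. conv (moll n) f x - f x) \<le> n2 (\<lambda>x. conv (moll n) f x - g x) + n2 (\<lambda>x. g x - f x)"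
      by (rule n2_diff_triangle[OF cl2[OF f] g(4) f])
    also have "n2 (\<lambda>x. conv (moll n) f x - g x)
       \<le> n2 (\<lambda>x. conv (moll n) f x - conv (moll n) g x) + n2 (\<lambda>x. conv (moll n) g x - g x)"
      by (rule n2_diff_triangle[OF cl2[OF f] cl2[OF g(4)] g(4)])
    finally show ?thesis using 1 2 N[OF that] by linarith
  qed
  then show "\<exists>no. \<forall>n\<ge>no. norm (n2 (\<lambda>x. conv (moll n) f x - f x) - 0) < e" by auto
qed

section \<open>Compactly supported divergence-free approximations\<close>

lemma smooth_linear_frechet: "smooth g \<Longrightarrow> linear (frechet_derivative g (at x))"
  using smooth_has_derivative has_derivative_linear by blast

lemma frechet_derivative_axis_sum:
  fixes g :: "real^3 \<Rightarrow> 'b::real_normed_vector"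
  assumes "smooth g"
  shows "frechet_derivative g (at x) w = (\<Sum>i\<in>UNIV. w $ i *\<^sub>R pd i g x)"
proof -
  have lin: "linear (frechet_derivative g (at x))" by (rule smooth_linear_frechet[OF assms])
  have "w = (\<Sum>i\<in>UNIV. w $ i *\<^sub>R axis i 1)"
    by (simp add: vec_eq_iff axis_def if_distrib cong: if_cong)
  then have "frechet_derivative g (at x) w = frechet_derivative g (at x) (\<Sum>i\<in>UNIV. w $ i *\<^sub>R axis i 1)" by simp
  also have "\<dots> = (\<Sum>i\<in>UNIV. w $ i *\<^sub>R pd i g x)"
    by (simp add: linear_sum[OF lin] linear_cmul[OF lin] pd_def)
  finally show ?thesis .
qed

lemma frechet_derivative_eq_grad: "smooth g \<Longrightarrow> frechet_derivative g (at x) w = w \<bullet> grad g x"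
  by (simp add: frechet_derivative_axis_sum grad_def inner_vec_def)

lemma continuous_pd: "smooth g \<Longrightarrow> continuous_on UNIV (\<lambda>x. pd i g x)"
  unfolding pd_def by (intro smooth_continuous smooth_frechet_derivative)

lemma compact_support_integrable:
  fixes f :: "'a::euclidean_space \<Rightarrow> 'b::euclidean_space"
  assumes "continuous_on UNIV f" "\<And>x. norm x > R \<Longrightarrow> f x = 0"
  shows "integrable lborel f"
proof -
  have "integrable lborel (\<lambda>x. indicator (cball 0 R) x *\<^sub>R f x)"
    by (rule borel_integrable_compact) (auto intro: continuous_on_subset[OF assms(1)])
  also have "(\<lambda>x. indicator (cball 0 R) x *\<^sub>R f x) = f"
    using assms(2) by (auto simp: fun_eq_iff indicator_def not_le)
  finally show ?thesis .
qed

text \<open>The diagonal partial derivatives integrate to 0 one by one. The derivative is an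
  explicit \<open>F'\<close> with continuous directional values because the lemma is applied to
  fields built from powers of \<open>cutoff\<close>, which are continuously differentiable but not
  smooth.\<close>

lemma divergence_theorem_compact_support:
  fixes F :: "real^3 \<Rightarrow> real^3"
  assumes der: "\<And>x. (F has_derivative F' x) (at x)"
    and cont: "\<And>h. continuous_on UNIV (\<lambda>x. F' x h)"
    and supp: "\<And>x. norm x > R \<Longrightarrow> F x = 0"
  shows "(LINT x|lborel. (\<Sum>i\<in>UNIV. F' x (axis i 1) $ i)) = 0"
proof -
  have F0: "F' x h = 0" if "norm x > R" for x h
  proof -
    have "open {x::real^3. norm x > R}" by (intro open_Collect_less continuous_intros)
    then have "(F has_derivative (\<lambda>h. 0)) (at x)"
      using that supp by (intro has_derivative_transform_within_open[OF has_derivative_const, where s = "{x. norm x > R}"]) auto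
    then show ?thesis using has_derivative_unique[OF der] by metis
  qed
  have Fc: "continuous_on UNIV F"
    using has_derivative_continuous[OF der] by (auto intro!: continuous_at_imp_continuous_on)
  have i: "integrable lborel (\<lambda>x. F' x (axis i 1) $ i)" for i
    by (rule compact_support_integrable[where R=R]) (auto intro!: continuous_intros cont simp: F0)
  have "(LINT x|lborel. F' x (axis i 1) $ i) = 0" for i
  proof (rule integral_directional_derivative_eq_0[where h = "\<lambda>x. F x $ i" and h' = "\<lambda>x e. F' x e $ i"])
    show "((\<lambda>x. F x $ i) has_derivative (\<lambda>e. F' x e $ i)) (at x)" for x
      using der by (rule bounded_linear.has_derivative[OF bounded_linear_vec_nth])
    show "integrable lborel (\<lambda>x. F x $ i)"
      by (rule compact_support_integrable[where R=R]) (auto intro!: continuous_intros Fc simp: supp)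
    show "continuous_on UNIV (\<lambda>x. F' x (axis i 1) $ i)" by (intro continuous_intros cont)
  qed (rule i)
  then show ?thesis using i by simp
qed

section \<open>A truncated polynomial cutoff with explicit derivatives\<close>

lemma DERIV_max_0_power:
  "((\<lambda>t::real. (max 0 t) ^ Suc (Suc n)) has_real_derivative real (Suc (Suc n)) * (max 0 t) ^ Suc n) (at t)"
proof -
  consider "t > 0" | "t < 0" | "t = 0" by linarith
  then show ?thesis
  proof cases
    case 1
    have "((\<lambda>t::real. t ^ Suc (Suc n)) has_real_derivative real (Suc (Suc n)) * (max 0 t) ^ Suc n) (at t)"
      using DERIV_power_Suc[OF DERIV_ident, of "Suc n" t UNIV] 1 by (simp add: max_def)
    then show ?thesis
      by (rule has_field_derivative_transform_within_open[where S = "{0<..}"]) (use 1 in auto)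
  next
    case 2
    have "((\<lambda>t::real. 0) has_real_derivative real (Suc (Suc n)) * (max 0 t) ^ Suc n) (at t)"
      using 2 by (auto simp: max_def)
    then show ?thesis
      by (rule has_field_derivative_transform_within_open[where S = "{..<0}"]) (use 2 in auto)
  next
    case 3
    have "((\<lambda>h::real. (max 0 h) ^ Suc (Suc n) / h) \<longlongrightarrow> 0) (at 0)"
    proof (rule Lim_null_comparison)
      show "\<forall>\<^sub>F h in at 0. norm ((max 0 h) ^ Suc (Suc n) / h) \<le> \<bar>h\<bar> ^ Suc n"
      proof (intro always_eventually allI)
        fix h :: real
        show "norm ((max 0 h) ^ Suc (Suc n) / h) \<le> \<bar>h\<bar> ^ Suc n"
        proof (cases "h > 0")
          case False
          then have "norm ((max 0 h) ^ Suc (Suc n) / h) = 0" by (simp add: max_def)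
          also have "0 \<le> \<bar>h\<bar> ^ Suc n" by (rule zero_le_power) simp
          finally show ?thesis .
        qed (auto simp: max_def)
      qed
      show "((\<lambda>h::real. \<bar>h\<bar> ^ Suc n) \<longlongrightarrow> 0) (at 0)"
        by (auto intro!: tendsto_eq_intros)
    qed
    then show ?thesis unfolding 3 by (simp add: has_field_derivative_iff)
  qed
qed

text \<open>Its cube is the cutoff in use: twice continuously differentiable, so that its gradient
  may itself be a factor in the divergence theorem, and explicit enough for bounds uniform in
  \<open>R\<close> to be read off. The gradient is radial, hence its cross product with the
  potential only involves the cross product of \<open>x\<close> with it.\<close>

definition cutoff :: "real \<Rightarrow> real^3 \<Rightarrow> real" where
  "cutoff R x = max 0 (1 - inverse (R\<^sup>2) * (x \<bullet> x))"

lemma cutoff_continuous: "continuous_on UNIV (cutoff R)"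
  unfolding cutoff_def by (intro continuous_intros)

lemma cutoff_bounds: "0 \<le> cutoff R x" "cutoff R x \<le> 1"
  by (auto simp: cutoff_def)

lemma cutoff_eq_0: "R > 0 \<Longrightarrow> norm x > R \<Longrightarrow> cutoff R x = 0"
proof -
  assume R: "R > 0" "norm x > R"
  then have "R\<^sup>2 \<le> x \<bullet> x" by (simp add: dot_square_norm power_mono)
  then show "cutoff R x = 0" using R by (simp add: cutoff_def field_simps)
qed

lemma cutoff_power_has_derivative:
  "((\<lambda>x. cutoff R x ^ Suc (Suc n)) has_derivative
     (\<lambda>h. - (2 * real (Suc (Suc n)) / R\<^sup>2) * cutoff R x ^ Suc n * (x \<bullet> h))) (at x)"
proof -
  have 1: "((\<lambda>x. 1 - inverse (R\<^sup>2) * (x \<bullet> x)) has_derivative (\<lambda>h. - (2 / R\<^sup>2) * (x \<bullet> h))) (at x)"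
    by (auto intro!: derivative_eq_intros simp: inner_commute divide_inverse)
  show ?thesis
    unfolding cutoff_def
    by (rule has_derivative_eq_rhs[OF has_derivative_compose[OF 1 DERIV_max_0_power[unfolded has_field_derivative_def]]])
      (simp add: fun_eq_iff mult_ac)
qed

text \<open>The gradient of \<open>cutoff R ^ 3\<close> at \<open>x\<close> is \<open>rho R x *\<^sub>R x\<close>.\<close>

definition rho :: "real \<Rightarrow> real^3 \<Rightarrow> real" where
  "rho R x = - (6 / R\<^sup>2) * (cutoff R x)\<^sup>2"

lemma cutoff3_has_derivative:
  "((\<lambda>x. cutoff R x ^ 3) has_derivative (\<lambda>h. rho R x * (x \<bullet> h))) (at x)"
  using cutoff_power_has_derivative[of R 1 x] by (simp add: numeral_3_eq_3 numeral_2_eq_2 rho_def)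

lemma rho_has_derivative:
  "(rho R has_derivative (\<lambda>h. (24 / R ^ 4) * cutoff R x * (x \<bullet> h))) (at x)"
proof -
  have "((\<lambda>x. - (6 / R\<^sup>2) * cutoff R x ^ Suc (Suc 0)) has_derivative
      (\<lambda>h. - (6 / R\<^sup>2) * (- (2 * real (Suc (Suc 0)) / R\<^sup>2) * cutoff R x ^ Suc 0 * (x \<bullet> h)))) (at x)"
    by (intro has_derivative_mult_right cutoff_power_has_derivative)
  then show ?thesis
    unfolding rho_def[abs_def] by (simp add: numeral_2_eq_2 power4_eq_xxxx power2_eq_square mult_ac)
qed

lemma rho_continuous: "continuous_on UNIV (rho R)"
  unfolding rho_def by (intro continuous_intros cutoff_continuous)

lemma rho_eq_0: "R > 0 \<Longrightarrow> norm x > R \<Longrightarrow> rho R x = 0"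
  by (simp add: rho_def cutoff_eq_0)

lemma rho_bound: "\<bar>rho R x\<bar> \<le> 6 / R\<^sup>2"
  using cutoff_bounds[of R x] by (simp add: rho_def abs_mult divide_right_mono power_le_one)

text \<open>As \<open>\<bar>rho R x\<bar> * norm x\<close> is the length of the gradient of
  \<open>cutoff R ^ 3\<close>, this is its scale-invariant bound; the factor
  \<open>R\<^sup>2\<close> lost by \<open>norm x \<le> R\<close> on the support cancels against
  \<open>rho_bound\<close>.\<close>

lemma rho_bound_support: "R > 0 \<Longrightarrow> \<bar>rho R x\<bar> * (norm x)\<^sup>2 \<le> 6"
proof (cases "norm x > R")
  case False
  assume R: "R > 0"
  have "\<bar>rho R x\<bar> * (norm x)\<^sup>2 \<le> 6 / R\<^sup>2 * R\<^sup>2"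
    using False R by (intro mult_mono rho_bound power_mono) auto
  then show ?thesis using R by simp
qed (simp add: rho_eq_0)

text \<open>The triple product of \<open>x\<close> with the cross product of
  \<open>v (s\<^sup>2 x)\<close> and \<open>x\<close>, expanded. Up to the factor
  \<open>(norm x)\<^sup>2\<close> it is the part of \<open>v (s\<^sup>2 x)\<close> tangential to the
  sphere through \<open>x\<close>; its orthogonality to \<open>x\<close> is used below.\<close>

definition tang :: "(real^3 \<Rightarrow> real^3) \<Rightarrow> real \<Rightarrow> real^3 \<Rightarrow> real^3" where
  "tang v s x = (x \<bullet> x) *\<^sub>R v (s\<^sup>2 *\<^sub>R x) - (x \<bullet> v (s\<^sup>2 *\<^sub>R x)) *\<^sub>R x"

text \<open>\<open>homotopy v x = x \<times> A x\<close> for the vector potential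
  \<open>A x = \<integral>\<^sub>0\<^sup>1 \<sigma> (v (\<sigma> x) \<times> x) d\<sigma>\<close> of \<open>v\<close> with
  the substitution \<open>\<sigma> = s\<^sup>2\<close>, so that \<open>compact_approx R v\<close> is the curl of \<open>cutoff R ^ 3 *\<^sub>R A\<close>.\<close>

definition homotopy :: "(real^3 \<Rightarrow> real^3) \<Rightarrow> real^3 \<Rightarrow> real^3" where
  "homotopy v x = (LINT s|lborel. indicat_real {0..1} s *\<^sub>R ((2 * s ^ 3) *\<^sub>R tang v s x))"

definition compact_approx :: "real \<Rightarrow> (real^3 \<Rightarrow> real^3) \<Rightarrow> real^3 \<Rightarrow> real^3" where
  "compact_approx R v x = cutoff R x ^ 3 *\<^sub>R v x + rho R x *\<^sub>R homotopy v x"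

section \<open>Weak divergence of the homotopy field\<close>

lemma pair_integrable_compact_support:
  fixes H :: "real \<times> (real^3) \<Rightarrow> 'b::euclidean_space"
  assumes H: "continuous_on UNIV H" and supp: "\<And>s x. norm x > R \<Longrightarrow> H (s, x) = 0"
  shows "integrable (lborel \<Otimes>\<^sub>M lborel) (\<lambda>(s, x). indicat_real {0..1} s *\<^sub>R H (s, x))"
proof -
  have "integrable lborel (\<lambda>p. indicator ({0..1} \<times> cball 0 R) p *\<^sub>R H p)"
    by (rule borel_integrable_compact) (auto intro: continuous_on_subset[OF H] compact_Times)
  also have "(\<lambda>p. indicator ({0..1} \<times> cball 0 R) p *\<^sub>R H p) = (\<lambda>(s, x). indicat_real {0..1} s *\<^sub>R H (s, x))"
    using supp by (auto simp: fun_eq_iff indicator_def) (meson not_le)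
  finally show ?thesis by (simp add: lborel_prod)
qed

lemma continuous_tang:
  assumes v: "continuous_on UNIV v"
  shows "continuous_on UNIV (\<lambda>p. tang v (fst p) (snd p))"
  unfolding tang_def by (intro continuous_intros continuous_on_compose2[OF v]) auto

text \<open>Divergence theorem for \<open>g\<close>, \<open>rho R\<close> and
  \<open>tang v s\<close> multiplied together. The term with the gradient of \<open>rho R\<close>
  drops out because that gradient is radial and \<open>tang v s x\<close> is orthogonal to
  \<open>x\<close>. In the divergence of \<open>tang v s\<close> the divergence of \<open>v\<close>
  vanishes by \<open>dv\<close>, and in dimension 3 the multiples of
  \<open>x \<bullet> v (s\<^sup>2 x)\<close> add up to \<open>2 - 1 - 3 = -2\<close>.\<close>

lemma tang_integral_identity:
  assumes v: "smooth v" and dv: "\<And>x. divergence v x = 0" and g: "smooth g" and R: "R > 0"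
  shows "(LINT x|lborel. rho R x * frechet_derivative g (at x) (tang v s x)
      - g x * rho R x * (x \<bullet> (2 *\<^sub>R v (s\<^sup>2 *\<^sub>R x) + s\<^sup>2 *\<^sub>R frechet_derivative v (at (s\<^sup>2 *\<^sub>R x)) x))) = 0"
proof -
  define Dv where "Dv = (\<lambda>x. frechet_derivative v (at x))"
  define Dg where "Dg = (\<lambda>x. frechet_derivative g (at x))"
  define V where "V = (\<lambda>x. v (s\<^sup>2 *\<^sub>R x))"
  define V' where "V' = (\<lambda>x h. s\<^sup>2 *\<^sub>R Dv (s\<^sup>2 *\<^sub>R x) h)"
  define W' where "W' = (\<lambda>x h. (2 * (x \<bullet> h)) *\<^sub>R V x + (x \<bullet> x) *\<^sub>R V' x h - (h \<bullet> V x + x \<bullet> V' x h) *\<^sub>R x - (x \<bullet> V x) *\<^sub>R h)"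
  define F' where "F' = (\<lambda>x h. (g x * rho R x) *\<^sub>R W' x h
      + (Dg x h * rho R x + g x * ((24 / R ^ 4) * cutoff R x * (x \<bullet> h))) *\<^sub>R tang v s x)"
  have Dv: "(v has_derivative Dv x) (at x)" for x unfolding Dv_def by (rule smooth_has_derivative[OF v])
  have lin: "linear (Dv x)" for x using Dv by (rule has_derivative_linear)
  have Dg: "(g has_derivative Dg x) (at x)" for x unfolding Dg_def by (rule smooth_has_derivative[OF g])
  have V: "(V has_derivative V' x) (at x)" for x
  proof -
    have "((\<lambda>x. s\<^sup>2 *\<^sub>R x) has_derivative (\<lambda>h. s\<^sup>2 *\<^sub>R h)) (at x)" by (auto intro!: derivative_eq_intros)
    from has_derivative_compose[OF this Dv] show ?thesis
      by (simp add: V_def V'_def linear_cmul[OF lin])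
  qed
  have W: "(tang v s has_derivative W' x) (at x)" for x
  proof -
    have t: "tang v s = (\<lambda>x. (x \<bullet> x) *\<^sub>R V x - (x \<bullet> V x) *\<^sub>R x)" by (auto simp: tang_def V_def)
    note id = has_derivative_ident[where F = "at x"]
    show ?thesis
      unfolding t W'_def
      by (rule has_derivative_eq_rhs[OF has_derivative_diff[OF
              has_derivative_scaleR[OF has_derivative_inner[OF id id] V]
              has_derivative_scaleR[OF has_derivative_inner[OF id V] id]]])
        (auto simp: fun_eq_iff inner_commute algebra_simps)
  qed
  have der: "((\<lambda>x. (g x * rho R x) *\<^sub>R tang v s x) has_derivative F' x) (at x)" for x
    unfolding F'_def
    by (rule has_derivative_eq_rhs[OF has_derivative_scaleR[OF has_derivative_mult[OF Dg rho_has_derivative] W]])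
      (auto simp: fun_eq_iff algebra_simps)
  have cDv: "continuous_on UNIV (\<lambda>x. Dv x h)" for h
    unfolding Dv_def by (rule smooth_continuous[OF smooth_frechet_derivative[OF v]])
  have cDg: "continuous_on UNIV (\<lambda>x. Dg x h)" for h
    unfolding Dg_def by (rule smooth_continuous[OF smooth_frechet_derivative[OF g]])
  have cV: "continuous_on UNIV V" "continuous_on UNIV (\<lambda>x. V' x h)" for h
    unfolding V_def V'_def
    by (intro continuous_intros continuous_on_compose2[OF smooth_continuous[OF v]] continuous_on_compose2[OF cDv]; auto)+
  have cW: "continuous_on UNIV (tang v s)"
    unfolding tang_def V_def[symmetric, THEN fun_cong] 
    using cV(1) unfolding V_def by (intro continuous_intros) auto
  have cont: "continuous_on UNIV (\<lambda>x. F' x h)" for h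
    unfolding F'_def W'_def
    by (intro continuous_intros cV cW cDg rho_continuous cutoff_continuous smooth_continuous[OF g])
  have 0: "(LINT x|lborel. (\<Sum>i\<in>UNIV. F' x (axis i 1) $ i)) = 0"
    by (rule divergence_theorem_compact_support[OF der cont, of R]) (simp add: rho_eq_0 R)
  have eq: "(\<Sum>i\<in>UNIV. F' x (axis i 1) $ i) = rho R x * Dg x (tang v s x)
      - g x * rho R x * (x \<bullet> (2 *\<^sub>R V x + V' x x))" for x
  proof -
    have divV: "(\<Sum>i\<in>UNIV. V' x (axis i 1) $ i) = 0"
      using dv[of "s\<^sup>2 *\<^sub>R x"] by (simp add: V'_def Dv_def divergence_def pd_def flip: sum_distrib_left)
    have xV': "(\<Sum>i\<in>UNIV. (x \<bullet> V' x (axis i 1)) * x $ i) = x \<bullet> V' x x"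
    proof -
      have "V' x x = (\<Sum>i\<in>UNIV. x $ i *\<^sub>R V' x (axis i 1))"
        unfolding V'_def Dv_def frechet_derivative_axis_sum[OF v, of _ x]
        by (simp add: pd_def scaleR_sum_right mult.commute)
      then show ?thesis by (simp add: inner_sum_right mult.commute)
    qed
    have axis: "x \<bullet> axis i 1 = x $ i" "axis i 1 \<bullet> x = x $ i" for x :: "real^3" and i
      by (simp_all add: inner_axis inner_axis')
    have "(\<Sum>i\<in>UNIV. W' x (axis i 1) $ i) =
        (\<Sum>i\<in>UNIV. 2 * (x $ i * V x $ i)) + (x \<bullet> x) * (\<Sum>i\<in>UNIV. V' x (axis i 1) $ i)
        - ((\<Sum>i\<in>UNIV. x $ i * V x $ i) + (\<Sum>i\<in>UNIV. (x \<bullet> V' x (axis i 1)) * x $ i))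
        - (\<Sum>i\<in>(UNIV::3 set). (x \<bullet> V x))"
      unfolding W'_def axis by (simp add: sum.distrib sum_subtractf sum_distrib_left axis_def algebra_simps)
    also have "\<dots> = - (x \<bullet> (2 *\<^sub>R V x + V' x x))"
    proof -
      have "(\<Sum>i\<in>UNIV. 2 * (x $ i * V x $ i)) = 2 * (x \<bullet> V x)" "(\<Sum>i\<in>UNIV. x $ i * V x $ i) = x \<bullet> V x"
        by (simp_all add: inner_vec_def sum_distrib_left)
      then show ?thesis unfolding divV xV' by (simp add: inner_add_right)
    qed
    finally have W: "(\<Sum>i\<in>UNIV. W' x (axis i 1) $ i) = - (x \<bullet> (2 *\<^sub>R V x + V' x x))" .
    have Dgt: "(\<Sum>i\<in>UNIV. Dg x (axis i 1) * tang v s x $ i) = Dg x (tang v s x)"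
      unfolding Dg_def by (subst (2) frechet_derivative_axis_sum[OF g]) (simp add: pd_def mult.commute)
    have orth: "(\<Sum>i\<in>UNIV. x $ i * tang v s x $ i) = 0"
    proof -
      have "(\<Sum>i\<in>UNIV. x $ i * tang v s x $ i) = x \<bullet> tang v s x" by (simp add: inner_vec_def)
      also have "\<dots> = 0" by (simp add: tang_def inner_diff_right)
      finally show ?thesis .
    qed
    have "(\<Sum>i\<in>UNIV. F' x (axis i 1) $ i) = (g x * rho R x) * (\<Sum>i\<in>UNIV. W' x (axis i 1) $ i)
        + rho R x * (\<Sum>i\<in>UNIV. Dg x (axis i 1) * tang v s x $ i)
        + (g x * ((24 / R ^ 4) * cutoff R x)) * (\<Sum>i\<in>UNIV. x $ i * tang v s x $ i)"
      unfolding F'_def axis sum_distrib_left sum.distrib[symmetric] by (intro sum.cong) (simp_all add: algebra_simps)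
    then show ?thesis unfolding W Dgt orth by simp
  qed
  show ?thesis using 0 unfolding eq Dg_def V_def V'_def Dv_def by simp
qed

lemma homotopy_integrand_integrable:
  assumes v: "continuous_on UNIV v"
  shows "integrable lborel (\<lambda>s. indicat_real {0..1} s *\<^sub>R ((2 * s ^ 3) *\<^sub>R tang v s x))"
  unfolding tang_def
  by (rule borel_integrable_compact) (auto intro!: continuous_intros continuous_on_compose2[OF v])

text \<open>The integrand is the derivative of
  \<open>s ^ 4 *\<^sub>R v (s\<^sup>2 *\<^sub>R x)\<close> in \<open>s\<close>, a primitive that is
  \<open>v x\<close> at 1 and 0 at 0. This is why the weight \<open>2 * s ^ 3\<close> recovers the
  field itself.\<close>

lemma radial_integral:
  fixes v :: "real^3 \<Rightarrow> real^3"
  assumes v: "smooth v"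
  shows "has_bochner_integral lborel (\<lambda>s. indicat_real {0..1} s *\<^sub>R ((2 * s ^ 3) *\<^sub>R
     (2 *\<^sub>R v (s\<^sup>2 *\<^sub>R x) + s\<^sup>2 *\<^sub>R frechet_derivative v (at (s\<^sup>2 *\<^sub>R x)) x))) (v x)"
proof -
  have lin: "linear (frechet_derivative v (at y))" for y by (rule smooth_linear_frechet[OF v])
  have "has_bochner_integral lborel (\<lambda>s. indicat_real {0..1} s *\<^sub>R ((2 * s ^ 3) *\<^sub>R
     (2 *\<^sub>R v (s\<^sup>2 *\<^sub>R x) + s\<^sup>2 *\<^sub>R frechet_derivative v (at (s\<^sup>2 *\<^sub>R x)) x)))
     ((1::real) ^ 4 *\<^sub>R v (1\<^sup>2 *\<^sub>R x) - (0::real) ^ 4 *\<^sub>R v (0\<^sup>2 *\<^sub>R x))"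
  proof (rule has_bochner_integral_FTC_Icc[where F = "\<lambda>s. s ^ 4 *\<^sub>R v (s\<^sup>2 *\<^sub>R x)"])
    show "((\<lambda>s. s ^ 4 *\<^sub>R v (s\<^sup>2 *\<^sub>R x)) has_vector_derivative (2 * s ^ 3) *\<^sub>R
       (2 *\<^sub>R v (s\<^sup>2 *\<^sub>R x) + s\<^sup>2 *\<^sub>R frechet_derivative v (at (s\<^sup>2 *\<^sub>R x)) x)) (at s within {0..1})" for s
    proof -
      have "((\<lambda>s. s\<^sup>2 *\<^sub>R x) has_derivative (\<lambda>h. (2 * s * h) *\<^sub>R x)) (at s)"
        by (auto intro!: derivative_eq_intros)
      from has_derivative_compose[OF this smooth_has_derivative[OF v]]
      have 1: "((\<lambda>s. v (s\<^sup>2 *\<^sub>R x)) has_derivative (\<lambda>h. (2 * s * h) *\<^sub>R frechet_derivative v (at (s\<^sup>2 *\<^sub>R x)) x)) (at s)"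
        by (simp add: linear_cmul[OF lin])
      have 2: "((\<lambda>s. s ^ 4) has_derivative (\<lambda>h. 4 * s ^ 3 * h)) (at s)"
        by (auto intro!: derivative_eq_intros)
      have "((\<lambda>s. s ^ 4 *\<^sub>R v (s\<^sup>2 *\<^sub>R x)) has_derivative (\<lambda>h. h *\<^sub>R ((2 * s ^ 3) *\<^sub>R
       (2 *\<^sub>R v (s\<^sup>2 *\<^sub>R x) + s\<^sup>2 *\<^sub>R frechet_derivative v (at (s\<^sup>2 *\<^sub>R x)) x)))) (at s)"
        by (rule has_derivative_eq_rhs[OF has_derivative_scaleR[OF 2 1]])
          (auto simp: fun_eq_iff scaleR_add_right power2_eq_square power3_eq_cube power4_eq_xxxx mult_ac)
      then show ?thesis unfolding has_vector_derivative_def by (rule has_derivative_at_withinI)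
    qed
    show "continuous_on {0..1} (\<lambda>s. (2 * s ^ 3) *\<^sub>R
       (2 *\<^sub>R v (s\<^sup>2 *\<^sub>R x) + s\<^sup>2 *\<^sub>R frechet_derivative v (at (s\<^sup>2 *\<^sub>R x)) x))"
      by (intro continuous_intros continuous_on_compose2[OF smooth_continuous[OF v]]
          continuous_on_compose2[OF smooth_continuous[OF smooth_frechet_derivative[OF v]]]) auto
  qed auto
  then show ?thesis by simp
qed

text \<open>Integrate \<open>tang_integral_identity\<close> against \<open>2 * s ^ 3\<close> over
  the unit interval and exchange the integrals: \<open>tang\<close> turns into
  \<open>homotopy\<close>, and the radial term into \<open>v x\<close>. This is the weak form of the
  statement that \<open>rho R x *\<^sub>R homotopy v x\<close> has divergence
  \<open>- rho R x * (x \<bullet> v x)\<close>, obtained without differentiating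
  \<open>homotopy\<close>.\<close>

lemma homotopy_integral_identity:
  assumes v: "smooth v" and dv: "\<And>x. divergence v x = 0" and g: "smooth g" and R: "R > 0"
  shows "integrable lborel (\<lambda>x. rho R x * frechet_derivative g (at x) (homotopy v x) - g x * rho R x * (x \<bullet> v x))"
    and "(LINT x|lborel. rho R x * frechet_derivative g (at x) (homotopy v x) - g x * rho R x * (x \<bullet> v x)) = 0"
proof -
  define H where "H = (\<lambda>(s::real, x). (2 * s ^ 3) * (rho R x * frechet_derivative g (at x) (tang v s x)
      - g x * rho R x * (x \<bullet> (2 *\<^sub>R v (s\<^sup>2 *\<^sub>R x) + s\<^sup>2 *\<^sub>R frechet_derivative v (at (s\<^sup>2 *\<^sub>R x)) x))))"
  note cv = smooth_continuous[OF v] and cg = smooth_continuous[OF g]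
  have "continuous_on UNIV H"
    unfolding H_def case_prod_unfold frechet_derivative_axis_sum[OF v] frechet_derivative_axis_sum[OF g]
    by (intro continuous_intros continuous_tang[OF cv] continuous_on_compose2[OF cv] continuous_on_compose2[OF cg]
        continuous_on_compose2[OF continuous_pd[OF v]] continuous_on_compose2[OF continuous_pd[OF g]]
        continuous_on_compose2[OF rho_continuous]) auto
  then have pair: "integrable (lborel \<Otimes>\<^sub>M lborel) (\<lambda>(s, x). indicat_real {0..1} s *\<^sub>R H (s, x))"
    by (rule pair_integrable_compact_support[where R=R]) (simp add: H_def rho_eq_0 R)
  have inner: "(LINT s|lborel. indicat_real {0..1} s *\<^sub>R H (s, x))
      = rho R x * frechet_derivative g (at x) (homotopy v x) - g x * rho R x * (x \<bullet> v x)" for x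
  proof -
    have blin: "bounded_linear (frechet_derivative g (at x))"
      by (simp add: smooth_linear_frechet[OF g] linear_conv_bounded_linear[symmetric])
    define a where "a = (\<lambda>s. indicat_real {0..1} s *\<^sub>R ((2 * s ^ 3) *\<^sub>R tang v s x))"
    define b where "b = (\<lambda>s. indicat_real {0..1} s *\<^sub>R ((2 * s ^ 3) *\<^sub>R
     (2 *\<^sub>R v (s\<^sup>2 *\<^sub>R x) + s\<^sup>2 *\<^sub>R frechet_derivative v (at (s\<^sup>2 *\<^sub>R x)) x)))"
    have a: "integrable lborel a" unfolding a_def by (rule homotopy_integrand_integrable[OF cv])
    have b: "integrable lborel b" "(LINT s|lborel. b s) = v x"
      using radial_integral[OF v, of x] unfolding b_def by (auto simp: has_bochner_integral_iff)
    have "indicat_real {0..1} s *\<^sub>R H (s, x) = rho R x * frechet_derivative g (at x) (a s) - g x * rho R x * (x \<bullet> b s)" for s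
      unfolding H_def a_def b_def using linear_cmul[OF smooth_linear_frechet[OF g]]
      by (simp add: inner_add_right algebra_simps)
    then have "(LINT s|lborel. indicat_real {0..1} s *\<^sub>R H (s, x))
       = (LINT s|lborel. rho R x * frechet_derivative g (at x) (a s) - g x * rho R x * (x \<bullet> b s))" by presburger
    also have "\<dots> = rho R x * (LINT s|lborel. frechet_derivative g (at x) (a s)) - g x * rho R x * (LINT s|lborel. x \<bullet> b s)"
      using a b integrable_bounded_linear[OF blin a] by simp
    also have "(LINT s|lborel. frechet_derivative g (at x) (a s)) = frechet_derivative g (at x) (homotopy v x)"
      using integral_bounded_linear[OF blin a] by (simp add: homotopy_def a_def)
    also have "(LINT s|lborel. x \<bullet> b s) = x \<bullet> v x"
      using b by simp
    finally show ?thesis .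
  qed
  show "integrable lborel (\<lambda>x. rho R x * frechet_derivative g (at x) (homotopy v x) - g x * rho R x * (x \<bullet> v x))"
    using lborel_pair.integrable_snd[OF pair] unfolding inner .
  have "(LINT x|lborel. LINT s|lborel. indicat_real {0..1} s *\<^sub>R H (s, x))
      = (LINT s|lborel. LINT x|lborel. indicat_real {0..1} s *\<^sub>R H (s, x))"
    by (rule lborel_pair.Fubini_integral[OF pair])
  also have "\<dots> = 0"
    unfolding H_def using tang_integral_identity[OF assms] by simp
  finally show "(LINT x|lborel. rho R x * frechet_derivative g (at x) (homotopy v x) - g x * rho R x * (x \<bullet> v x)) = 0"
    unfolding inner .
qed

text \<open>The field \<open>cutoff R x ^ 3 *\<^sub>R v x\<close> has divergence
  \<open>rho R x * (x \<bullet> v x)\<close>, because \<open>v\<close> is divergence free; the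
  homotopy term has exactly the opposite weak divergence. Compact support of both terms admits every
  smooth \<open>g\<close>.\<close>

lemma compact_approx_weakly_div_free:
  fixes g :: "real^3 \<Rightarrow> real"
  assumes v: "smooth v" and dv: "\<And>x. divergence v x = 0" and g: "smooth g" and R: "R > 0"
  shows "(LINT x|lborel. frechet_derivative g (at x) (compact_approx R v x)) = 0"
proof -
  define F' where "F' = (\<lambda>x h. (g x * cutoff R x ^ 3) *\<^sub>R frechet_derivative v (at x) h
      + (frechet_derivative g (at x) h * cutoff R x ^ 3 + g x * (rho R x * (x \<bullet> h))) *\<^sub>R v x)"
  note cv = smooth_continuous[OF v] and cg = smooth_continuous[OF g]
  have der: "((\<lambda>x. (g x * cutoff R x ^ 3) *\<^sub>R v x) has_derivative F' x) (at x)" for x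
    unfolding F'_def
    by (rule has_derivative_eq_rhs[OF has_derivative_scaleR[OF
            has_derivative_mult[OF smooth_has_derivative[OF g] cutoff3_has_derivative] smooth_has_derivative[OF v]]])
      (auto simp: fun_eq_iff algebra_simps)
  have cont: "continuous_on UNIV (\<lambda>x. F' x h)" for h
    unfolding F'_def
    by (intro continuous_intros cv cg rho_continuous cutoff_continuous smooth_continuous[OF smooth_frechet_derivative] v g)
  have axis: "x \<bullet> axis i 1 = x $ i" for x :: "real^3" and i by (simp add: inner_axis)
  have eq: "(\<Sum>i\<in>UNIV. F' x (axis i 1) $ i) = cutoff R x ^ 3 * frechet_derivative g (at x) (v x) + g x * rho R x * (x \<bullet> v x)" for x
  proof -
    have "(\<Sum>i\<in>UNIV. F' x (axis i 1) $ i) = (g x * cutoff R x ^ 3) * divergence v x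
      + cutoff R x ^ 3 * (\<Sum>i\<in>UNIV. frechet_derivative g (at x) (axis i 1) * v x $ i)
      + g x * rho R x * (\<Sum>i\<in>UNIV. x $ i * v x $ i)"
      unfolding F'_def axis divergence_def pd_def sum_distrib_left sum.distrib[symmetric]
      by (intro sum.cong) (simp_all add: algebra_simps)
    also have "(\<Sum>i\<in>UNIV. frechet_derivative g (at x) (axis i 1) * v x $ i) = frechet_derivative g (at x) (v x)"
      by (subst (2) frechet_derivative_axis_sum[OF g]) (simp add: pd_def mult.commute)
    finally show ?thesis by (simp add: dv inner_vec_def)
  qed
  have 0: "(LINT x|lborel. cutoff R x ^ 3 * frechet_derivative g (at x) (v x) + g x * rho R x * (x \<bullet> v x)) = 0"
    using divergence_theorem_compact_support[OF der cont, of R] unfolding eq by (simp add: cutoff_eq_0 R)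
  have i: "integrable lborel (\<lambda>x. cutoff R x ^ 3 * frechet_derivative g (at x) (v x) + g x * rho R x * (x \<bullet> v x))"
    unfolding frechet_derivative_axis_sum[OF g]
    by (rule compact_support_integrable[where R=R])
      (auto intro!: continuous_intros cutoff_continuous rho_continuous cv cg continuous_pd[OF g] simp: cutoff_eq_0 rho_eq_0 R)
  have lin: "linear (frechet_derivative g (at x))" for x by (rule smooth_linear_frechet[OF g])
  have "frechet_derivative g (at x) (compact_approx R v x) =
      (cutoff R x ^ 3 * frechet_derivative g (at x) (v x) + g x * rho R x * (x \<bullet> v x))
      + (rho R x * frechet_derivative g (at x) (homotopy v x) - g x * rho R x * (x \<bullet> v x))" for x
    unfolding compact_approx_def by (simp add: linear_add[OF lin] linear_cmul[OF lin])
  then have "(LINT x|lborel. frechet_derivative g (at x) (compact_approx R v x)) =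
    (LINT x|lborel. (cutoff R x ^ 3 * frechet_derivative g (at x) (v x) + g x * rho R x * (x \<bullet> v x))
      + (rho R x * frechet_derivative g (at x) (homotopy v x) - g x * rho R x * (x \<bullet> v x)))"
    by presburger
  also have "\<dots> = 0"
    unfolding Bochner_Integration.integral_add[OF i homotopy_integral_identity(1)[OF assms]]
    by (simp only: 0 homotopy_integral_identity(2)[OF assms] add_0)
  finally show ?thesis .
qed

text \<open>Here the substitution by \<open>s\<^sup>2\<close> pays off. In the original variable
  \<open>\<sigma>\<close>, squaring the integrand and integrating over \<open>x\<close> leaves the
  divergent integral of \<open>\<sigma>\<^sup>2 / \<sigma> ^ 3\<close>, whereas in \<open>s\<close>
  the result is constant, so Cauchy-Schwarz on the unit interval suffices and the L2 norm of
  \<open>m\<close> is at most twice that of \<open>v\<close>.\<close>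

lemma homotopy_bound:
  assumes v: "smooth v" "l2 v"
  obtains m where "l2 m" "\<And>x. m x \<ge> (0::real)" "\<And>x. norm (homotopy v x) \<le> (norm x)\<^sup>2 * m x"
proof -
  note cv = smooth_continuous[OF v(1)]
  have [measurable]: "v \<in> borel_measurable borel" using v by (simp add: l2_def)
  define q where "q = (\<lambda>s x. indicat_real {0..1} s *\<^sub>R (2 * s ^ 3 * norm (v (s\<^sup>2 *\<^sub>R x))))"
  define m where "m = (\<lambda>x. LINT s|lborel. q s x)"
  have qi: "integrable lborel (\<lambda>s. q s x)" for x
    unfolding q_def by (rule borel_integrable_compact) (auto intro!: continuous_intros continuous_on_compose2[OF cv])
  have ql2: "l2 (\<lambda>s. q s x)" for x
  proof -
    have "integrable lborel (\<lambda>s. indicat_real {0..1} s *\<^sub>R (2 * s ^ 3 * norm (v (s\<^sup>2 *\<^sub>R x)))\<^sup>2)"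
      by (rule borel_integrable_compact) (auto intro!: continuous_intros continuous_on_compose2[OF cv])
    also have "(\<lambda>s. indicat_real {0..1} s *\<^sub>R (2 * s ^ 3 * norm (v (s\<^sup>2 *\<^sub>R x)))\<^sup>2) = (\<lambda>s. (norm (q s x))\<^sup>2)"
      by (auto simp: fun_eq_iff q_def indicator_def)
    finally show ?thesis unfolding l2_def q_def by simp
  qed
  have one: "l2 (indicat_real {0..1::real})" "n2 (indicat_real {0..1::real}) = 1"
  proof -
    have "(\<lambda>s. (norm (indicat_real {0..1} s))\<^sup>2) = indicat_real {0..1::real}" by (auto simp: fun_eq_iff indicator_def)
    then show "l2 (indicat_real {0..1::real})" "n2 (indicat_real {0..1::real}) = 1"
      by (simp_all only: l2_def n2_def ip_self) simp_all
  qed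
  have pair: "integrable (lborel \<Otimes>\<^sub>M lborel) (\<lambda>(s, x). (q s x)\<^sup>2)"
  proof (rule lborel_pair.Fubini_integrable)
    show "(\<lambda>(s, x). (q s x)\<^sup>2) \<in> borel_measurable (lborel \<Otimes>\<^sub>M lborel)" unfolding q_def by measurable
    have int_v: "integrable lborel (\<lambda>x. (norm (v x))\<^sup>2)" by (rule l2_integrable[OF v(2)])
    have *: "integrable lborel (\<lambda>x. (q s x)\<^sup>2) \<and>
        (LINT x|lborel. (q s x)\<^sup>2) = indicat_real {0..1} s * (4 * (n2 v)\<^sup>2)" if "s \<noteq> 0" for s
    proof -
      \<comment> \<open>The power \<open>s ^ 6\<close> equals the Jacobian of
        \<open>x \<mapsto> s\<^sup>2 *\<^sub>R x\<close> in dimension 3, so no power of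
        \<open>s\<close> survives the integration over \<open>x\<close>.\<close>
      have eq: "(q s x)\<^sup>2 = (indicat_real {0..1} s * 4 * s ^ 6) * (norm (v (0 + s\<^sup>2 *\<^sub>R x)))\<^sup>2" for x
        by (auto simp: q_def indicator_def power_mult_distrib simp flip: power_mult)
      have "s\<^sup>2 \<noteq> 0" using that by simp
      note aff = lborel_affine_integral[OF _ this, of "\<lambda>x. (norm (v x))\<^sup>2" "0::real^3"]
      have "(n2 v)\<^sup>2 = s ^ 6 * (LINT x|lborel. (norm (v (0 + s\<^sup>2 *\<^sub>R x)))\<^sup>2)"
        unfolding n2_power2_int using aff(2) by (simp flip: power_mult)
      then show ?thesis unfolding eq using aff(1) int_v by simp
    qed
    have "integrable lborel (\<lambda>s::real. indicat_real {0..1} s * (4 * (n2 v)\<^sup>2))" by simp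
    moreover have "AE s::real in lborel. (LINT x|lborel. (q s x)\<^sup>2) = indicat_real {0..1} s * (4 * (n2 v)\<^sup>2)"
      using AE_lborel_singleton[of "0::real"] by eventually_elim (use * in blast)
    ultimately show "integrable lborel (\<lambda>s. LINT x|lborel. norm (case (s, x) of (s, x) \<Rightarrow> (q s x)\<^sup>2))"
      by (subst integrable_cong_AE[where g = "\<lambda>s. indicat_real {0..1} s * (4 * (n2 v)\<^sup>2)"]) (auto simp: q_def)
    show "AE s in lborel. integrable lborel (\<lambda>x. case (s, x) of (s, x) \<Rightarrow> (q s x)\<^sup>2)"
      using AE_lborel_singleton[of "0::real"] by eventually_elim (use * in auto)
  qed
  have mm: "m \<in> borel_measurable borel" unfolding m_def q_def by measurable
  have m_sq: "(norm (m x))\<^sup>2 \<le> (LINT s|lborel. (q s x)\<^sup>2)" for x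
  proof -
    have "m x = ip (indicat_real {0..1}) (\<lambda>s. q s x)"
      unfolding m_def ip_def by (rule Bochner_Integration.integral_cong) (auto simp: q_def indicator_def)
    then have "\<bar>m x\<bar> \<le> n2 (\<lambda>s. q s x)" using ip_Cauchy_Schwarz[OF one(1) ql2[of x]] one(2) by simp
    then have "\<bar>m x\<bar>\<^sup>2 \<le> (n2 (\<lambda>s. q s x))\<^sup>2" by (rule power_mono) simp
    then show ?thesis by (simp add: n2_power2_int)
  qed
  have "l2 m" by (rule l2I_bound[OF mm lborel_pair.integrable_snd[OF pair] m_sq])
  moreover have "m x \<ge> 0" for x
    unfolding m_def q_def by (intro integral_nonneg_AE AE_I2) (auto simp: indicator_def)
  moreover have "norm (homotopy v x) \<le> (norm x)\<^sup>2 * m x" for x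
  proof -
    have t: "norm (tang v s x) \<le> (norm x)\<^sup>2 * norm (v (s\<^sup>2 *\<^sub>R x))" for s
    proof (rule power2_le_imp_le)
      have "(norm (tang v s x))\<^sup>2 = ((norm x)\<^sup>2 * norm (v (s\<^sup>2 *\<^sub>R x)))\<^sup>2 - (norm x)\<^sup>2 * (x \<bullet> v (s\<^sup>2 *\<^sub>R x))\<^sup>2"
        unfolding tang_def power_mult_distrib power2_norm_eq_inner
        by (simp add: inner_diff_left inner_diff_right inner_commute power2_eq_square algebra_simps)
      then show "(norm (tang v s x))\<^sup>2 \<le> ((norm x)\<^sup>2 * norm (v (s\<^sup>2 *\<^sub>R x)))\<^sup>2" by simp
    qed simp
    have "norm (homotopy v x) \<le> (LINT s|lborel. norm (indicat_real {0..1} s *\<^sub>R ((2 * s ^ 3) *\<^sub>R tang v s x)))"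
      unfolding homotopy_def by (rule integral_norm_bound)
    also have "\<dots> \<le> (LINT s|lborel. (norm x)\<^sup>2 * q s x)"
    proof (rule integral_mono)
      show "norm (indicat_real {0..1} s *\<^sub>R ((2 * s ^ 3) *\<^sub>R tang v s x)) \<le> (norm x)\<^sup>2 * q s x" for s
        using mult_left_mono[OF t[of s], of "2 * s ^ 3"] by (auto simp: q_def indicator_def abs_mult mult_ac)
    qed (rule integrable_norm[OF homotopy_integrand_integrable[OF cv]], use qi in auto)
    also have "\<dots> = (norm x)\<^sup>2 * m x" by (simp add: m_def)
    finally show ?thesis .
  qed
  ultimately show ?thesis by (rule that)
qed

text \<open>The fields \<open>w n\<close> are only square integrable and weakly divergence free.
  That fits their use: they enter the equation as \<open>conv k (w n)\<close>, which is a smooth,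
  compactly supported, classically divergence-free field.\<close>

theorem compact_div_free_approximation:
  assumes v: "smooth v" "l2 v" and dv: "\<And>x. divergence v x = 0"
  obtains w :: "nat \<Rightarrow> real^3 \<Rightarrow> real^3" where
    "\<And>n. l2 (w n)" "\<And>n. \<exists>R. \<forall>x. norm x > R \<longrightarrow> w n x = 0"
    "\<And>n (g :: real^3 \<Rightarrow> real). smooth g \<Longrightarrow> (LINT x|lborel. frechet_derivative g (at x) (w n x)) = 0"
    "(\<lambda>n. n2 (\<lambda>x. w n x - v x)) \<longlonglongrightarrow> 0"
proof -
  obtain m where m: "l2 m" "\<And>x. m x \<ge> (0::real)" "\<And>x. norm (homotopy v x) \<le> (norm x)\<^sup>2 * m x"
    using homotopy_bound[OF v] by blast
  have [measurable]: "v \<in> borel_measurable borel" using v by (simp add: l2_def)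
  have [measurable]: "cutoff R \<in> borel_measurable borel" "rho R \<in> borel_measurable borel" for R
    by (auto intro: borel_measurable_continuous_onI cutoff_continuous rho_continuous)
  have [measurable]: "homotopy v \<in> borel_measurable borel"
    unfolding homotopy_def tang_def by measurable
  define w where "w = (\<lambda>n. compact_approx (real (Suc n)) v)"
  have wm: "w n \<in> borel_measurable borel" for n unfolding w_def compact_approx_def by measurable
  \<comment> \<open>From \<open>(p + 6 * m)\<^sup>2 \<le> 2 * p\<^sup>2 + 72 * m\<^sup>2\<close>,
    where the 6 is the constant of \<open>rho_bound_support\<close>.\<close>
  define b where "b = (\<lambda>x. (2 * (norm (v x))\<^sup>2 + 72 * (m x)\<^sup>2))"
  have bi: "integrable lborel b"
    unfolding b_def using l2_integrable[OF v(2)] l2_integrable[OF m(1)] by simp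
  have diff: "norm (w n x - v x) \<le> (1 - cutoff (real (Suc n)) x ^ 3) * norm (v x) + \<bar>rho (real (Suc n)) x\<bar> * (norm x)\<^sup>2 * m x" for n x
  proof -
    have "w n x - v x = - ((1 - cutoff (real (Suc n)) x ^ 3) *\<^sub>R v x) + rho (real (Suc n)) x *\<^sub>R homotopy v x"
      by (simp add: w_def compact_approx_def algebra_simps)
    also have "norm \<dots> \<le> norm ((1 - cutoff (real (Suc n)) x ^ 3) *\<^sub>R v x) + norm (rho (real (Suc n)) x *\<^sub>R homotopy v x)"
      using norm_triangle_ineq by (metis norm_minus_cancel)
    also have "\<dots> \<le> (1 - cutoff (real (Suc n)) x ^ 3) * norm (v x) + \<bar>rho (real (Suc n)) x\<bar> * ((norm x)\<^sup>2 * m x)"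
      using cutoff_bounds[of "real (Suc n)" x] m(3)[of x] by (simp add: power_le_one mult_left_mono)
    finally show ?thesis by (simp add: mult.assoc)
  qed
  have bound: "(norm (w n x - v x))\<^sup>2 \<le> b x" for n x
  proof -
    have "(1 - cutoff (real (Suc n)) x ^ 3) * norm (v x) \<le> 1 * norm (v x)"
      using cutoff_bounds[of "real (Suc n)" x] by (intro mult_right_mono) auto
    moreover have "\<bar>rho (real (Suc n)) x\<bar> * (norm x)\<^sup>2 * m x \<le> 6 * m x"
      using m(2) by (intro mult_right_mono rho_bound_support) auto
    ultimately have "norm (w n x - v x) \<le> norm (v x) + 6 * m x" using diff[of n x] by linarith
    then have "(norm (w n x - v x))\<^sup>2 \<le> (norm (v x) + 6 * m x)\<^sup>2" by (rule power_mono) simp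
    also have "\<dots> \<le> b x"
      using zero_le_power2[of "norm (v x) - 6 * m x"] by (simp add: b_def power2_eq_square algebra_simps)
    finally show ?thesis .
  qed
  have l2d: "l2 (\<lambda>x. w n x - v x)" for n
    by (rule l2I_bound[OF _ bi bound]) (use wm[of n] in measurable)
  have l2w: "l2 (w n)" for n using l2_add[OF l2d v(2)] by simp
  have lim: "(\<lambda>n. n2 (\<lambda>x. w n x - v x)) \<longlonglongrightarrow> 0"
  proof (rule n2_tendsto_0I[OF l2d bi bound])
    show "AE x in lborel. (\<lambda>n. w n x - v x) \<longlonglongrightarrow> 0"
    proof (rule AE_I2, rule Lim_null_comparison)
      fix x
      show "\<forall>\<^sub>F n in sequentially. norm (w n x - v x) \<le>
          (1 - cutoff (real (Suc n)) x ^ 3) * norm (v x) + (6 / (real (Suc n))\<^sup>2) * (norm x)\<^sup>2 * m x"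
      proof (intro always_eventually allI)
        fix n
        have "\<bar>rho (real (Suc n)) x\<bar> * (norm x)\<^sup>2 * m x \<le> (6 / (real (Suc n))\<^sup>2) * (norm x)\<^sup>2 * m x"
          using m(2) by (intro mult_right_mono rho_bound) auto
        then show "norm (w n x - v x) \<le>
          (1 - cutoff (real (Suc n)) x ^ 3) * norm (v x) + (6 / (real (Suc n))\<^sup>2) * (norm x)\<^sup>2 * m x"
          using diff[of n x] by linarith
      qed
      have inv: "(\<lambda>n. inverse ((real (Suc n))\<^sup>2)) \<longlonglongrightarrow> 0"
        unfolding power_inverse[symmetric] using tendsto_power[OF LIMSEQ_inverse_real_of_nat, of 2] by simp
      have "(\<lambda>n. (1 - (max 0 (1 - inverse ((real (Suc n))\<^sup>2) * (x \<bullet> x))) ^ 3) * norm (v x) + (6 * inverse ((real (Suc n))\<^sup>2)) * (norm x)\<^sup>2 * m x)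
          \<longlonglongrightarrow> (1 - (max 0 (1 - 0 * (x \<bullet> x))) ^ 3) * norm (v x) + (6 * 0) * (norm x)\<^sup>2 * m x"
        by (intro tendsto_intros inv)
      then show "(\<lambda>n. (1 - cutoff (real (Suc n)) x ^ 3) * norm (v x) + (6 / (real (Suc n))\<^sup>2) * (norm x)\<^sup>2 * m x) \<longlonglongrightarrow> 0"
        by (simp add: cutoff_def divide_inverse)
    qed
  qed
  have supp: "\<exists>R. \<forall>x. norm x > R \<longrightarrow> w n x = 0" for n
    by (rule exI[of _ "real (Suc n)"]) (simp add: w_def compact_approx_def cutoff_eq_0 rho_eq_0)
  have "(LINT x|lborel. frechet_derivative g (at x) (w n x)) = 0" if "smooth g" for g :: "real^3 \<Rightarrow> real" and n
    unfolding w_def by (rule compact_approx_weakly_div_free[OF v(1) dv that]) simp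
  with l2w supp lim show ?thesis by (intro that) blast+
qed

section \<open>Continuous curves of square integrable functions\<close>

text \<open>Sequential, because the convergence results for \<open>ip\<close> and \<open>n2\<close>
  are about sequences; on a set of reals this gives continuity of the scalar functions
  \<open>ip (F t) (G t)\<close>.\<close>

definition l2_continuous_on :: "real set \<Rightarrow> (real \<Rightarrow> 'a::euclidean_space \<Rightarrow> 'b::euclidean_space) \<Rightarrow> bool" where
  "l2_continuous_on S F \<longleftrightarrow> (\<forall>t\<in>S. l2 (F t)) \<and>
     (\<forall>X t. t \<in> S \<longrightarrow> (\<forall>n. X n \<in> S) \<longrightarrow> X \<longlonglongrightarrow> t \<longrightarrow> (\<lambda>n::nat. n2 (\<lambda>x. F (X n) x - F t x)) \<longlonglongrightarrow> 0)"

lemma l2_continuous_onD: "l2_continuous_on S F \<Longrightarrow> t \<in> S \<Longrightarrow> l2 (F t)"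
  by (simp add: l2_continuous_on_def)

lemma l2_continuous_on_compare:
  assumes F: "l2_continuous_on S F" and G: "\<And>t. t \<in> S \<Longrightarrow> l2 (G t)"
    and le: "\<And>s t. s \<in> S \<Longrightarrow> t \<in> S \<Longrightarrow> n2 (\<lambda>x. G s x - G t x) \<le> C * n2 (\<lambda>x. F s x - F t x)"
  shows "l2_continuous_on S G"
  unfolding l2_continuous_on_def
proof (intro conjI ballI allI impI G)
  fix X t assume t: "t \<in> S" "\<forall>n::nat. X n \<in> S" "X \<longlonglongrightarrow> t"
  have lim: "(\<lambda>n. C * n2 (\<lambda>x. F (X n) x - F t x)) \<longlonglongrightarrow> 0"
    using F t unfolding l2_continuous_on_def by (intro tendsto_mult_right_zero) blast
  show "(\<lambda>n. n2 (\<lambda>x. G (X n) x - G t x)) \<longlonglongrightarrow> 0"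
    by (rule Lim_null_comparison[OF _ lim]) (use t le in auto)
qed

lemma l2_continuous_on_const: "l2 f \<Longrightarrow> l2_continuous_on S (\<lambda>t. f)"
  by (simp add: l2_continuous_on_def n2_def ip_def)

lemma l2_continuous_on_add:
  assumes F: "l2_continuous_on S F" and G: "l2_continuous_on S G"
  shows "l2_continuous_on S (\<lambda>t x. F t x + G t x)"
  unfolding l2_continuous_on_def
proof (intro conjI ballI allI impI)
  show "l2 (\<lambda>x. F t x + G t x)" if "t \<in> S" for t
    using F G that by (intro l2_add) (auto dest: l2_continuous_onD)
  fix X t assume t: "t \<in> S" "\<forall>n::nat. X n \<in> S" "X \<longlonglongrightarrow> t"
  have lim: "(\<lambda>n. n2 (\<lambda>x. F (X n) x - F t x) + n2 (\<lambda>x. G (X n) x - G t x)) \<longlonglongrightarrow> 0"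
    using F G t unfolding l2_continuous_on_def by (intro tendsto_add_zero) blast+
  have "n2 (\<lambda>x. F (X n) x + G (X n) x - (F t x + G t x)) \<le> n2 (\<lambda>x. F (X n) x - F t x) + n2 (\<lambda>x. G (X n) x - G t x)" for n
  proof -
    have "n2 (\<lambda>x. (F (X n) x - F t x) + (G (X n) x - G t x)) \<le> n2 (\<lambda>x. F (X n) x - F t x) + n2 (\<lambda>x. G (X n) x - G t x)"
      using F G t by (intro n2_triangle l2_diff) (auto dest: l2_continuous_onD)
    then show ?thesis by (simp add: algebra_simps)
  qed
  then show "(\<lambda>n. n2 (\<lambda>x. F (X n) x + G (X n) x - (F t x + G t x))) \<longlonglongrightarrow> 0"
    by (intro Lim_null_comparison[OF _ lim]) auto
qed

lemma l2_continuous_on_scaleR: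
  assumes F: "l2_continuous_on S F"
  shows "l2_continuous_on S (\<lambda>t x. c *\<^sub>R F t x)"
proof (rule l2_continuous_on_compare[OF F, where C = "\<bar>c\<bar>"])
  show "n2 (\<lambda>x. c *\<^sub>R F s x - c *\<^sub>R F t x) \<le> \<bar>c\<bar> * n2 (\<lambda>x. F s x - F t x)" for s t
    unfolding scaleR_diff_right[symmetric] n2_scaleR by simp
qed (use F in \<open>auto intro: l2_scaleR dest: l2_continuous_onD\<close>)

lemma l2_continuous_on_diff:
  "l2_continuous_on S F \<Longrightarrow> l2_continuous_on S G \<Longrightarrow> l2_continuous_on S (\<lambda>t x. F t x - G t x)"
  using l2_continuous_on_add[OF _ l2_continuous_on_scaleR[of S G "-1"], of F] by simp

lemma l2_continuous_on_sum:
  "(\<And>i. i \<in> I \<Longrightarrow> l2_continuous_on S (F i)) \<Longrightarrow> l2_continuous_on S (\<lambda>t x. \<Sum>i\<in>I. F i t x)"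
  by (induction I rule: infinite_finite_induct) (auto intro: l2_continuous_on_add l2_continuous_on_const l2_zero)

lemma l2_continuous_on_conv:
  assumes k: "test_function UNIV k" and F: "l2_continuous_on S F"
  shows "l2_continuous_on S (\<lambda>t. conv k (F t))"
proof (rule l2_continuous_on_compare[OF F, where C = "LINT z|lborel. \<bar>k z\<bar>"])
  show "l2 (conv k (F t))" if "t \<in> S" for t
    by (rule conv_Young(1)[OF k l2_continuous_onD[OF F that]])
  fix s t assume st: "s \<in> S" "t \<in> S"
  have "(\<lambda>x. conv k (F s) x - conv k (F t) x) = conv k (\<lambda>x. F s x - F t x)"
    using st F by (auto simp: fun_eq_iff intro!: conv_diff[OF k, symmetric] loc_int_l2 dest: l2_continuous_onD)
  then show "n2 (\<lambda>x. conv k (F s) x - conv k (F t) x) \<le> (LINT z|lborel. \<bar>k z\<bar>) * n2 (\<lambda>x. F s x - F t x)"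
    using conv_Young(2)[OF k l2_diff[OF l2_continuous_onD[OF F st(1)] l2_continuous_onD[OF F st(2)]]] by simp
qed

lemma continuous_on_ip:
  assumes F: "l2_continuous_on S F" and G: "l2_continuous_on S G"
  shows "continuous_on S (\<lambda>t. ip (F t) (G t))"
proof (rule continuous_on_sequentiallyI)
  fix X :: "nat \<Rightarrow> real" and t assume t: "\<forall>n. X n \<in> S" "t \<in> S" "X \<longlonglongrightarrow> t"
  show "(\<lambda>n. ip (F (X n)) (G (X n))) \<longlonglongrightarrow> ip (F t) (G t)"
    using F G t unfolding l2_continuous_on_def by (intro ip_tendsto) blast+
qed

lemma continuous_on_n2: "l2_continuous_on S F \<Longrightarrow> continuous_on S (\<lambda>t. n2 (F t))"
  unfolding n2_def by (intro continuous_on_real_sqrt continuous_on_ip)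

section \<open>Partial derivatives of convolutions\<close>

lemma test_function_pd: "test_function UNIV k \<Longrightarrow> test_function UNIV (pd i k)"
  unfolding pd_def[abs_def] by (rule test_function_frechet_derivative)

lemma pd_conv: "test_function UNIV k \<Longrightarrow> loc_int f \<Longrightarrow> pd i (conv k f) = conv (pd i k) f"
  unfolding pd_def[abs_def] by (intro ext frechet_derivative_conv)

lemma pd_reflect:
  assumes "smooth k"
  shows "pd i (\<lambda>y. k (x - y)) y = - pd i k (x - y)"
proof -
  have lin: "linear (frechet_derivative k (at (x - y)))" by (rule smooth_linear_frechet[OF assms])
  have "((\<lambda>y. x - y) has_derivative (\<lambda>h. - h)) (at y)" by (auto intro!: derivative_eq_intros)
  from has_derivative_compose[OF this smooth_has_derivative[OF assms]] show ?thesis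
    unfolding pd_def by (subst frechet_derivative_eq) (auto simp: linear_neg[OF lin])
qed

text \<open>The sign \<open>c\<close> treats both parities at once: first derivatives of an even
  kernel are odd and second ones even, which decides the sign when a derivative of the kernel is
  moved across \<open>ip\<close>.\<close>

lemma pd_even:
  fixes k :: "real^3 \<Rightarrow> real"
  assumes "smooth k" "\<And>z. k (- z) = c * k z"
  shows "pd i k (- z) = - c * pd i k z"
proof -
  have "pd i (\<lambda>y. k (0 - y)) z = - pd i k (0 - z)" by (rule pd_reflect[OF assms(1)])
  moreover have "pd i (\<lambda>y. k (0 - y)) z = c * pd i k z"
  proof -
    have "(\<lambda>y. k (0 - y)) = (\<lambda>y. c * k y)" using assms(2) by simp
    then show ?thesis
      unfolding pd_def using frechet_derivative_eq[OF has_derivative_mult_right[OF smooth_has_derivative[OF assms(1)], of c z]]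
      by simp
  qed
  ultimately show ?thesis by simp
qed

lemma conv_minus_kernel: "conv (\<lambda>z. - k z) f = (\<lambda>x. - conv k f x)"
  by (auto simp: fun_eq_iff conv_def)

lemma conv_adjoint_even:
  assumes "test_function UNIV k" "\<And>z. k (- z) = k z" "l2 f" "l2 g"
  shows "ip (conv k f) g = ip f (conv k g)"
  using conv_adjoint[OF assms(1,3,4)] assms(2) by simp

lemma conv_adjoint_odd:
  assumes "test_function UNIV k" "\<And>z. k (- z) = - k z" "l2 f" "l2 g"
  shows "ip (conv k f) g = - ip f (conv k g)"
  using conv_adjoint[OF assms(1,3,4)] assms(2) by (simp add: conv_minus_kernel ip_def)

text \<open>With the derivative on the kernel, the divergence becomes the pairing of
  \<open>f\<close> with the gradient of \<open>y \<mapsto> k (x - y)\<close>. That function is a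
  test function, so a weakly divergence-free \<open>f\<close> has a classically divergence-free
  convolution.\<close>

lemma divergence_conv:
  fixes f :: "real^3 \<Rightarrow> real^3"
  assumes k: "test_function UNIV k" and f: "loc_int f"
  shows "divergence (conv k f) x = - (LINT y|lborel. frechet_derivative (\<lambda>y. k (x - y)) (at y) (f y))"
proof -
  have pd: "test_function UNIV (pd i k)" for i by (rule test_function_pd[OF k])
  have "divergence (conv k f) x = (\<Sum>i\<in>UNIV. (LINT y|lborel. pd i k (x - y) *\<^sub>R f y) $ i)"
    unfolding divergence_def pd_conv[OF k f] by (simp add: conv_def)
  also have "\<dots> = (\<Sum>i\<in>UNIV. (LINT y|lborel. (pd i k (x - y) *\<^sub>R f y) $ i))"
    by (intro sum.cong refl integral_bounded_linear[OF bounded_linear_vec_nth, symmetric] conv_integrable pd f)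
  also have "\<dots> = (LINT y|lborel. (\<Sum>i\<in>UNIV. (pd i k (x - y) *\<^sub>R f y) $ i))"
    by (intro Bochner_Integration.integral_sum[symmetric] integrable_bounded_linear[OF bounded_linear_vec_nth] conv_integrable pd f)
  also have "\<dots> = (LINT y|lborel. - frechet_derivative (\<lambda>y. k (x - y)) (at y) (f y))"
  proof (rule Bochner_Integration.integral_cong[OF refl])
    fix y
    show "(\<Sum>i\<in>UNIV. (pd i k (x - y) *\<^sub>R f y) $ i) = - frechet_derivative (\<lambda>y. k (x - y)) (at y) (f y)"
      unfolding frechet_derivative_axis_sum[OF test_function_smooth[OF test_function_reflect[OF k]]]
        pd_reflect[OF test_function_smooth[OF k]]
      by (simp add: mult.commute sum_negf)
  qed
  finally show ?thesis by simp
qed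

section \<open>The mollified energy balance\<close>

text \<open>Regularity of the curve without the equation, kept apart because testing in time takes
  place on an interval larger than the one on which the integrated equation results. The bound holds
  at every point, as the representatives are truncated.\<close>

locale bounded_curve =
  fixes U :: "real \<Rightarrow> real^3 \<Rightarrow> real^3" and a b M :: real
  assumes ab: "a \<le> b"
    and U_cont: "l2_continuous_on {a..b} U"
    and U_bound: "\<And>t x. t \<in> {a..b} \<Longrightarrow> norm (U t x) \<le> M"
begin

definition UU :: "3 \<Rightarrow> real \<Rightarrow> real^3 \<Rightarrow> real^3" where
  "UU i t x = (U t x $ i) *\<^sub>R U t x"

lemma M_nonneg: "M \<ge> 0"
  using order_trans[OF norm_ge_zero U_bound[of a 0]] ab by simp

lemma U_l2: "t \<in> {a..b} \<Longrightarrow> l2 (U t)"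
  using U_cont by (rule l2_continuous_onD)

lemma U_measurable: "t \<in> {a..b} \<Longrightarrow> U t \<in> borel_measurable borel"
  using U_l2 by (simp add: l2_def)

text \<open>On bounded fields the quadratic map is Lipschitz in L2: write the difference of the
  products as \<open>(U s x $ i) *\<^sub>R (U s x - U t x)\<close> plus
  \<open>((U s x - U t x) $ i) *\<^sub>R U t x\<close> and bound the undifferenced factor by
  \<open>M\<close>.\<close>

lemma UU_cont: "l2_continuous_on {a..b} (UU i)"
proof (rule l2_continuous_on_compare[OF U_cont, where C = "2 * M"])
  have comp: "\<bar>U t x $ i\<bar> \<le> M" if "t \<in> {a..b}" for t x
    using component_le_norm_cart[of "U t x" i] U_bound[OF that, of x] by linarith
  show l: "l2 (UU i t)" if "t \<in> {a..b}" for t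
  proof -
    have "(\<lambda>x. U t x $ i) \<in> borel_measurable borel"
      by (rule measurable_compose[OF U_measurable[OF that]], intro borel_measurable_continuous_onI continuous_intros)
    then show ?thesis
      unfolding UU_def[abs_def] by (rule l2_mult_bounded(1)[OF U_l2[OF that] _ comp[OF that]])
  qed
  fix s t assume st: "s \<in> {a..b}" "t \<in> {a..b}"
  have "norm (UU i s x - UU i t x) \<le> norm ((2 * M) *\<^sub>R (U s x - U t x))" for x
  proof -
    have "UU i s x - UU i t x = (U s x $ i) *\<^sub>R (U s x - U t x) + ((U s x - U t x) $ i) *\<^sub>R U t x"
      by (simp add: UU_def algebra_simps)
    also have "norm \<dots> \<le> \<bar>U s x $ i\<bar> * norm (U s x - U t x) + \<bar>(U s x - U t x) $ i\<bar> * norm (U t x)"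
      by (rule norm_triangle_le) simp
    also have "\<dots> \<le> M * norm (U s x - U t x) + norm (U s x - U t x) * M"
      using comp[OF st(1)] U_bound[OF st(2)] component_le_norm_cart[of "U s x - U t x" i] M_nonneg
      by (intro add_mono mult_mono) auto
    finally show ?thesis using M_nonneg by (simp add: mult.commute)
  qed
  from n2_mono(2)[OF l2_scaleR[OF l2_diff[OF U_l2[OF st(1)] U_l2[OF st(2)]]] this]
  show "n2 (\<lambda>x. UU i s x - UU i t x) \<le> 2 * M * n2 (\<lambda>x. U s x - U t x)"
    using l2_diff[OF l[OF st(1)] l[OF st(2)]] M_nonneg by (simp add: n2_scaleR l2_def)
qed

lemma UU_l2: "t \<in> {a..b} \<Longrightarrow> l2 (UU i t)"
  using UU_cont by (rule l2_continuous_onD)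

end

text \<open>The equation enters as \<open>U_eq\<close>, integrated in time and tested with fields
  that do not depend on time; such fields being divergence free, the pressure has already
  disappeared.\<close>

locale ns_interval = bounded_curve +
  assumes U_div: "\<And>t (g :: real^3 \<Rightarrow> real). t \<in> {a..b} \<Longrightarrow> test_function UNIV g \<Longrightarrow> (LINT x|lborel. frechet_derivative g (at x) (U t x)) = 0"
    and U_eq: "\<And>w s t. test_function UNIV w \<Longrightarrow> (\<And>x. divergence w x = 0) \<Longrightarrow> s \<in> {a..b} \<Longrightarrow> t \<in> {a..b} \<Longrightarrow> s \<le> t \<Longrightarrow>
       ((\<lambda>r. ip (U r) (laplacian w) + ip (U r) (convect (U r) w)) has_integral (ip (U t) w - ip (U s) w)) {s..t}"
begin

text \<open>The time derivative of \<open>conv k (U t)\<close> modulo gradients: convolved Laplacian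
  minus convolved divergence of the products. All derivatives sit on \<open>k\<close>, so the flux
  is square integrable for a merely bounded L2 field.\<close>

definition flux :: "(real^3 \<Rightarrow> real) \<Rightarrow> real \<Rightarrow> real^3 \<Rightarrow> real^3" where
  "flux k t x = (\<Sum>i\<in>UNIV. conv (pd i (pd i k)) (U t) x) - (\<Sum>i\<in>UNIV. conv (pd i k) (UU i t) x)"

definition dissipation :: "(real^3 \<Rightarrow> real) \<Rightarrow> real \<Rightarrow> real" where
  "dissipation k t = (\<Sum>i\<in>UNIV. (n2 (conv (pd i k) (U t)))\<^sup>2)"

definition transport :: "(real^3 \<Rightarrow> real) \<Rightarrow> real \<Rightarrow> real" where
  "transport k t = (\<Sum>i\<in>UNIV. ip (conv k (UU i t)) (conv (pd i k) (U t)))"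

section \<open>Evolution and energy of the solution mollified by one even kernel\<close>

context
  fixes k :: "real^3 \<Rightarrow> real"
  assumes k: "test_function UNIV k" and even: "\<And>z. k (- z) = k z"
begin

lemma pdk: "test_function UNIV (pd i k)" "test_function UNIV (pd i (pd i k))"
  by (intro test_function_pd k)+

lemma pdk_odd: "pd i k (- z) = - pd i k z"
  using pd_even[OF test_function_smooth[OF k], of 1 i z] even by simp

lemma pdpdk_even: "pd i (pd i k) (- z) = pd i (pd i k) z"
  using pd_even[OF test_function_smooth[OF pdk(1)], of i "-1" i z] pdk_odd by simp

lemma flux_cont: "l2_continuous_on {a..b} (flux k)"
  unfolding flux_def[abs_def]
  by (intro l2_continuous_on_diff l2_continuous_on_sum l2_continuous_on_conv pdk U_cont UU_cont)

lemma V_cont: "l2_continuous_on {a..b} (\<lambda>t. conv k (U t))"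
  by (intro l2_continuous_on_conv k U_cont)

lemma dissipation_cont: "continuous_on {a..b} (dissipation k)"
  unfolding dissipation_def[abs_def]
  by (intro continuous_intros continuous_on_n2 l2_continuous_on_conv pdk U_cont)

lemma transport_cont: "continuous_on {a..b} (transport k)"
  unfolding transport_def[abs_def]
  by (intro continuous_intros continuous_on_ip l2_continuous_on_conv pdk k U_cont UU_cont)

lemma conv_U_div_free: "t \<in> {a..b} \<Longrightarrow> divergence (conv k (U t)) x = 0"
  using divergence_conv[OF k loc_int_l2[OF U_l2]] U_div[OF _ test_function_reflect[OF k]] by simp

text \<open>The field \<open>conv k w\<close> is an admissible test field, and its kernel is then
  moved onto the solution. Evenness makes \<open>k\<close> and its second derivatives self-adjoint
  under \<open>ip\<close>; the first derivatives are odd, which produces the minus sign of the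
  second sum in \<open>flux\<close>.\<close>

lemma evolution_compact:
  assumes w: "l2 w" "\<And>x. norm x > R \<Longrightarrow> w x = 0"
    "\<And>g :: real^3 \<Rightarrow> real. smooth g \<Longrightarrow> (LINT x|lborel. frechet_derivative g (at x) (w x)) = 0"
    and st: "s \<in> {a..b}" "t \<in> {a..b}" "s \<le> t"
  shows "((\<lambda>r. ip (flux k r) w) has_integral (ip (conv k (U t)) w - ip (conv k (U s)) w)) {s..t}"
proof -
  have wl: "loc_int w" by (rule loc_int_l2[OF w(1)])
  have W: "test_function UNIV (conv k w)" by (rule test_function_conv[OF k wl w(2)])
  have "divergence (conv k w) x = 0" for x
    unfolding divergence_conv[OF k wl] using w(3)[OF test_function_smooth[OF test_function_reflect[OF k]]] by simp
  from U_eq[OF W this st]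
  have main: "((\<lambda>r. ip (U r) (laplacian (conv k w)) + ip (U r) (convect (U r) (conv k w))) has_integral
      (ip (U t) (conv k w) - ip (U s) (conv k w))) {s..t}" .
  have eq: "ip (U r) (laplacian (conv k w)) + ip (U r) (convect (U r) (conv k w)) = ip (flux k r) w" if "r \<in> {s..t}" for r
  proof -
    have r: "r \<in> {a..b}" using that st by auto
    have cl2: "l2 (conv (pd i (pd i k)) w)" "l2 (conv (pd i k) w)" for i
      by (intro conv_Young(1) pdk w)+
    have cU: "l2 (conv (pd i (pd i k)) (U r))" "l2 (conv (pd i k) (UU i r))" for i
      by (intro conv_Young(1) pdk U_l2 UU_l2 r)+
    have lap: "laplacian (conv k w) = (\<lambda>x. \<Sum>i\<in>UNIV. conv (pd i (pd i k)) w x)"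
      unfolding laplacian_def[abs_def] pd_conv[OF k wl] pd_conv[OF pdk(1) wl] ..
    have "ip (U r) (laplacian (conv k w)) = (\<Sum>i\<in>UNIV. ip (conv (pd i (pd i k)) (U r)) w)"
      unfolding lap ip_commute[of "U r"] using cl2 U_l2[OF r]
      by (subst ip_sum_left) (auto simp: ip_commute[of _ "U r"] conv_adjoint_even[OF pdk(2) pdpdk_even U_l2[OF r] w(1)])
    moreover have "ip (U r) (convect (U r) (conv k w)) = - (\<Sum>i\<in>UNIV. ip (conv (pd i k) (UU i r)) w)"
    proof -
      have "ip (U r) (convect (U r) (conv k w)) = (LINT x|lborel. (\<Sum>i\<in>UNIV. UU i r x \<bullet> conv (pd i k) w x))"
        unfolding ip_def convect_def pd_conv[OF k wl] UU_def by (simp add: inner_sum_right)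
      also have "\<dots> = (\<Sum>i\<in>UNIV. ip (UU i r) (conv (pd i k) w))"
        unfolding ip_def using cl2 UU_l2[OF r] by (intro Bochner_Integration.integral_sum l2_inner_integrable)
      finally show ?thesis
        using conv_adjoint_odd[OF pdk(1) pdk_odd UU_l2[OF r] w(1)] by (simp add: sum_negf)
    qed
    moreover have "ip (flux k r) w = (\<Sum>i\<in>UNIV. ip (conv (pd i (pd i k)) (U r)) w) - (\<Sum>i\<in>UNIV. ip (conv (pd i k) (UU i r)) w)"
      unfolding flux_def[abs_def] using cU w(1) by (simp add: ip_diff_left ip_sum_left l2_sum)
    ultimately show ?thesis by simp
  qed
  have ends: "ip (U r) (conv k w) = ip (conv k (U r)) w" if "r \<in> {a..b}" for r
    using conv_adjoint_even[OF k even U_l2[OF that] w(1)] by simp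
  show ?thesis
    using main unfolding ends[OF st(1)] ends[OF st(2)] by (rule has_integral_eq[rotated]) (rule eq)
qed

lemma flux_bounded: obtains B where "B \<ge> 0" "\<And>r. r \<in> {a..b} \<Longrightarrow> n2 (flux k r) \<le> B"
proof -
  have "compact ((\<lambda>r. n2 (flux k r)) ` {a..b})"
    by (intro compact_continuous_image continuous_on_n2 flux_cont) auto
  then obtain B where "\<And>r. r \<in> {a..b} \<Longrightarrow> norm (n2 (flux k r)) \<le> B"
    by (metis bounded_iff compact_imp_bounded imageI)
  then show ?thesis by (intro that[of "max B 0"]) (auto simp: max_def intro: order_trans)
qed

text \<open>Both sides depend continuously on the test field in L2, uniformly in time because the
  flux is bounded on the compact interval. The identity thus passes from the compactly supported
  \<open>w n\<close> to their L2 limit \<open>v\<close>.\<close>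

lemma evolution:
  assumes v: "smooth v" "l2 v" "\<And>x. divergence v x = 0"
    and st: "s \<in> {a..b}" "t \<in> {a..b}" "s \<le> t"
  shows "((\<lambda>r. ip (flux k r) v) has_integral (ip (conv k (U t)) v - ip (conv k (U s)) v)) {s..t}"
proof -
  obtain w :: "nat \<Rightarrow> real^3 \<Rightarrow> real^3" where w: "\<And>n. l2 (w n)" "\<And>n. \<exists>R. \<forall>x. norm x > R \<longrightarrow> w n x = 0"
    "\<And>n (g :: real^3 \<Rightarrow> real). smooth g \<Longrightarrow> (LINT x|lborel. frechet_derivative g (at x) (w n x)) = 0"
    "(\<lambda>n. n2 (\<lambda>x. w n x - v x)) \<longlonglongrightarrow> 0"
    using compact_div_free_approximation[OF v] by blast
  obtain B where B: "B \<ge> 0" "\<And>r. r \<in> {a..b} \<Longrightarrow> n2 (flux k r) \<le> B"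
    using flux_bounded by blast
  have sub: "{s..t} \<subseteq> {a..b}" using st by auto
  have "(\<lambda>r. ip (flux k r) v) integrable_on {s..t}"
    by (intro integrable_continuous_real continuous_on_subset[OF _ sub] continuous_on_ip flux_cont l2_continuous_on_const v)
  then obtain I where I: "((\<lambda>r. ip (flux k r) v) has_integral I) {s..t}" by blast
  define c where "c = (\<lambda>n. ip (conv k (U t)) (w n) - ip (conv k (U s)) (w n))"
  have cn: "((\<lambda>r. ip (flux k r) (w n)) has_integral c n) {s..t}" for n
  proof -
    obtain R where R: "\<And>x. norm x > R \<Longrightarrow> w n x = 0" using w(2) by blast
    show ?thesis unfolding c_def by (rule evolution_compact[OF w(1) R w(3) st])
  qed
  have bound: "norm (c n - I) \<le> (B * n2 (\<lambda>x. w n x - v x)) * measure lborel {s..t}" for n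
  proof (rule has_integral_bound_real[where S = "{}"])
    show "((\<lambda>r. ip (flux k r) (w n) - ip (flux k r) v) has_integral c n - I) {s..t}"
      by (intro has_integral_diff cn I)
    fix r assume "r \<in> {s..t} - {}"
    then have r: "r \<in> {a..b}" using sub by auto
    have "\<bar>ip (flux k r) (\<lambda>x. w n x - v x)\<bar> \<le> n2 (flux k r) * n2 (\<lambda>x. w n x - v x)"
      by (intro ip_Cauchy_Schwarz l2_diff w v l2_continuous_onD[OF flux_cont r])
    also have "\<dots> \<le> B * n2 (\<lambda>x. w n x - v x)" using B(2)[OF r] by (intro mult_right_mono) auto
    finally show "norm (ip (flux k r) (w n) - ip (flux k r) v) \<le> B * n2 (\<lambda>x. w n x - v x)"
      using w(1) v(2) l2_continuous_onD[OF flux_cont r] by (simp add: ip_diff_right)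
  qed (use B in auto)
  have "(\<lambda>n. (B * n2 (\<lambda>x. w n x - v x)) * measure lborel {s..t}) \<longlonglongrightarrow> 0"
    using w(4) by (auto intro!: tendsto_eq_intros)
  then have "(\<lambda>n. c n - I) \<longlonglongrightarrow> 0"
    by (rule Lim_null_comparison[rotated]) (use bound in auto)
  then have 1: "c \<longlonglongrightarrow> I" by (simp add: LIM_zero_iff)
  have lim: "(\<lambda>n. ip f (w n)) \<longlonglongrightarrow> ip f v" if "l2 f" for f
    by (rule ip_tendsto) (use that w v in \<open>auto simp: n2_def ip_def\<close>)
  have "c \<longlonglongrightarrow> ip (conv k (U t)) v - ip (conv k (U s)) v"
    unfolding c_def using conv_Young(1)[OF k U_l2] st by (intro tendsto_diff lim) auto
  with 1 have "I = ip (conv k (U t)) v - ip (conv k (U s)) v" by (rule LIMSEQ_unique)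
  with I show ?thesis by simp
qed

text \<open>One integration by parts in each term: the second derivatives give minus the squared
  gradients, and the derivative on the products moves to the mollified field, its sign cancelling
  the one in \<open>flux\<close>.\<close>

lemma flux_energy:
  assumes t: "t \<in> {a..b}"
  shows "ip (flux k t) (conv k (U t)) = transport k t - dissipation k t"
proof -
  note Ul = loc_int_l2[OF U_l2[OF t]] and UUl = loc_int_l2[OF UU_l2[OF t]]
  have l: "l2 (conv k (U t))" "l2 (conv (pd i k) (U t))" "l2 (conv (pd i (pd i k)) (U t))"
     "l2 (conv k (UU i t))" "l2 (conv (pd i k) (UU i t))" for i
    by (intro conv_Young(1) k pdk U_l2 UU_l2 t)+
  have pdc: "(\<lambda>x. frechet_derivative (conv q f) (at x) (axis i 1)) = conv (pd i q) f" if "test_function UNIV q" "loc_int f"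
    for q and f :: "real^3 \<Rightarrow> real^3" and i
    using pd_conv[OF that, of i] by (simp add: pd_def[abs_def])
  have 1: "ip (conv (pd i (pd i k)) (U t)) (conv k (U t)) = - (n2 (conv (pd i k) (U t)))\<^sup>2" for i
    using l2_integration_by_parts[of "conv (pd i k) (U t)" "axis i 1" "conv k (U t)"] l
    by (simp add: pdc pdk k Ul smooth_conv n2_power2)
  have 2: "ip (conv (pd i k) (UU i t)) (conv k (U t)) = - ip (conv k (UU i t)) (conv (pd i k) (U t))" for i
    using l2_integration_by_parts[of "conv k (UU i t)" "axis i 1" "conv k (U t)"] l
    by (simp add: pdc pdk k Ul UUl smooth_conv)
  show ?thesis
    unfolding flux_def[abs_def] using l
    by (simp add: ip_diff_left ip_sum_left l2_sum 1 2 sum_negf dissipation_def transport_def)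
qed

text \<open>Test fields in \<open>evolution\<close> are constant in time, so \<open>V r\<close> at
  the running time cannot be inserted. Instead the difference of squares is factored as the pairing
  of \<open>V y - V z\<close> with the fixed field \<open>V y + V z\<close>, which is divergence
  free and admissible. As both times tend to \<open>t\<close>, the integrand tends to
  \<open>2 * ip (flux k t) (V t)\<close>.\<close>

lemma energy_has_derivative:
  assumes t: "t \<in> {a..b}"
  shows "((\<lambda>t. ip (conv k (U t)) (conv k (U t))) has_real_derivative 2 * ip (flux k t) (conv k (U t))) (at t within {a..b})"
proof -
  define V where "V = (\<lambda>t. conv k (U t))"
  define D where "D = 2 * ip (flux k t) (V t)"
  have Vl: "l2 (V s)" if "s \<in> {a..b}" for s
    using V_cont that unfolding V_def by (rule l2_continuous_onD)
  have Fl: "l2 (flux k s)" if "s \<in> {a..b}" for s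
    using flux_cont that by (rule l2_continuous_onD)
  have evol: "((\<lambda>r. ip (flux k r) (\<lambda>x. V y x + V z x)) has_integral ip (V y) (V y) - ip (V z) (V z)) {z..y}"
    if yz: "y \<in> {a..b}" "z \<in> {a..b}" "z \<le> y" for y z
  proof -
    have eq: "conv k (\<lambda>x. U y x + U z x) = (\<lambda>x. V y x + V z x)"
      unfolding V_def using conv_add[OF k loc_int_l2[OF U_l2[OF yz(1)]] loc_int_l2[OF U_l2[OF yz(2)]]] by blast
    have l: "l2 (\<lambda>x. U y x + U z x)" by (intro l2_add U_l2 yz)
    have sV: "smooth (V s)" if "s \<in> {a..b}" for s unfolding V_def by (intro smooth_conv k loc_int_l2 U_l2 that)
    have dv: "divergence (\<lambda>x. V y x + V z x) x = 0" for x
    proof -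
      have "divergence (\<lambda>x. V y x + V z x) x = divergence (V y) x + divergence (V z) x"
        unfolding divergence_def pd_def
        using frechet_derivative_eq[OF has_derivative_add[OF smooth_has_derivative[OF sV[OF yz(1)]] smooth_has_derivative[OF sV[OF yz(2)]]]]
        by (simp add: sum.distrib)
      then show ?thesis using conv_U_div_free yz by (simp add: V_def)
    qed
    have "((\<lambda>r. ip (flux k r) (\<lambda>x. V y x + V z x)) has_integral ip (conv k (U y)) (\<lambda>x. V y x + V z x) - ip (conv k (U z)) (\<lambda>x. V y x + V z x)) {z..y}"
      by (rule evolution) (use sV Vl yz dv in \<open>auto intro: smooth_add l2_add\<close>)
    then have "((\<lambda>r. ip (flux k r) (\<lambda>x. V y x + V z x)) has_integral ip (V y) (\<lambda>x. V y x + V z x) - ip (V z) (\<lambda>x. V y x + V z x)) {z..y}"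
      by (simp only: V_def)
    moreover have "ip (V y) (\<lambda>x. V y x + V z x) - ip (V z) (\<lambda>x. V y x + V z x) = ip (V y) (V y) - ip (V z) (V z)"
      using Vl yz by (simp add: ip_add_right ip_commute[of "V z" "V y"])
    ultimately show ?thesis by simp
  qed
  obtain K where K: "K > 0" "\<And>s. s \<in> {a..b} \<Longrightarrow> n2 (V s) \<le> K"
  proof -
    have "compact ((\<lambda>r. n2 (V r)) ` {a..b})"
      unfolding V_def by (intro compact_continuous_image continuous_on_n2 V_cont) auto
    then obtain B where "\<And>r. r \<in> {a..b} \<Longrightarrow> norm (n2 (V r)) \<le> B"
      by (metis bounded_iff compact_imp_bounded imageI)
    then show ?thesis by (intro that[of "max B 1"]) (auto simp: max_def intro: order_trans)
  qed
  have diffs: "continuous_on {a..b} (\<lambda>r. n2 (\<lambda>x. flux k r x - flux k t x))" "continuous_on {a..b} (\<lambda>r. n2 (\<lambda>x. V r x - V t x))"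
    unfolding V_def
    by (intro continuous_on_n2 l2_continuous_on_diff flux_cont V_cont l2_continuous_on_const conv_Young(1)[OF k U_l2] t
       l2_continuous_onD[OF flux_cont])+
  have "\<exists>d>0. \<forall>y\<in>{a..b}. norm (y - t) < d \<longrightarrow>
     norm (ip (V y) (V y) - ip (V t) (V t) - D * (y - t)) \<le> e * norm (y - t)" if e: "e > 0" for e
  proof -
    \<comment> \<open>Half of \<open>e\<close> is allotted to each error: the first is at most
      \<open>e1 * (2 * K)\<close>, since the sum of two fields has norm at most
      \<open>2 * K\<close>, the second at most \<open>L * e2\<close>. The summand 1 in
      \<open>L\<close> keeps it positive.\<close>
    define e1 where "e1 = e / (4 * K)"
    define L where "L = n2 (flux k t) + 1"
    have L: "L > 0" "n2 (flux k t) \<le> L" using n2_nonneg[of "flux k t"] unfolding L_def by linarith+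
    define e2 where "e2 = e / (2 * L)"
    have e12: "e1 > 0" "e2 > 0" unfolding e1_def e2_def using e K(1) L by auto
    obtain d1 where d1: "d1 > 0" "\<And>r. r \<in> {a..b} \<Longrightarrow> dist r t < d1 \<Longrightarrow> n2 (\<lambda>x. flux k r x - flux k t x) < e1"
      using diffs(1) t e12(1) unfolding continuous_on_iff by (fastforce simp: n2_def ip_def dist_real_def)
    obtain d2 where d2: "d2 > 0" "\<And>r. r \<in> {a..b} \<Longrightarrow> dist r t < d2 \<Longrightarrow> n2 (\<lambda>x. V r x - V t x) < e2"
      using diffs(2) t e12(2) unfolding continuous_on_iff by (fastforce simp: n2_def ip_def dist_real_def)
    have est: "norm (ip (flux k r) (\<lambda>x. V y x + V z x) - D) \<le> e"
      if r: "r \<in> {a..b}" "dist r t < d1" and yz: "y = t \<and> z \<in> {a..b} \<and> dist z t < d2 \<or> z = t \<and> y \<in> {a..b} \<and> dist y t < d2" for r y z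
    proof -
      \<comment> \<open>One of \<open>y\<close> and \<open>z\<close> is \<open>t\<close>;
        \<open>q\<close> is the other, which serves the left and the right difference quotient
        simultaneously.\<close>
      define q where "q = (if y = t then z else y)"
      have q: "q \<in> {a..b}" "dist q t < d2" and sum: "(\<lambda>x. V y x + V z x) = (\<lambda>x. V q x + V t x)"
        using yz d2(1) t by (auto simp: q_def fun_eq_iff)
      have l: "l2 (V q)" "l2 (V t)" "l2 (flux k r)" "l2 (flux k t)" by (intro Vl Fl q t r)+
      have "ip (flux k r) (\<lambda>x. V q x + V t x) - D
          = ip (\<lambda>x. flux k r x - flux k t x) (\<lambda>x. V q x + V t x) + ip (flux k t) (\<lambda>x. V q x - V t x)"
        using l by (simp add: D_def ip_diff_left ip_add_right ip_diff_right l2_add l2_diff)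
      moreover have "\<bar>ip (\<lambda>x. flux k r x - flux k t x) (\<lambda>x. V q x + V t x)\<bar> \<le> e / 2"
      proof -
        have "\<bar>ip (\<lambda>x. flux k r x - flux k t x) (\<lambda>x. V q x + V t x)\<bar> \<le> n2 (\<lambda>x. flux k r x - flux k t x) * n2 (\<lambda>x. V q x + V t x)"
          by (intro ip_Cauchy_Schwarz l2_add l2_diff l)
        also have "\<dots> \<le> e1 * (2 * K)"
        proof (intro mult_mono)
          show "n2 (\<lambda>x. flux k r x - flux k t x) \<le> e1" using d1(2)[OF r] by simp
          show "n2 (\<lambda>x. V q x + V t x) \<le> 2 * K"
            using n2_triangle[OF l(1,2)] K(2)[OF q(1)] K(2)[OF t] by linarith
        qed (use e12 in auto)
        also have "\<dots> = e / 2" using K(1) by (simp add: e1_def)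
        finally show ?thesis .
      qed
      moreover have "\<bar>ip (flux k t) (\<lambda>x. V q x - V t x)\<bar> \<le> e / 2"
      proof -
        have "\<bar>ip (flux k t) (\<lambda>x. V q x - V t x)\<bar> \<le> n2 (flux k t) * n2 (\<lambda>x. V q x - V t x)"
          by (intro ip_Cauchy_Schwarz l2_diff l)
        also have "\<dots> \<le> L * e2"
          using d2(2)[OF q] L by (intro mult_mono) auto
        also have "\<dots> = e / 2" using L by (simp add: e2_def)
        finally show ?thesis .
      qed
      ultimately show ?thesis unfolding sum real_norm_def by linarith
    qed
    have "norm (ip (V y) (V y) - ip (V t) (V t) - D * (y - t)) \<le> e * norm (y - t)"
      if y: "y \<in> {a..b}" "norm (y - t) < min d1 d2" for y
    proof (cases "t \<le> y")
      case True
      have "norm (ip (V y) (V y) - ip (V t) (V t) - D * (y - t)) \<le> e * measure lborel {t..y}"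
      proof (rule has_integral_bound_real[where S = "{}"])
        show "((\<lambda>r. ip (flux k r) (\<lambda>x. V y x + V t x) - D) has_integral ip (V y) (V y) - ip (V t) (V t) - D * (y - t)) {t..y}"
          using has_integral_diff[OF evol[OF y(1) t True] has_integral_const_real[of D t y]] True by (simp add: mult.commute)
        show "norm (ip (flux k r) (\<lambda>x. V y x + V t x) - D) \<le> e" if "r \<in> {t..y} - {}" for r
          by (rule est) (use that y t True in \<open>auto simp: dist_real_def\<close>)
      qed (use e in auto)
      then show ?thesis using True by simp
    next
      case False
      then have le: "y \<le> t" by simp
      have "norm (ip (V t) (V t) - ip (V y) (V y) - D * (t - y)) \<le> e * measure lborel {y..t}"
      proof (rule has_integral_bound_real[where S = "{}"])
        show "((\<lambda>r. ip (flux k r) (\<lambda>x. V t x + V y x) - D) has_integral ip (V t) (V t) - ip (V y) (V y) - D * (t - y)) {y..t}"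
          using has_integral_diff[OF evol[OF t y(1) le] has_integral_const_real[of D y t]] le by (simp add: mult.commute)
        show "norm (ip (flux k r) (\<lambda>x. V t x + V y x) - D) \<le> e" if "r \<in> {y..t} - {}" for r
          by (rule est) (use that y t le in \<open>auto simp: dist_real_def\<close>)
      qed (use e in auto)
      moreover have "ip (V y) (V y) - ip (V t) (V t) - D * (y - t) = - (ip (V t) (V t) - ip (V y) (V y) - D * (t - y))"
        by (simp add: algebra_simps)
      ultimately show ?thesis using le by (simp only: norm_minus_cancel) simp
    qed
    then show ?thesis using d1(1) d2(1) by (intro exI[of _ "min d1 d2"]) auto
  qed
  then have "((\<lambda>t. ip (V t) (V t)) has_derivative (\<lambda>h. D * h)) (at t within {a..b})"
    unfolding has_derivative_within_alt by (auto intro: bounded_linear_mult_right)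
  then show ?thesis unfolding has_field_derivative_def D_def V_def .
qed

lemma energy_balance:
  "((\<lambda>t. 2 * (transport k t - dissipation k t)) has_integral (n2 (conv k (U b)))\<^sup>2 - (n2 (conv k (U a)))\<^sup>2) {a..b}"
proof -
  have "((\<lambda>t. 2 * ip (flux k t) (conv k (U t))) has_integral
      ip (conv k (U b)) (conv k (U b)) - ip (conv k (U a)) (conv k (U a))) {a..b}"
    by (rule fundamental_theorem_of_calculus[OF ab])
      (use energy_has_derivative in \<open>auto simp: has_real_derivative_iff_has_vector_derivative\<close>)
  then show ?thesis
    unfolding n2_power2 by (rule has_integral_eq[rotated]) (simp add: flux_energy)
qed

end

end

section \<open>Completeness of the square integrable functions\<close>

text \<open>Monotone convergence for the nonnegative series: its integral is at most a geometric
  sum, hence the series is finite almost everywhere and its sum integrable. Used in space for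
  completeness and in time for the choice of a subsequence.\<close>

lemma AE_summable_of_integrals:
  fixes f :: "nat \<Rightarrow> 'a \<Rightarrow> real"
  assumes int: "\<And>k. integrable M (f k)" and nonneg: "\<And>k x. f k x \<ge> 0"
    and bound: "\<And>k. (LINT x|M. f k x) \<le> C * (1/2) ^ k"
  shows "AE x in M. summable (\<lambda>k. f k x)" and "integrable M (\<lambda>x. \<Sum>k. f k x)"
proof -
  have [measurable]: "f k \<in> borel_measurable M" for k using int by (rule borel_measurable_integrable)
  have sm: "summable (\<lambda>k. C * (1/2::real) ^ k)" by (intro summable_mult summable_geometric) simp
  have i0: "(LINT x|M. f k x) \<ge> 0" for k using nonneg by (intro integral_nonneg_AE) auto
  have sint: "summable (\<lambda>k. LINT x|M. f k x)"
    by (rule summable_comparison_test'[OF sm, of 0]) (use bound i0 in auto)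
  have "(\<integral>\<^sup>+x. (\<Sum>k. ennreal (f k x)) \<partial>M) = (\<Sum>k. \<integral>\<^sup>+x. ennreal (f k x) \<partial>M)"
    by (rule nn_integral_suminf) measurable
  also have "\<dots> = (\<Sum>k. ennreal (LINT x|M. f k x))"
    using int nonneg by (simp add: nn_integral_eq_integral)
  also have "\<dots> = ennreal (\<Sum>k. LINT x|M. f k x)"
    by (rule suminf_ennreal2[OF i0 sint])
  finally have "(\<integral>\<^sup>+x. (\<Sum>k. ennreal (f k x)) \<partial>M) \<noteq> \<infinity>" by simp
  then have "AE x in M. (\<Sum>k. ennreal (f k x)) \<noteq> \<infinity>"
    by (rule nn_integral_PInf_AE[rotated]) measurable
  then show ae: "AE x in M. summable (\<lambda>k. f k x)"
  proof eventually_elim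
    case (elim x)
    then show ?case using nonneg by (intro summable_suminf_not_top) auto
  qed
  show "integrable M (\<lambda>x. \<Sum>k. f k x)"
    by (rule integrable_suminf) (use int ae nonneg sint in auto)
qed

text \<open>Each weighted square is bounded by the whole sum; taking roots converts the weight
  \<open>c ^ k\<close> into geometric decay of ratio \<open>1 / sqrt c\<close>.\<close>

lemma geometric_weight_bound:
  fixes d :: "nat \<Rightarrow> real"
  assumes s: "summable (\<lambda>k. c ^ k * (d k)\<^sup>2)" and c: "c > 0"
  shows "d k \<le> sqrt (\<Sum>k. c ^ k * (d k)\<^sup>2) * (1 / sqrt c) ^ k"
proof -
  have "c ^ k * (d k)\<^sup>2 \<le> (\<Sum>k. c ^ k * (d k)\<^sup>2)"
    using sum_le_suminf[OF s, of "{k}"] c by simp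
  then have "sqrt (c ^ k * (d k)\<^sup>2) \<le> sqrt (\<Sum>k. c ^ k * (d k)\<^sup>2)" by (rule real_sqrt_le_mono)
  moreover have "sqrt (c ^ k * (d k)\<^sup>2) = sqrt c ^ k * \<bar>d k\<bar>"
    by (subst real_sqrt_mult, subst real_sqrt_abs, subst real_sqrt_power) (rule refl)
  moreover have "sqrt c ^ k * d k \<le> sqrt c ^ k * \<bar>d k\<bar>" using c by (intro mult_left_mono) auto
  ultimately have "sqrt c ^ k * d k \<le> sqrt (\<Sum>k. c ^ k * (d k)\<^sup>2)" by linarith
  then show ?thesis using c by (simp add: power_divide field_simps)
qed

text \<open>Riesz-Fischer for a sequence with geometrically small increments. The sum
  \<open>r\<close> of the weighted squared increments bounds every increment pointwise, so the
  sequence converges wherever \<open>r\<close> is finite, and \<open>4 * r\<close> dominates all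
  squared distances to the limit.\<close>

theorem l2_complete:
  fixes f :: "nat \<Rightarrow> 'a::euclidean_space \<Rightarrow> 'b::euclidean_space"
  assumes f: "\<And>k. l2 (f k)" and d: "\<And>k. n2 (\<lambda>x. f (Suc k) x - f k x) \<le> C * (1/4) ^ k"
  obtains h where "l2 h" "(\<lambda>k. n2 (\<lambda>x. f k x - h x)) \<longlonglongrightarrow> 0"
proof -
  have [measurable]: "f k \<in> borel_measurable borel" for k using f by (simp add: l2_def)
  \<comment> \<open>The squared increments decay like \<open>(1/16) ^ k\<close>. The weight
    \<open>4 ^ k\<close> leaves enough of this for the integrals to be summable and turns the rest
    into the pointwise ratio \<open>1/2\<close>.\<close>
  define q where "q = (\<lambda>k x. 4 ^ k * (norm (f (Suc k) x - f k x))\<^sup>2)"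
  have qi: "integrable lborel (q k)" for k
    unfolding q_def using l2_integrable[OF l2_diff[OF f f]] by simp
  have "(LINT x|lborel. q k x) \<le> C\<^sup>2 * (1/2) ^ k" for k
  proof -
    have "(LINT x|lborel. q k x) = 4 ^ k * (n2 (\<lambda>x. f (Suc k) x - f k x))\<^sup>2"
      by (simp add: q_def n2_power2_int)
    also have "\<dots> \<le> 4 ^ k * (C * (1/4) ^ k)\<^sup>2"
      using d[of k] by (intro mult_left_mono power_mono) auto
    also have "\<dots> = C\<^sup>2 * (1/4) ^ k"
      by (simp add: power_mult_distrib power_divide power2_eq_square)
    also have "\<dots> \<le> C\<^sup>2 * (1/2) ^ k" by (intro mult_left_mono power_mono) auto
    finally show ?thesis .
  qed
  from AE_summable_of_integrals[OF qi _ this]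
  have ae: "AE x in lborel. summable (\<lambda>k. q k x)" and ri: "integrable lborel (\<lambda>x. \<Sum>k. q k x)"
    by (auto simp: q_def)
  define r where "r = (\<lambda>x. \<Sum>k. q k x)"
  define h where "h = (\<lambda>x. lim (\<lambda>k. f k x))"
  have hm [measurable]: "h \<in> borel_measurable borel" unfolding h_def by measurable
  have conv: "(\<lambda>k. f k x) \<longlonglongrightarrow> h x \<and> (\<forall>n. (norm (f n x - h x))\<^sup>2 \<le> 4 * r x)" if s: "summable (\<lambda>k. q k x)" for x
  proof -
    define a where "a = (\<lambda>k. f (Suc k) x - f k x)"
    have r0: "r x \<ge> 0" unfolding r_def by (rule suminf_nonneg[OF s]) (simp add: q_def)
    have ak: "norm (a k) \<le> sqrt (r x) * (1/2) ^ k" for k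
      using geometric_weight_bound[of 4 "\<lambda>k. norm (a k)" k] s by (simp add: q_def r_def a_def)
    have geo: "(\<lambda>k. sqrt (r x) * (1/2::real) ^ k) sums (2 * sqrt (r x))"
      using sums_mult[OF geometric_sums[of "1/2::real"], of "sqrt (r x)"] by (simp add: mult.commute)
    have sa: "summable a" by (rule summable_comparison_test'[OF sums_summable[OF geo], of 0]) (rule ak)
    have part: "f 0 x + (\<Sum>k<n. a k) = f n x" for n
      unfolding a_def using sum_lessThan_telescope[of "\<lambda>k. f k x" n] by simp
    have "(\<lambda>n. f 0 x + (\<Sum>k<n. a k)) \<longlonglongrightarrow> f 0 x + suminf a"
      by (intro tendsto_add tendsto_const summable_LIMSEQ sa)
    then have lim: "(\<lambda>n. f n x) \<longlonglongrightarrow> f 0 x + suminf a" unfolding part .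
    then have hx: "h x = f 0 x + suminf a" unfolding h_def by (rule limI)
    have "(norm (f n x - h x))\<^sup>2 \<le> 4 * r x" for n
    proof -
      have "h x - f n x = (\<Sum>k. a (k + n))"
        using suminf_split_initial_segment[OF sa, of n] unfolding hx part[of n, symmetric] by simp
      also have "norm \<dots> \<le> (\<Sum>k. sqrt (r x) * (1/2) ^ k)"
      proof (rule norm_suminf_le[OF _ sums_summable[OF geo]])
        fix k
        have "norm (a (k + n)) \<le> sqrt (r x) * (1/2) ^ (k + n)" by (rule ak)
        also have "\<dots> \<le> sqrt (r x) * (1/2) ^ k"
          using r0 by (intro mult_left_mono power_decreasing) auto
        finally show "norm (a (k + n)) \<le> sqrt (r x) * (1/2) ^ k" .
      qed
      also have "\<dots> = 2 * sqrt (r x)" using geo by (rule sums_unique[symmetric])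
      finally have "(norm (f n x - h x))\<^sup>2 \<le> (2 * sqrt (r x))\<^sup>2"
        by (intro power_mono) (simp_all add: norm_minus_commute)
      then show ?thesis using r0 by (simp add: power_mult_distrib)
    qed
    then show ?thesis using lim hx by simp
  qed
  have ri': "integrable lborel (\<lambda>x. 4 * r x)" using ri unfolding r_def by simp
  have l2d: "l2 (\<lambda>x. f n x - h x)" for n
    unfolding l2_def
  proof
    show "integrable lborel (\<lambda>x. (norm (f n x - h x))\<^sup>2)"
      by (rule Bochner_Integration.integrable_bound[OF ri'])
        (measurable, use ae in eventually_elim, use conv in \<open>auto intro: order_trans[OF _ abs_ge_self]\<close>)
  qed measurable
  have "l2 h" using l2_diff[OF f l2d, of 0 0] by simp
  moreover have "(\<lambda>k. n2 (\<lambda>x. f k x - h x)) \<longlonglongrightarrow> 0"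
  proof (rule n2_tendsto_0I_AE[OF l2d ri'])
    show "AE x in lborel. (norm (f n x - h x))\<^sup>2 \<le> 4 * r x" for n
      using ae by eventually_elim (use conv in blast)
    show "AE x in lborel. (\<lambda>n. f n x - h x) \<longlonglongrightarrow> 0"
      using ae by eventually_elim (use conv LIM_zero in blast)
  qed
  ultimately show ?thesis by (rule that)
qed

lemma n2_telescope_bound:
  assumes f: "\<And>k. l2 (f k)" and d: "\<And>k. n2 (\<lambda>x. f (Suc k) x - f k x) \<le> C * (1/4) ^ k" and C: "C \<ge> 0"
  shows "n2 (f n) \<le> n2 (f 0) + 2 * C"
proof -
  \<comment> \<open>The exact partial sum of the geometric series of ratio \<open>1/4\<close>, which
    makes the induction go through; it is rounded up to \<open>2 * C\<close> afterwards.\<close>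
  have "n2 (f n) \<le> n2 (f 0) + 4/3 * C * (1 - (1/4) ^ n)"
  proof (induction n)
    case (Suc n)
    have "n2 (f (Suc n)) \<le> n2 (\<lambda>x. f (Suc n) x - f n x) + n2 (f n)"
      using n2_triangle[OF l2_diff[OF f f] f, of "Suc n" n n] by simp
    also have "\<dots> \<le> C * (1/4) ^ n + (n2 (f 0) + 4/3 * C * (1 - (1/4) ^ n))"
      by (intro add_mono d Suc.IH)
    also have "\<dots> = n2 (f 0) + 4/3 * C * (1 - (1/4) ^ Suc n)" by (simp add: field_simps)
    finally show ?case .
  qed simp
  also have "4/3 * C * (1 - (1/4) ^ n) \<le> 4/3 * C * 1" using C by (intro mult_left_mono) auto
  also have "\<dots> \<le> 2 * C" using C by simp
  finally show ?thesis by simp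
qed

lemma n2_tendsto:
  assumes "\<And>k. l2 (f k)" "l2 h" "(\<lambda>k. n2 (\<lambda>x. f k x - h x)) \<longlonglongrightarrow> 0"
  shows "(\<lambda>k. n2 (f k)) \<longlonglongrightarrow> n2 h"
  unfolding n2_def by (intro tendsto_real_sqrt ip_tendsto assms)

section \<open>Weak gradients\<close>

definition wgrad :: "(real^3 \<Rightarrow> real^3) \<Rightarrow> (real^3 \<Rightarrow> real^3^3) \<Rightarrow> bool" where
  "wgrad u G \<longleftrightarrow> l2 G \<and> (\<forall>g i j. test_function UNIV g \<longrightarrow>
     ip (\<lambda>x. u x $ i) (pd j g) = - ip (\<lambda>x. G x $ i $ j) g)"

lemma l2_linear_image:
  assumes f: "l2 f" and L: "bounded_linear L"
  shows "l2 (\<lambda>x. L (f x))"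
proof (rule l2I_bound)
  have [measurable]: "f \<in> borel_measurable borel" using f by (simp add: l2_def)
  have "L \<in> borel_measurable borel" by (intro borel_measurable_continuous_onI linear_continuous_on L)
  then show "(\<lambda>x. L (f x)) \<in> borel_measurable borel" by measurable
  show "integrable lborel (\<lambda>x. (onorm L)\<^sup>2 * (norm (f x))\<^sup>2)" using l2_integrable[OF f] by simp
  show "(norm (L (f x)))\<^sup>2 \<le> (onorm L)\<^sup>2 * (norm (f x))\<^sup>2" for x
    using power_mono[OF onorm[OF L], of "f x" 2] by (simp add: power_mult_distrib)
qed

lemmas l2_nth = l2_linear_image[OF _ bounded_linear_vec_nth]

lemma n2_vec_power2:
  fixes f :: "'a::euclidean_space \<Rightarrow> ('b::euclidean_space)^'n"
  assumes "l2 f"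
  shows "(n2 f)\<^sup>2 = (\<Sum>i\<in>UNIV. (n2 (\<lambda>x. f x $ i))\<^sup>2)"
proof -
  have "(n2 f)\<^sup>2 = (LINT x|lborel. (\<Sum>i\<in>UNIV. (norm (f x $ i))\<^sup>2))"
    unfolding n2_power2_int by (simp add: norm_vec_def L2_set_def sum_nonneg)
  also have "\<dots> = (\<Sum>i\<in>UNIV. LINT x|lborel. (norm (f x $ i))\<^sup>2)"
    by (intro Bochner_Integration.integral_sum l2_integrable l2_nth assms)
  finally show ?thesis unfolding n2_power2_int .
qed

lemma conv_nth:
  fixes f :: "'a::euclidean_space \<Rightarrow> ('b::euclidean_space)^'n"
  assumes "test_function UNIV k" "loc_int f"
  shows "conv k f x $ i = conv k (\<lambda>y. f y $ i) x"
  unfolding conv_def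
  using integral_bounded_linear[OF bounded_linear_vec_nth conv_integrable[OF assms], of x i]
  by simp

text \<open>The definition of the weak gradient, tested with \<open>y \<mapsto> k (x - y)\<close>;
  the sign from reflecting the kernel cancels the one from the weak derivative.\<close>

lemma conv_pd_wgrad:
  assumes G: "wgrad u G" and u: "l2 u" and k: "test_function UNIV k"
  shows "conv (pd j k) u x $ i = conv k (\<lambda>y. G y $ i $ j) x"
proof -
  have t: "test_function UNIV (\<lambda>y. k (x - y))" by (rule test_function_reflect[OF k])
  have "conv (pd j k) u x $ i = (LINT y|lborel. pd j k (x - y) * u y $ i)"
    unfolding conv_nth[OF test_function_pd[OF k] loc_int_l2[OF u]] by (simp add: conv_def)
  also have "\<dots> = - ip (\<lambda>x. u x $ i) (pd j (\<lambda>y. k (x - y)))"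
    unfolding ip_def pd_reflect[OF test_function_smooth[OF k]] by (simp add: mult.commute)
  also have "\<dots> = ip (\<lambda>x. G x $ i $ j) (\<lambda>y. k (x - y))"
    using G t by (simp add: wgrad_def)
  also have "\<dots> = conv k (\<lambda>y. G y $ i $ j) x"
    by (simp add: ip_def conv_def mult.commute)
  finally show ?thesis .
qed

text \<open>The mollified gradients are the mollifications of any given weak gradient, so mollifier
  convergence applies entrywise. The left side does not mention \<open>G\<close>: all weak gradients
  of \<open>u\<close> have the same norm, and any selection of them may be used later.\<close>

lemma dissipation_tendsto_wgrad:
  assumes G: "wgrad u G" and u: "l2 u"
  shows "(\<lambda>n. \<Sum>j\<in>UNIV. (n2 (conv (pd j (moll n)) u))\<^sup>2) \<longlonglongrightarrow> (n2 G)\<^sup>2"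
proof -
  have Gl: "l2 G" using G by (simp add: wgrad_def)
  have Gij: "l2 (\<lambda>y. G y $ i $ j)" for i j by (intro l2_nth Gl)
  have "(n2 (conv (pd j (moll n)) u))\<^sup>2 = (\<Sum>i\<in>UNIV. (n2 (conv (moll n) (\<lambda>y. G y $ i $ j)))\<^sup>2)" for n j
    using n2_vec_power2[OF conv_Young(1)[OF test_function_pd[OF test_function_moll] u], of j n]
    unfolding conv_pd_wgrad[OF G u test_function_moll] by simp
  then have eq: "(\<Sum>j\<in>UNIV. (n2 (conv (pd j (moll n)) u))\<^sup>2)
      = (\<Sum>i\<in>UNIV. \<Sum>j\<in>UNIV. (n2 (conv (moll n) (\<lambda>y. G y $ i $ j)))\<^sup>2)" for n
    by (subst sum.swap) simp
  have "(\<lambda>n. n2 (conv (moll n) (\<lambda>y. G y $ i $ j))) \<longlonglongrightarrow> n2 (\<lambda>y. G y $ i $ j)" for i j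
    by (intro n2_tendsto conv_moll_l2_tendsto conv_Young(1) test_function_moll Gij)
  then have "(\<lambda>n. \<Sum>i\<in>UNIV. \<Sum>j\<in>UNIV. (n2 (conv (moll n) (\<lambda>y. G y $ i $ j)))\<^sup>2)
      \<longlonglongrightarrow> (\<Sum>i\<in>UNIV. \<Sum>j\<in>UNIV. (n2 (\<lambda>y. G y $ i $ j))\<^sup>2)"
    by (intro tendsto_intros)
  also have "(\<Sum>i\<in>UNIV. \<Sum>j\<in>UNIV. (n2 (\<lambda>y. G y $ i $ j))\<^sup>2) = (n2 G)\<^sup>2"
    unfolding n2_vec_power2[OF Gl] n2_vec_power2[OF l2_nth[OF Gl]] ..
  finally show ?thesis unfolding eq .
qed

text \<open>Closedness of the weak gradient: integrate by parts against a test function for each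
  mollified field and pass to the limit on both sides. Convergence along the subsequence
  \<open>\<phi>\<close> is all that is available.\<close>

lemma wgrad_of_limit:
  assumes u: "l2 u" and h: "\<And>j. l2 (h j)"
    and lim: "\<And>j. (\<lambda>n. n2 (\<lambda>x. conv (pd j (moll (\<phi> n))) u x - h j x)) \<longlonglongrightarrow> 0"
    and \<phi>: "filterlim \<phi> at_top sequentially"
  shows "wgrad u (\<lambda>x. \<chi> i j. h j x $ i)"
  unfolding wgrad_def
proof (intro conjI allI impI)
  let ?G = "\<lambda>x. \<chi> i j. h j x $ i"
  have [measurable]: "h j \<in> borel_measurable borel" for j using h by (simp add: l2_def)
  have G_eq: "?G x = (\<Sum>j\<in>UNIV. (\<lambda>v::real^3. (\<chi> i k. if k = j then v $ i else 0) :: real^3^3) (h j x))" for x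
    by (simp add: vec_eq_iff)
  have bl: "bounded_linear (\<lambda>v::real^3. (\<chi> i k. if k = j then v $ i else 0) :: real^3^3)" for j :: 3
    by (rule linear_conv_bounded_linear[THEN iffD1], rule linearI) (auto simp: vec_eq_iff)
  show "l2 ?G"
    unfolding G_eq by (rule l2_sum) (rule l2_linear_image[OF h bl])
  fix g :: "real^3 \<Rightarrow> real" and i j assume g: "test_function UNIV g"
  \<comment> \<open>Multiplying \<open>g\<close> by the \<open>i\<close>-th unit vector lets the
    vector-valued integration by parts read off the \<open>i\<close>-th component.\<close>
  define b where "b = (\<lambda>x. g x *\<^sub>R (axis i 1 :: real^3))"
  have sb: "smooth b" unfolding b_def by (intro smooth_scaleR test_function_smooth[OF g] smooth_const)
  have b': "(\<lambda>x. frechet_derivative b (at x) (axis j 1)) = (\<lambda>x. pd j g x *\<^sub>R axis i 1)"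
    unfolding b_def pd_def
    by (intro ext, subst frechet_derivative_eq[OF has_derivative_scaleR_left[OF smooth_has_derivative[OF test_function_smooth[OF g]]]]) simp
  have lb: "l2 b" "l2 (\<lambda>x. pd j g x *\<^sub>R (axis i 1 :: real^3))"
    unfolding b_def using l2_linear_image[OF test_function_l2[OF g] bounded_linear_scaleR_left]
      l2_linear_image[OF test_function_l2[OF test_function_pd[OF g]] bounded_linear_scaleR_left] by auto
  have ipb: "ip f b = ip (\<lambda>x. f x $ i) g" "ip f (\<lambda>x. pd j g x *\<^sub>R axis i 1) = ip (\<lambda>x. f x $ i) (pd j g)" for f :: "real^3 \<Rightarrow> real^3"
    unfolding ip_def b_def by (simp_all add: inner_axis mult.commute)
  have parts: "ip (conv (pd j (moll n)) u) b = - ip (conv (moll n) u) (\<lambda>x. pd j g x *\<^sub>R axis i 1)" for n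
  proof -
    have c: "(\<lambda>x. frechet_derivative (conv (moll n) u) (at x) (axis j 1)) = conv (pd j (moll n)) u"
      using pd_conv[OF test_function_moll loc_int_l2[OF u], of j] by (simp add: pd_def[abs_def])
    show ?thesis
      using l2_integration_by_parts[of "conv (moll n) u" "axis j 1" b] sb lb
      unfolding c b' by (simp add: smooth_conv loc_int_l2 u test_function_moll test_function_pd conv_Young(1))
  qed
  have "(\<lambda>n. ip (conv (pd j (moll (\<phi> n))) u) b) \<longlonglongrightarrow> ip (h j) b"
    by (rule ip_tendsto) (use lim h lb in \<open>auto simp: n2_def[of "\<lambda>x. 0"] ip_def[of "\<lambda>x. 0"] intro: conv_Young(1) u test_function_moll test_function_pd\<close>)
  moreover have "(\<lambda>n. ip (conv (pd j (moll (\<phi> n))) u) b) \<longlonglongrightarrow> - ip u (\<lambda>x. pd j g x *\<^sub>R axis i 1)"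
    unfolding parts
  proof (intro tendsto_minus ip_tendsto)
    show "(\<lambda>n. n2 (\<lambda>x. conv (moll (\<phi> n)) u x - u x)) \<longlonglongrightarrow> 0"
      by (rule filterlim_compose[OF conv_moll_l2_tendsto[OF u] \<phi>])
  qed (use lb u in \<open>auto simp: n2_def[of "\<lambda>x. 0"] ip_def[of "\<lambda>x. 0"] intro: conv_Young(1) test_function_moll\<close>)
  ultimately have "ip (h j) b = - ip u (\<lambda>x. pd j g x *\<^sub>R axis i 1)" by (rule LIMSEQ_unique)
  then show "ip (\<lambda>x. u x $ i) (pd j g) = - ip (\<lambda>x. ?G x $ i $ j) g"
    unfolding ipb by simp
qed

section \<open>Removing the mollification\<close>

lemma test_function_derivative_bound:
  fixes f :: "real^3 \<Rightarrow> real"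
  assumes f: "test_function UNIV f"
  obtains C where "C \<ge> 0" "\<And>x h. \<bar>frechet_derivative f (at x) h\<bar> \<le> C * norm h"
proof -
  have "\<exists>C\<ge>0. \<forall>x. \<bar>pd i f x\<bar> \<le> C" for i
    using test_function_bounded[OF test_function_pd[OF f, of i]] by (metis real_norm_def)
  then obtain C where C: "\<And>i. C i \<ge> 0" "\<And>i x. \<bar>pd i f x\<bar> \<le> C i" by metis
  have "\<bar>frechet_derivative f (at x) h\<bar> \<le> (\<Sum>i\<in>UNIV. C i) * norm h" for x h
  proof -
    have "\<bar>frechet_derivative f (at x) h\<bar> \<le> (\<Sum>i\<in>UNIV. \<bar>h $ i *\<^sub>R pd i f x\<bar>)"
      unfolding frechet_derivative_axis_sum[OF test_function_smooth[OF f]] by (rule sum_abs)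
    also have "\<dots> \<le> (\<Sum>i\<in>UNIV. C i * norm h)"
      using C component_le_norm_cart[of h]
      by (intro sum_mono) (subst mult.commute, auto simp: abs_mult intro!: mult_mono)
    finally show ?thesis by (simp add: sum_distrib_right)
  qed
  then show ?thesis using C(1) by (intro that[of "\<Sum>i\<in>UNIV. C i"] sum_nonneg) auto
qed

section \<open>Vanishing of the transport by the solution of its own mollification\<close>

context ns_interval
begin

text \<open>Insert a cutoff dilated by \<open>Suc n\<close>. The gradient of the cutoff is of size
  \<open>1 / Suc n\<close> and the field is bounded by \<open>M\<close>, so the error is at most a
  constant times the L1 norm of \<open>q\<close> over \<open>Suc n\<close>. This admits
  \<open>q\<close> without compact support.\<close>

lemma U_gradient_integral_0:
  fixes q :: "real^3 \<Rightarrow> real"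
  assumes t: "t \<in> {a..b}" and q: "smooth q" and qi: "integrable lborel q"
    and gi: "integrable lborel (\<lambda>x. frechet_derivative q (at x) (U t x))"
  shows "(LINT x|lborel. frechet_derivative q (at x) (U t x)) = 0"
proof -
  \<comment> \<open>Normalised to the value 1 at the origin, so that the dilated cutoffs converge to
    1 at every point.\<close>
  define \<beta> where "\<beta> = (\<lambda>x::real^3. bump x / bump (0::real^3))"
  have b0: "bump (0::real^3) > 0" by (simp add: bump_pos_iff)
  have \<beta>: "test_function UNIV \<beta>"
    using test_function_scaleR[OF smooth_const test_function_bump, of "1 / bump (0::real^3)"]
    unfolding \<beta>_def by simp
  have \<beta>1: "\<beta> 0 = 1" using b0 by (simp add: \<beta>_def)
  obtain B where B: "\<And>x. \<bar>\<beta> x\<bar> \<le> B" using test_function_bounded[OF \<beta>] by (metis real_norm_def)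
  obtain C where C: "C \<ge> 0" "\<And>x h. \<bar>frechet_derivative \<beta> (at x) h\<bar> \<le> C * norm h"
    using test_function_derivative_bound[OF \<beta>] by blast
  have [measurable]: "q \<in> borel_measurable borel" "U t \<in> borel_measurable borel" "\<beta> \<in> borel_measurable borel"
    using qi U_measurable[OF t] test_function_measurable[OF \<beta>] by (auto dest: borel_measurable_integrable)
  have gm [measurable]: "(\<lambda>x. frechet_derivative q (at x) (U t x)) \<in> borel_measurable borel"
    using gi by (auto dest: borel_measurable_integrable)
  define \<psi> where "\<psi> = (\<lambda>n x. \<beta> (inverse (real (Suc n)) *\<^sub>R x))"
  have \<psi>: "test_function UNIV (\<psi> n)" for n
  proof -
    obtain R where R: "\<And>x. norm x > R \<Longrightarrow> \<beta> x = 0" using test_function_supportE[OF \<beta>] by metis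
    have "smooth (\<lambda>x. \<beta> (0 + inverse (real (Suc n)) *\<^sub>R x))"
      by (rule smooth_affine[OF bounded_linear_scaleR_right test_function_smooth[OF \<beta>]])
    moreover have "norm x \<le> real (Suc n) * R" if "\<psi> n x \<noteq> 0" for x
      using that R[of "inverse (real (Suc n)) *\<^sub>R x"] unfolding \<psi>_def
      by (cases "norm (inverse (real (Suc n)) *\<^sub>R x) > R") (auto simp: field_simps simp del: of_nat_Suc)
    ultimately show ?thesis by (intro test_functionI[where R = "real (Suc n) * R"]) (auto simp: \<psi>_def)
  qed
  have d\<psi>: "(\<psi> n has_derivative (\<lambda>h. inverse (real (Suc n)) * frechet_derivative \<beta> (at (inverse (real (Suc n)) *\<^sub>R x)) h)) (at x)" for n x
  proof -
    have lin: "linear (frechet_derivative \<beta> (at y))" for y by (rule smooth_linear_frechet[OF test_function_smooth[OF \<beta>]])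
    have "((\<lambda>x. inverse (real (Suc n)) *\<^sub>R x) has_derivative (\<lambda>h. inverse (real (Suc n)) *\<^sub>R h)) (at x)"
      by (auto intro!: derivative_eq_intros)
    from has_derivative_compose[OF this smooth_has_derivative[OF test_function_smooth[OF \<beta>]]]
    show ?thesis unfolding \<psi>_def by (simp add: linear_cmul[OF lin])
  qed
  define e where "e = (\<lambda>n x. q x * (inverse (real (Suc n)) * frechet_derivative \<beta> (at (inverse (real (Suc n)) *\<^sub>R x)) (U t x)))"
  have em [measurable]: "e n \<in> borel_measurable borel" for n
  proof -
    have pm [measurable]: "pd i \<beta> \<in> borel_measurable borel" for i
      by (rule test_function_measurable[OF test_function_pd[OF \<beta>]])
    have cm [measurable]: "(\<lambda>x. U t x $ i) \<in> borel_measurable borel" for i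
      by (rule measurable_compose[OF U_measurable[OF t]], intro borel_measurable_continuous_onI continuous_intros)
    show ?thesis
      unfolding e_def frechet_derivative_axis_sum[OF test_function_smooth[OF \<beta>]] by measurable
  qed
  have eb: "\<bar>e n x\<bar> \<le> inverse (real (Suc n)) * (C * M * \<bar>q x\<bar>)" for n x
  proof -
    have "\<bar>frechet_derivative \<beta> (at (inverse (real (Suc n)) *\<^sub>R x)) (U t x)\<bar> \<le> C * M"
      using C(2) mult_left_mono[OF U_bound[OF t, of x] C(1)] order_trans by blast
    then have "inverse (real (Suc n)) * (\<bar>q x\<bar> * \<bar>frechet_derivative \<beta> (at (inverse (real (Suc n)) *\<^sub>R x)) (U t x)\<bar>)
        \<le> inverse (real (Suc n)) * (\<bar>q x\<bar> * (C * M))"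
      by (intro mult_left_mono) auto
    then show ?thesis unfolding e_def by (simp add: abs_mult mult_ac del: of_nat_Suc)
  qed
  have ei: "integrable lborel (e n)" for n
    by (rule Bochner_Integration.integrable_bound[of _ "\<lambda>x. inverse (real (Suc n)) * (C * M * \<bar>q x\<bar>)"])
      (use qi eb in \<open>auto simp del: of_nat_Suc intro!: AE_I2 order_trans[OF _ abs_ge_self]\<close>)
  have ci: "integrable lborel (\<lambda>x. \<psi> n x * frechet_derivative q (at x) (U t x))" for n
    by (rule Bochner_Integration.integrable_bound[OF integrable_mult_right[OF gi, of B]])
      (auto simp: \<psi>_def abs_mult simp del: of_nat_Suc intro!: AE_I2 mult_right_mono order_trans[OF B abs_ge_self])
  have zero: "(LINT x|lborel. \<psi> n x * frechet_derivative q (at x) (U t x)) + (LINT x|lborel. e n x) = 0" for n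
  proof -
    have "test_function UNIV (\<lambda>x. q x *\<^sub>R \<psi> n x)" by (rule test_function_scaleR[OF q \<psi>])
    from U_div[OF t this] have "(LINT x|lborel. e n x + \<psi> n x * frechet_derivative q (at x) (U t x)) = 0"
      using frechet_derivative_eq[OF has_derivative_scaleR[OF smooth_has_derivative[OF q] d\<psi>]]
      by (simp add: e_def mult.commute del: of_nat_Suc)
    then show ?thesis using ei ci by simp
  qed
  have "(\<lambda>n. LINT x|lborel. \<psi> n x * frechet_derivative q (at x) (U t x)) \<longlonglongrightarrow> (LINT x|lborel. frechet_derivative q (at x) (U t x))"
  proof (rule integral_dominated_convergence)
    show "integrable lborel (\<lambda>x. B * \<bar>frechet_derivative q (at x) (U t x)\<bar>)" using gi by simp
    show "AE x in lborel. norm (\<psi> n x * frechet_derivative q (at x) (U t x)) \<le> B * \<bar>frechet_derivative q (at x) (U t x)\<bar>" for n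
      using B by (auto simp: \<psi>_def abs_mult simp del: of_nat_Suc intro!: mult_right_mono)
    show "AE x in lborel. (\<lambda>n. \<psi> n x * frechet_derivative q (at x) (U t x)) \<longlonglongrightarrow> frechet_derivative q (at x) (U t x)"
    proof (rule AE_I2)
      fix x :: "real^3"
      have "(\<lambda>n. inverse (real (Suc n)) *\<^sub>R x) \<longlonglongrightarrow> 0 *\<^sub>R x"
        by (intro tendsto_intros LIMSEQ_inverse_real_of_nat)
      moreover have "isCont \<beta> 0"
        using smooth_continuous[OF test_function_smooth[OF \<beta>]] by (simp add: continuous_on_eq_continuous_at)
      ultimately have "(\<lambda>n. \<psi> n x) \<longlonglongrightarrow> \<beta> 0"
        unfolding \<psi>_def using isCont_tendsto_compose[of 0 \<beta>] by simp
      from tendsto_mult[OF this tendsto_const]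
      show "(\<lambda>n. \<psi> n x * frechet_derivative q (at x) (U t x)) \<longlonglongrightarrow> frechet_derivative q (at x) (U t x)"
        unfolding \<beta>1 by simp
    qed
  qed (use ci gi in \<open>auto dest: borel_measurable_integrable\<close>)
  moreover have "(\<lambda>n. LINT x|lborel. e n x) \<longlonglongrightarrow> 0"
  proof (rule Lim_null_comparison)
    show "\<forall>\<^sub>F n in sequentially. norm (LINT x|lborel. e n x) \<le> inverse (real (Suc n)) * (C * M * (LINT x|lborel. \<bar>q x\<bar>))"
    proof (intro always_eventually allI)
      fix n
      have "norm (LINT x|lborel. e n x) \<le> (LINT x|lborel. norm (e n x))" by (rule integral_norm_bound)
      also have "\<dots> \<le> (LINT x|lborel. inverse (real (Suc n)) * (C * M * \<bar>q x\<bar>))"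
        using ei[of n] eb[of n] qi by (intro integral_mono) (auto simp del: of_nat_Suc)
      finally show "norm (LINT x|lborel. e n x) \<le> inverse (real (Suc n)) * (C * M * (LINT x|lborel. \<bar>q x\<bar>))"
        by simp
    qed
    show "(\<lambda>n. inverse (real (Suc n)) * (C * M * (LINT x|lborel. \<bar>q x\<bar>))) \<longlonglongrightarrow> 0"
      by (rule tendsto_mult_left_zero[OF LIMSEQ_inverse_real_of_nat])
  qed
  ultimately have "(\<lambda>n. (LINT x|lborel. \<psi> n x * frechet_derivative q (at x) (U t x)) + (LINT x|lborel. e n x))
      \<longlonglongrightarrow> (LINT x|lborel. frechet_derivative q (at x) (U t x)) + 0"
    by (rule tendsto_add)
  then show ?thesis unfolding zero by (simp add: LIMSEQ_const_iff)
qed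

lemma comp_bound: "t \<in> {a..b} \<Longrightarrow> \<bar>U t x $ i\<bar> \<le> M"
  using component_le_norm_cart[of "U t x" i] U_bound[of t x] by linarith

lemma comp_measurable: "t \<in> {a..b} \<Longrightarrow> (\<lambda>x. U t x $ i) \<in> borel_measurable borel"
  by (rule measurable_compose[OF U_measurable], assumption, intro borel_measurable_continuous_onI continuous_intros)

lemma l2_comp_scaleR:
  assumes "t \<in> {a..b}" "l2 f"
  shows "l2 (\<lambda>x. U t x $ i *\<^sub>R f x)" "n2 (\<lambda>x. U t x $ i *\<^sub>R f x) \<le> M * n2 f"
  using l2_mult_bounded[OF assms(2) comp_measurable comp_bound] assms(1) by auto

text \<open>With \<open>V = conv k (U t)\<close>, the summands add up to the integral of
  \<open>U t\<close> against the gradient of half the square of \<open>V\<close>. That square is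
  integrable but not compactly supported, hence the extension of the divergence condition just
  proved.\<close>

lemma transport_cancels:
  assumes t: "t \<in> {a..b}" and k: "test_function UNIV k"
  shows "(\<Sum>i\<in>UNIV. ip (\<lambda>x. U t x $ i *\<^sub>R conv k (U t) x) (conv (pd i k) (U t))) = 0"
proof -
  define V where "V = conv k (U t)"
  have Ul: "loc_int (U t)" by (rule loc_int_l2[OF U_l2[OF t]])
  have sV: "smooth V" unfolding V_def by (rule smooth_conv[OF k Ul])
  have lV: "l2 V" unfolding V_def by (rule conv_Young(1)[OF k U_l2[OF t]])
  have lp: "l2 (conv (pd i k) (U t))" for i by (rule conv_Young(1)[OF test_function_pd[OF k] U_l2[OF t]])
  define q where "q = (\<lambda>x. (1/2) *\<^sub>R (V x \<bullet> V x))"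
  have dq: "frechet_derivative q (at x) h = V x \<bullet> frechet_derivative V (at x) h" for x h
  proof -
    have "(q has_derivative (\<lambda>h. (1/2) *\<^sub>R (V x \<bullet> frechet_derivative V (at x) h + frechet_derivative V (at x) h \<bullet> V x))) (at x)"
      unfolding q_def by (intro has_derivative_scaleR_right has_derivative_inner smooth_has_derivative sV)
    from frechet_derivative_eq[OF this] show ?thesis by (simp add: inner_commute)
  qed
  have eq: "frechet_derivative q (at x) (U t x) = (\<Sum>i\<in>UNIV. (U t x $ i *\<^sub>R V x) \<bullet> conv (pd i k) (U t) x)" for x
    unfolding dq frechet_derivative_axis_sum[OF sV] pd_conv[OF k Ul, folded V_def] by (simp add: inner_sum_right)
  have ii: "integrable lborel (\<lambda>x. (U t x $ i *\<^sub>R V x) \<bullet> conv (pd i k) (U t) x)" for i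
    by (rule l2_inner_integrable[OF l2_comp_scaleR(1)[OF t lV] lp])
  have "(LINT x|lborel. frechet_derivative q (at x) (U t x)) = 0"
  proof (rule U_gradient_integral_0[OF t])
    show "smooth q" unfolding q_def by (intro smooth_scaleR smooth_const smooth_inner sV)
    show "integrable lborel q" unfolding q_def using l2_inner_integrable[OF lV lV] by simp
    show "integrable lborel (\<lambda>x. frechet_derivative q (at x) (U t x))" unfolding eq using ii by simp
  qed
  then show ?thesis unfolding eq ip_def V_def[symmetric] using ii by simp
qed

end

text \<open>Completeness of Lebesgue measure: the pointwise \<open>lim\<close> is measurable and
  \<open>g\<close> agrees with it almost everywhere. Gradients are picked separately for each time,
  so this is the source of measurability of their norms in time.\<close>

lemma borel_measurable_lebesgue_on_AE_limit:
  fixes f :: "nat \<Rightarrow> 'a::euclidean_space \<Rightarrow> real"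
  assumes f: "\<And>n. f n \<in> borel_measurable (lebesgue_on S)" and S: "S \<in> sets lebesgue"
    and lim: "AE t in lebesgue_on S. (\<lambda>n. f n t) \<longlonglongrightarrow> g t"
  shows "g \<in> borel_measurable (lebesgue_on S)"
proof -
  define h where "h = (\<lambda>t. lim (\<lambda>n. f n t))"
  have "h \<in> borel_measurable (lebesgue_on S)"
    unfolding h_def using f by measurable
  then have 1: "(\<lambda>x. if x \<in> S then h x else 0) \<in> borel_measurable lebesgue"
    by (simp add: borel_measurable_if[OF S])
  have "AE t in lebesgue_on S. h t = g t"
    using lim by eventually_elim (simp add: h_def limI)
  then have "AE t in lebesgue. t \<in> S \<longrightarrow> h t = g t"
    using S by (simp add: AE_restrict_space_iff)
  then have "AE t in lebesgue. (if t \<in> S then h t else 0) = (if t \<in> S then g t else 0)"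
    by eventually_elim auto
  from borel_measurable_AE[OF 1 this] show ?thesis
    by (simp add: borel_measurable_if[OF S])
qed

section \<open>The Cauchy estimate for mollified gradients in space-time\<close>

context ns_interval
begin

abbreviation "time \<equiv> lebesgue_on {a..b}"

lemma time_integrable: "continuous_on {a..b} f \<Longrightarrow> integrable time (f :: real \<Rightarrow> real)"
  by (rule continuous_imp_integrable_real)

lemma energy_balance_time:
  assumes k: "test_function UNIV k" "\<And>z. k (- z) = k z"
  shows "2 * (LINT t|time. transport k t) - 2 * (LINT t|time. dissipation k t)
    = (n2 (conv k (U b)))\<^sup>2 - (n2 (conv k (U a)))\<^sup>2"
proof -
  have i: "integrable time (transport k)" "integrable time (dissipation k)"
    using time_integrable[OF transport_cont[OF k]] time_integrable[OF dissipation_cont[OF k]] by auto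
  then have "integrable time (\<lambda>t. 2 * (transport k t - dissipation k t))" by simp
  from lebesgue_integral_eq_integral[OF this] integral_unique[OF energy_balance[OF k]]
  have "(LINT t|time. 2 * (transport k t - dissipation k t)) = (n2 (conv k (U b)))\<^sup>2 - (n2 (conv k (U a)))\<^sup>2"
    by simp
  then show ?thesis using i by (simp add: right_diff_distrib)
qed

lemma dissipation_nonneg: "dissipation k t \<ge> 0"
  unfolding dissipation_def by (intro sum_nonneg) simp

definition moll_error :: "nat \<Rightarrow> real \<Rightarrow> real" where
  "moll_error n t = (\<Sum>i\<in>UNIV. (n2 (\<lambda>x. conv (moll n) (UU i t) x - UU i t x))\<^sup>2)"

text \<open>The contribution of one index to the Cauchy estimate. The factors 2 come from
  \<open>(x + y)\<^sup>2 \<le> 2 * x\<^sup>2 + 2 * y\<^sup>2\<close> when a difference of two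
  mollifiers is compared with the identity through each of them.\<close>

definition moll_gap :: "nat \<Rightarrow> real" where
  "moll_gap n = 2 * (n2 (\<lambda>x. conv (moll n) (U a) x - U a x))\<^sup>2 + 2 * (LINT t|time. moll_error n t)"

lemma moll_error_cont: "continuous_on {a..b} (moll_error n)"
  unfolding moll_error_def[abs_def]
  by (intro continuous_intros continuous_on_n2 l2_continuous_on_diff l2_continuous_on_conv test_function_moll UU_cont)

lemma conv_moll_l2: "l2 f \<Longrightarrow> l2 (conv (moll n) f)"
  by (rule conv_Young(1)[OF test_function_moll])

lemma conv_moll_error_bound:
  assumes f: "l2 f"
  shows "n2 (\<lambda>x. conv (moll n) f x - f x) \<le> 2 * n2 f"
  using n2_triangle_diff[OF conv_moll_l2[OF f, of n] f] conv_Young(2)[OF test_function_moll[of n] f]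
  by (simp add: moll_abs_integral)

lemma moll_gap_tendsto_0: "moll_gap \<longlonglongrightarrow> 0"
proof -
  have a: "a \<in> {a..b}" using ab by simp
  have "(\<lambda>n. LINT t|time. moll_error n t) \<longlonglongrightarrow> (LINT t|time. 0)"
  proof (rule integral_dominated_convergence)
    have c: "continuous_on {a..b} (\<lambda>t. \<Sum>i\<in>UNIV. (2 * n2 (UU i t))\<^sup>2)"
      by (intro continuous_intros continuous_on_n2 UU_cont)
    show "integrable time (\<lambda>t. \<Sum>i\<in>UNIV. (2 * n2 (UU i t))\<^sup>2)" by (rule time_integrable[OF c])
    show "moll_error n \<in> borel_measurable time" for n
      using time_integrable[OF moll_error_cont] by (rule borel_measurable_integrable)
    show "AE t in time. (\<lambda>n. moll_error n t) \<longlonglongrightarrow> 0"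
    proof (rule AE_I2)
      fix t assume "t \<in> space time"
      then have t: "t \<in> {a..b}" by simp
      have "(\<lambda>n. moll_error n t) \<longlonglongrightarrow> (\<Sum>i\<in>(UNIV::3 set). 0\<^sup>2)"
        unfolding moll_error_def by (intro tendsto_intros conv_moll_l2_tendsto UU_l2 t)
      then show "(\<lambda>n. moll_error n t) \<longlonglongrightarrow> 0" by simp
    qed
    show "AE t in time. norm (moll_error n t) \<le> (\<Sum>i\<in>UNIV. (2 * n2 (UU i t))\<^sup>2)" for n
    proof (rule AE_I2)
      fix t assume "t \<in> space time"
      then have t: "t \<in> {a..b}" by simp
      have "moll_error n t \<le> (\<Sum>i\<in>UNIV. (2 * n2 (UU i t))\<^sup>2)"
        unfolding moll_error_def by (intro sum_mono power_mono conv_moll_error_bound UU_l2 t) simp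
      moreover have "moll_error n t \<ge> 0" unfolding moll_error_def by (intro sum_nonneg) simp
      ultimately show "norm (moll_error n t) \<le> (\<Sum>i\<in>UNIV. (2 * n2 (UU i t))\<^sup>2)" by simp
    qed
  qed simp
  then have "(\<lambda>n. 2 * (n2 (\<lambda>x. conv (moll n) (U a) x - U a x))\<^sup>2 + 2 * (LINT t|time. moll_error n t)) \<longlonglongrightarrow> 2 * 0\<^sup>2 + 2 * 0"
    by (intro tendsto_intros conv_moll_l2_tendsto U_l2 a) simp
  then show ?thesis unfolding moll_gap_def[abs_def] by simp
qed

definition moll_diff :: "nat \<Rightarrow> nat \<Rightarrow> real^3 \<Rightarrow> real" where
  "moll_diff m n z = moll m z - moll n z"

lemma test_function_moll_diff: "test_function UNIV (moll_diff m n)"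
  unfolding moll_diff_def[abs_def] by (intro test_function_diff test_function_moll)

lemma moll_diff_even: "moll_diff m n (- z) = moll_diff m n z"
  by (simp add: moll_diff_def moll_minus)

lemma n2_conv_moll_diff:
  assumes f: "l2 f"
  shows "(n2 (conv (moll_diff m n) f))\<^sup>2
    \<le> 2 * (n2 (\<lambda>x. conv (moll m) f x - f x))\<^sup>2 + 2 * (n2 (\<lambda>x. conv (moll n) f x - f x))\<^sup>2"
proof -
  have "conv (moll_diff m n) f = (\<lambda>x. conv (moll m) f x - conv (moll n) f x)"
    unfolding moll_diff_def[abs_def] by (intro ext conv_diff_kernel test_function_moll loc_int_l2 f)
  moreover have "n2 (\<lambda>x. conv (moll m) f x - conv (moll n) f x)
      \<le> n2 (\<lambda>x. conv (moll m) f x - f x) + n2 (\<lambda>x. f x - conv (moll n) f x)"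
    by (intro n2_diff_triangle conv_moll_l2 f)
  ultimately have "n2 (conv (moll_diff m n) f) \<le> n2 (\<lambda>x. conv (moll m) f x - f x) + n2 (\<lambda>x. conv (moll n) f x - f x)"
    by (simp add: n2_diff_commute[of f])
  then have "(n2 (conv (moll_diff m n) f))\<^sup>2 \<le> (n2 (\<lambda>x. conv (moll m) f x - f x) + n2 (\<lambda>x. conv (moll n) f x - f x))\<^sup>2"
    by (rule power_mono) simp
  also have "\<dots> \<le> 2 * (n2 (\<lambda>x. conv (moll m) f x - f x))\<^sup>2 + 2 * (n2 (\<lambda>x. conv (moll n) f x - f x))\<^sup>2"
    using sum_squares_bound[of "n2 (\<lambda>x. conv (moll m) f x - f x)" "n2 (\<lambda>x. conv (moll n) f x - f x)"]
    by (simp add: power2_sum)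
  finally show ?thesis .
qed

text \<open>In the balance for the difference kernel, twice the transport is at most the squared
  norms of the convolved products plus one copy of the dissipation. The balance carries two copies,
  so one remains on the left; the energy at \<open>b\<close> is nonnegative and is discarded, and
  only the initial difference at \<open>a\<close> and the product errors are left.\<close>

lemma dissipation_moll_diff: "(LINT t|time. dissipation (moll_diff m n) t) \<le> moll_gap m + moll_gap n"
proof -
  let ?k = "moll_diff m n"
  note k = test_function_moll_diff[of m n] moll_diff_even[of m n]
  have a: "a \<in> {a..b}" using ab by simp
  have i: "integrable time (transport ?k)" "integrable time (dissipation ?k)" "integrable time (moll_error m)" "integrable time (moll_error n)"
    using time_integrable[OF transport_cont[OF k]] time_integrable[OF dissipation_cont[OF k]] time_integrable[OF moll_error_cont] by auto
  have T: "2 * transport ?k t \<le> 2 * moll_error m t + 2 * moll_error n t + dissipation ?k t" if t: "t \<in> {a..b}" for t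
  proof -
    have "2 * transport ?k t = (\<Sum>i\<in>UNIV. 2 * ip (conv ?k (UU i t)) (conv (pd i ?k) (U t)))"
      by (simp add: transport_def sum_distrib_left)
    also have "\<dots> \<le> (\<Sum>i\<in>UNIV. (2 * (n2 (\<lambda>x. conv (moll m) (UU i t) x - UU i t x))\<^sup>2
        + 2 * (n2 (\<lambda>x. conv (moll n) (UU i t) x - UU i t x))\<^sup>2) + (n2 (conv (pd i ?k) (U t)))\<^sup>2)"
    proof (rule sum_mono)
      fix i :: 3
      have "ip (conv ?k (UU i t)) (conv (pd i ?k) (U t)) \<le> n2 (conv ?k (UU i t)) * n2 (conv (pd i ?k) (U t))"
        using ip_Cauchy_Schwarz[OF conv_Young(1)[OF k(1) UU_l2[OF t]] conv_Young(1)[OF test_function_pd[OF k(1)] U_l2[OF t]]]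
        by (rule order_trans[OF abs_ge_self])
      then have "2 * ip (conv ?k (UU i t)) (conv (pd i ?k) (U t)) \<le> (n2 (conv ?k (UU i t)))\<^sup>2 + (n2 (conv (pd i ?k) (U t)))\<^sup>2"
        using sum_squares_bound[of "n2 (conv ?k (UU i t))" "n2 (conv (pd i ?k) (U t))"] by linarith
      then show "2 * ip (conv ?k (UU i t)) (conv (pd i ?k) (U t)) \<le> (2 * (n2 (\<lambda>x. conv (moll m) (UU i t) x - UU i t x))\<^sup>2
        + 2 * (n2 (\<lambda>x. conv (moll n) (UU i t) x - UU i t x))\<^sup>2) + (n2 (conv (pd i ?k) (U t)))\<^sup>2"
        using n2_conv_moll_diff[OF UU_l2[OF t], of m n i] by linarith
    qed
    also have "\<dots> = 2 * moll_error m t + 2 * moll_error n t + dissipation ?k t"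
      by (simp add: sum.distrib moll_error_def dissipation_def sum_distrib_left)
    finally show ?thesis .
  qed
  have "2 * (LINT t|time. transport ?k t) = (LINT t|time. 2 * transport ?k t)" by simp
  also have "\<dots> \<le> (LINT t|time. 2 * moll_error m t + 2 * moll_error n t + dissipation ?k t)"
    by (rule integral_mono) (use i T in auto)
  also have "\<dots> = 2 * (LINT t|time. moll_error m t) + 2 * (LINT t|time. moll_error n t) + (LINT t|time. dissipation ?k t)"
    using i by simp
  finally have "(LINT t|time. dissipation ?k t) \<le> (n2 (conv ?k (U a)))\<^sup>2
      + 2 * (LINT t|time. moll_error m t) + 2 * (LINT t|time. moll_error n t)"
    using energy_balance_time[OF k] zero_le_power2[of "n2 (conv ?k (U b))"] by linarith
  then show ?thesis using n2_conv_moll_diff[OF U_l2[OF a], of m n] unfolding moll_gap_def by linarith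
qed

text \<open>Convergence in space-time is made quantitative along a subsequence, so that for almost
  every fixed time the gradient increments are geometrically small and \<open>l2_complete\<close>
  applies in space. The same series supplies \<open>W\<close>, one integrable function of time that
  dominates all dissipations along the subsequence.\<close>

lemma gradient_subsequence:
  obtains \<phi> :: "nat \<Rightarrow> nat" and W :: "real \<Rightarrow> real" where
    "filterlim \<phi> at_top sequentially" "integrable time W"
    "AE t in time. (\<exists>G. wgrad (U t) G) \<and> (\<forall>n. dissipation (moll (\<phi> n)) t \<le> W t)"
proof -
  \<comment> \<open>Two consecutive gaps then add up to at most \<open>(1/32) ^ k\<close>. The
    weight \<open>16 ^ k\<close> in \<open>q\<close> leaves the summable \<open>(1/2) ^ k\<close>,
    and its root yields the ratio \<open>1/4\<close> required by \<open>l2_complete\<close>.\<close>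
  have "\<exists>n\<ge>k. moll_gap n \<le> 1/2 * (1/32) ^ k" for k
  proof -
    have "\<forall>\<^sub>F n in sequentially. moll_gap n < 1/2 * (1/32) ^ k"
      by (rule order_tendstoD[OF moll_gap_tendsto_0]) simp
    then obtain n0 where n0: "\<And>n. n \<ge> n0 \<Longrightarrow> moll_gap n < 1/2 * (1/32) ^ k"
      unfolding eventually_sequentially by blast
    then show ?thesis by (intro exI[of _ "max k n0"]) (simp add: less_imp_le)
  qed
  then obtain \<phi> :: "nat \<Rightarrow> nat" where \<phi>: "\<And>k. \<phi> k \<ge> k" "\<And>k. moll_gap (\<phi> k) \<le> 1/2 * (1/32) ^ k"
    by metis
  have \<phi>_lim: "filterlim \<phi> at_top sequentially"
    by (rule filterlim_at_top_mono[OF filterlim_ident]) (use \<phi>(1) in auto)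
  define q where "q = (\<lambda>k t. 16 ^ k * dissipation (moll_diff (\<phi> (Suc k)) (\<phi> k)) t)"
  have qi: "integrable time (q k)" for k
    unfolding q_def using time_integrable[OF dissipation_cont[OF test_function_moll_diff moll_diff_even]] by simp
  have q0: "q k t \<ge> 0" for k t by (simp add: q_def dissipation_nonneg)
  have qb: "(LINT t|time. q k t) \<le> 1 * (1/2) ^ k" for k
  proof -
    have "moll_gap (\<phi> (Suc k)) + moll_gap (\<phi> k) \<le> 1/2 * (1/32) ^ Suc k + 1/2 * (1/32) ^ k"
      by (intro add_mono \<phi>)
    also have "\<dots> \<le> (1/32) ^ k" by simp
    finally have "(LINT t|time. dissipation (moll_diff (\<phi> (Suc k)) (\<phi> k)) t) \<le> (1/32) ^ k"
      using dissipation_moll_diff[of "\<phi> (Suc k)" "\<phi> k"] by linarith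
    then have "(LINT t|time. q k t) \<le> 16 ^ k * (1/32) ^ k" by (simp add: q_def)
    also have "\<dots> = (1/2) ^ k" by (simp flip: power_mult_distrib)
    finally show ?thesis by simp
  qed
  note S = AE_summable_of_integrals[OF qi q0 qb]
  \<comment> \<open>From \<open>(p + 2 * c)\<^sup>2 \<le> 2 * p\<^sup>2 + 8 * c\<^sup>2\<close> in
    each of the three directions, with \<open>c\<^sup>2\<close> the sum of the series
    \<open>q\<close>.\<close>
  define W where "W = (\<lambda>t. 2 * dissipation (moll (\<phi> 0)) t + 24 * (\<Sum>k. q k t))"
  have Wi: "integrable time W"
    unfolding W_def using S(2) time_integrable[OF dissipation_cont[OF test_function_moll moll_minus]] by simp
  have "AE t in time. t \<in> {a..b}" by (rule AE_I2) simp
  with S(1) have "AE t in time. (\<exists>G. wgrad (U t) G) \<and> (\<forall>n. dissipation (moll (\<phi> n)) t \<le> W t)"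
  proof eventually_elim
    case (elim t)
    note s = elim(1) and t = elim(2)
    define c where "c = sqrt (\<Sum>k. q k t)"
    have S0: "(\<Sum>k. q k t) \<ge> 0" by (rule suminf_nonneg[OF s q0])
    then have c0: "c \<ge> 0" "c\<^sup>2 = (\<Sum>k. q k t)" by (auto simp: c_def)
    define f where "f = (\<lambda>i k. conv (pd i (moll (\<phi> k))) (U t))"
    have fl: "l2 (f i k)" for i k
      unfolding f_def by (intro conv_Young(1) test_function_pd test_function_moll U_l2 t)
    have fd: "n2 (\<lambda>x. f i (Suc k) x - f i k x) \<le> c * (1/4) ^ k" for i k
    proof -
      have "pd i (moll_diff m n) = (\<lambda>z. pd i (moll m) z - pd i (moll n) z)" for m n
        unfolding moll_diff_def[abs_def] pd_def
        by (intro ext, subst frechet_derivative_eq[OF has_derivative_diff[OF smooth_has_derivative smooth_has_derivative]])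
          (auto intro: test_function_smooth test_function_moll)
      then have "conv (pd i (moll_diff (\<phi> (Suc k)) (\<phi> k))) (U t) = (\<lambda>x. f i (Suc k) x - f i k x)"
        unfolding f_def using conv_diff_kernel[OF test_function_pd[OF test_function_moll] test_function_pd[OF test_function_moll] loc_int_l2[OF U_l2[OF t]]]
        by auto
      then have "(n2 (\<lambda>x. f i (Suc k) x - f i k x))\<^sup>2 \<le> dissipation (moll_diff (\<phi> (Suc k)) (\<phi> k)) t"
        unfolding dissipation_def
        using member_le_sum[of i UNIV "\<lambda>i. (n2 (conv (pd i (moll_diff (\<phi> (Suc k)) (\<phi> k))) (U t)))\<^sup>2"] by simp
      then have 1: "n2 (\<lambda>x. f i (Suc k) x - f i k x) \<le> sqrt (dissipation (moll_diff (\<phi> (Suc k)) (\<phi> k)) t)"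
        by (rule real_le_rsqrt)
      have "(\<lambda>k. 16 ^ k * (sqrt (dissipation (moll_diff (\<phi> (Suc k)) (\<phi> k)) t))\<^sup>2) = (\<lambda>k. q k t)"
        by (simp add: q_def dissipation_nonneg)
      with geometric_weight_bound[of 16 "\<lambda>k. sqrt (dissipation (moll_diff (\<phi> (Suc k)) (\<phi> k)) t)" k] s
      have "sqrt (dissipation (moll_diff (\<phi> (Suc k)) (\<phi> k)) t) \<le> c * (1 / sqrt 16) ^ k"
        by (simp add: c_def)
      moreover have "sqrt 16 = (4::real)" by (rule real_sqrt_unique) auto
      ultimately show ?thesis using 1 by simp
    qed
    have "\<exists>h. l2 h \<and> (\<lambda>n. n2 (\<lambda>x. f i n x - h x)) \<longlonglongrightarrow> 0" for i
      by (rule l2_complete[of "f i" c, OF fl fd]) blast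
    then obtain h where "\<forall>i. l2 (h i) \<and> (\<lambda>n. n2 (\<lambda>x. f i n x - h i x)) \<longlonglongrightarrow> 0"
      using choice[of "\<lambda>i h. l2 h \<and> (\<lambda>n. n2 (\<lambda>x. f i n x - h x)) \<longlonglongrightarrow> 0"] by blast
    then have h: "\<And>i. l2 (h i)" "\<And>i. (\<lambda>n. n2 (\<lambda>x. f i n x - h i x)) \<longlonglongrightarrow> 0"
      by auto
    have "wgrad (U t) (\<lambda>x. \<chi> i j. h j x $ i)"
      by (rule wgrad_of_limit[OF U_l2[OF t] h(1) h(2)[unfolded f_def] \<phi>_lim])
    moreover have "dissipation (moll (\<phi> n)) t \<le> W t" for n
    proof -
      have "dissipation (moll (\<phi> n)) t \<le> (\<Sum>i\<in>UNIV. 2 * (n2 (f i 0))\<^sup>2 + 8 * c\<^sup>2)"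
        unfolding dissipation_def f_def[symmetric]
      proof (rule sum_mono)
        fix i :: 3
        have "n2 (f i n) \<le> n2 (f i 0) + 2 * c" by (rule n2_telescope_bound[OF fl fd c0(1)])
        then have "(n2 (f i n))\<^sup>2 \<le> (n2 (f i 0) + 2 * c)\<^sup>2" by (rule power_mono) simp
        also have "\<dots> \<le> 2 * (n2 (f i 0))\<^sup>2 + 8 * c\<^sup>2"
          using zero_le_power2[of "n2 (f i 0) - 2 * c"] by (simp add: power2_eq_square algebra_simps)
        finally show "(n2 (conv (pd i (moll (\<phi> n))) (U t)))\<^sup>2 \<le> 2 * (n2 (f i 0))\<^sup>2 + 8 * c\<^sup>2"
          by (simp add: f_def)
      qed
      also have "\<dots> = W t"
        by (simp add: W_def c0(2) dissipation_def f_def sum.distrib sum_distrib_left)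
      finally show ?thesis .
    qed
    ultimately show ?case by blast
  qed
  with \<phi>_lim Wi show ?thesis by (rule that)
qed

section \<open>Commutators and the passage to the limit\<close>

definition commutator :: "nat \<Rightarrow> 3 \<Rightarrow> real \<Rightarrow> real" where
  "commutator n i t = n2 (\<lambda>x. conv (moll n) (UU i t) x - U t x $ i *\<^sub>R conv (moll n) (U t) x)"

text \<open>Insert the product \<open>UU i t\<close> itself: what remains are the mollification
  errors of the product and of \<open>U t\<close>, the latter multiplied by a component bounded by
  \<open>M\<close>.\<close>

lemma commutator_le:
  assumes t: "t \<in> {a..b}"
  shows "commutator n i t \<le> n2 (\<lambda>x. conv (moll n) (UU i t) x - UU i t x) + M * n2 (\<lambda>x. conv (moll n) (U t) x - U t x)"
proof -
  have "commutator n i t \<le> n2 (\<lambda>x. conv (moll n) (UU i t) x - UU i t x)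
      + n2 (\<lambda>x. UU i t x - U t x $ i *\<^sub>R conv (moll n) (U t) x)"
    unfolding commutator_def by (intro n2_diff_triangle conv_moll_l2 UU_l2 U_l2 l2_comp_scaleR t)
  also have "(\<lambda>x. UU i t x - U t x $ i *\<^sub>R conv (moll n) (U t) x) = (\<lambda>x. U t x $ i *\<^sub>R (U t x - conv (moll n) (U t) x))"
    by (simp add: UU_def scaleR_diff_right)
  also have "n2 \<dots> \<le> M * n2 (\<lambda>x. U t x - conv (moll n) (U t) x)"
    by (intro l2_comp_scaleR t l2_diff U_l2 conv_moll_l2)
  finally show ?thesis by (simp add: n2_diff_commute[of "U t"])
qed

text \<open>Subtracting the vanishing sum of \<open>transport_cancels\<close> replaces each
  convolved product by its commutator; Cauchy-Schwarz and the bound on the dissipation give the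
  rest.\<close>

lemma transport_bound:
  assumes t: "t \<in> {a..b}" and W: "dissipation (moll n) t \<le> W"
  shows "\<bar>transport (moll n) t\<bar> \<le> (\<Sum>i\<in>UNIV. commutator n i t) * sqrt W"
proof -
  have l: "l2 (conv (moll n) (UU i t))" "l2 (conv (pd i (moll n)) (U t))"
      "l2 (\<lambda>x. U t x $ i *\<^sub>R conv (moll n) (U t) x)" for i
    by (intro conv_moll_l2 UU_l2 U_l2 l2_comp_scaleR conv_Young(1) test_function_pd test_function_moll t)+
  have "transport (moll n) t = (\<Sum>i\<in>UNIV. ip (\<lambda>x. conv (moll n) (UU i t) x - U t x $ i *\<^sub>R conv (moll n) (U t) x) (conv (pd i (moll n)) (U t)))"
    unfolding transport_def using transport_cancels[OF t test_function_moll, of n] l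
    by (simp add: ip_diff_left sum_subtractf)
  also have "\<bar>\<dots>\<bar> \<le> (\<Sum>i\<in>UNIV. commutator n i t * sqrt W)"
  proof (rule sum_abs[THEN order_trans], rule sum_mono)
    fix i :: 3
    have "(n2 (conv (pd i (moll n)) (U t)))\<^sup>2 \<le> dissipation (moll n) t"
      unfolding dissipation_def using member_le_sum[of i UNIV "\<lambda>i. (n2 (conv (pd i (moll n)) (U t)))\<^sup>2"] by simp
    then have "n2 (conv (pd i (moll n)) (U t)) \<le> sqrt W"
      using W by (intro real_le_rsqrt) linarith
    then have "commutator n i t * n2 (conv (pd i (moll n)) (U t)) \<le> commutator n i t * sqrt W"
      by (rule mult_left_mono) (simp add: commutator_def)
    then show "\<bar>ip (\<lambda>x. conv (moll n) (UU i t) x - U t x $ i *\<^sub>R conv (moll n) (U t) x) (conv (pd i (moll n)) (U t))\<bar> \<le> commutator n i t * sqrt W"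
      using ip_Cauchy_Schwarz[OF l2_diff[OF l(1,3)] l(2), of i i i] unfolding commutator_def by linarith
  qed
  finally show ?thesis by (simp add: sum_distrib_right)
qed

text \<open>Along the subsequence the dissipations converge at almost every time and are dominated
  by \<open>W\<close>; the transport tends to 0 and is dominated by a multiple of
  \<open>1 + W\<close>. \<open>\<Gamma>\<close> is an arbitrary selection of weak gradients, so that
  it can later be matched with \<open>weak_grad\<close>; measurability of its norm in time follows
  from the limit.\<close>

theorem energy_equality:
  shows "AE t in time. \<exists>G. wgrad (U t) G"
    and "AE t in time. wgrad (U t) (\<Gamma> t) \<Longrightarrow> integrable time (\<lambda>t. (n2 (\<Gamma> t))\<^sup>2)"
    and "AE t in time. wgrad (U t) (\<Gamma> t) \<Longrightarrow>
      (n2 (U b))\<^sup>2 + 2 * (LINT t|time. (n2 (\<Gamma> t))\<^sup>2) = (n2 (U a))\<^sup>2"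
proof -
  obtain \<phi> W where \<phi>: "filterlim \<phi> at_top sequentially" and W: "integrable time W"
    and ae: "AE t in time. (\<exists>G. wgrad (U t) G) \<and> (\<forall>n. dissipation (moll (\<phi> n)) t \<le> W t)"
    using gradient_subsequence by blast
  show "AE t in time. \<exists>G. wgrad (U t) G" using ae by eventually_elim blast
  have aeab: "AE t in time. t \<in> {a..b}" by (rule AE_I2) simp
  have D_int: "integrable time (dissipation (moll n))" and T_int: "integrable time (transport (moll n))" for n
    using time_integrable[OF dissipation_cont[OF test_function_moll moll_minus]]
      time_integrable[OF transport_cont[OF test_function_moll moll_minus]] by auto
  assume \<Gamma>: "AE t in time. wgrad (U t) (\<Gamma> t)"
  have D_lim: "AE t in time. (\<lambda>n. dissipation (moll (\<phi> n)) t) \<longlonglongrightarrow> (n2 (\<Gamma> t))\<^sup>2"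
    using \<Gamma> aeab
  proof eventually_elim
    case (elim t)
    from filterlim_compose[OF dissipation_tendsto_wgrad[OF elim(1) U_l2[OF elim(2)]] \<phi>]
    show ?case by (simp add: dissipation_def)
  qed
  have \<Gamma>m: "(\<lambda>t. (n2 (\<Gamma> t))\<^sup>2) \<in> borel_measurable time"
    by (rule borel_measurable_lebesgue_on_AE_limit[OF _ _ D_lim]) (use D_int in \<open>auto dest: borel_measurable_integrable\<close>)
  have D_bound: "AE t in time. norm (dissipation (moll (\<phi> n)) t) \<le> W t" for n
    using ae by eventually_elim (simp add: dissipation_nonneg)
  note Dm = borel_measurable_integrable[OF D_int]
  show "integrable time (\<lambda>t. (n2 (\<Gamma> t))\<^sup>2)"
    by (rule integrable_dominated_convergence[OF \<Gamma>m Dm W D_lim D_bound])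
  have D_conv: "(\<lambda>n. LINT t|time. dissipation (moll (\<phi> n)) t) \<longlonglongrightarrow> (LINT t|time. (n2 (\<Gamma> t))\<^sup>2)"
    by (rule integral_dominated_convergence[OF \<Gamma>m Dm W D_lim D_bound])
  define C where "C = (\<lambda>t. \<Sum>i\<in>UNIV. (2 * n2 (UU i t) + M * (2 * n2 (U t))))"
  have "continuous_on {a..b} C"
    unfolding C_def by (intro continuous_intros continuous_on_n2 UU_cont U_cont)
  then have "compact (C ` {a..b})" by (intro compact_continuous_image) auto
  then obtain C0 where "\<And>r. r \<in> {a..b} \<Longrightarrow> norm (C r) \<le> C0"
    by (metis bounded_iff compact_imp_bounded imageI)
  then have C0: "\<And>r. r \<in> {a..b} \<Longrightarrow> C r \<le> \<bar>C0\<bar>" by (metis abs_ge_self order_trans real_norm_def)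
  have T_conv: "(\<lambda>n. LINT t|time. transport (moll (\<phi> n)) t) \<longlonglongrightarrow> (LINT t|time. 0)"
  proof (rule integral_dominated_convergence)
    \<comment> \<open>\<open>transport_bound\<close> produces \<open>sqrt (W t)\<close>, which is at
      most \<open>1 + W t\<close>; the constant is integrable on the bounded time interval.\<close>
    show "integrable time (\<lambda>t. \<bar>C0\<bar> * (1 + W t))"
      using W time_integrable[OF continuous_on_const, of "1"] by simp
    show "AE t in time. norm (transport (moll (\<phi> n)) t) \<le> \<bar>C0\<bar> * (1 + W t)" for n
      using ae aeab
    proof eventually_elim
      case (elim t)
      have W0: "W t \<ge> 0" using elim(1) dissipation_nonneg order_trans by blast
      have "\<bar>transport (moll (\<phi> n)) t\<bar> \<le> (\<Sum>i\<in>UNIV. commutator (\<phi> n) i t) * sqrt (W t)"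
        by (rule transport_bound) (use elim in auto)
      also have "\<dots> \<le> \<bar>C0\<bar> * (1 + W t)"
      proof (rule mult_mono)
        have "(\<Sum>i\<in>UNIV. commutator (\<phi> n) i t) \<le> C t"
          unfolding C_def
        proof (rule sum_mono)
          fix i :: 3
          have "M * n2 (\<lambda>x. conv (moll (\<phi> n)) (U t) x - U t x) \<le> M * (2 * n2 (U t))"
            by (intro mult_left_mono conv_moll_error_bound U_l2 elim(2) M_nonneg)
          then show "commutator (\<phi> n) i t \<le> 2 * n2 (UU i t) + M * (2 * n2 (U t))"
            using commutator_le[OF elim(2), of "\<phi> n" i] conv_moll_error_bound[OF UU_l2[OF elim(2)], of "\<phi> n" i] by linarith
        qed
        then show "(\<Sum>i\<in>UNIV. commutator (\<phi> n) i t) \<le> \<bar>C0\<bar>" using C0[OF elim(2)] by linarith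
        have "sqrt (W t) \<le> sqrt ((1 + W t)\<^sup>2)"
          using W0 by (intro real_sqrt_le_mono) (simp add: power2_eq_square algebra_simps)
        then show "sqrt (W t) \<le> 1 + W t" using W0 by simp
      qed (use W0 in auto)
      finally show ?case by simp
    qed
    show "AE t in time. (\<lambda>n. transport (moll (\<phi> n)) t) \<longlonglongrightarrow> 0"
      using ae aeab
    proof eventually_elim
      case (elim t)
      note Ut = U_l2[OF elim(2)] and UUt = UU_l2[OF elim(2)]
      show ?case
      proof (rule Lim_null_comparison)
        show "\<forall>\<^sub>F n in sequentially. norm (transport (moll (\<phi> n)) t) \<le>
          (\<Sum>i\<in>UNIV. n2 (\<lambda>x. conv (moll (\<phi> n)) (UU i t) x - UU i t x) + M * n2 (\<lambda>x. conv (moll (\<phi> n)) (U t) x - U t x)) * sqrt (W t)"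
        proof (intro always_eventually allI)
          fix n
          have "W t \<ge> 0" using elim(1) dissipation_nonneg order_trans by blast
          then have "(\<Sum>i\<in>UNIV. commutator (\<phi> n) i t) * sqrt (W t) \<le>
            (\<Sum>i\<in>UNIV. n2 (\<lambda>x. conv (moll (\<phi> n)) (UU i t) x - UU i t x) + M * n2 (\<lambda>x. conv (moll (\<phi> n)) (U t) x - U t x)) * sqrt (W t)"
            by (intro mult_right_mono sum_mono commutator_le elim(2)) simp
          moreover have "\<bar>transport (moll (\<phi> n)) t\<bar> \<le> (\<Sum>i\<in>UNIV. commutator (\<phi> n) i t) * sqrt (W t)"
            by (rule transport_bound) (use elim in auto)
          ultimately show "norm (transport (moll (\<phi> n)) t) \<le>
            (\<Sum>i\<in>UNIV. n2 (\<lambda>x. conv (moll (\<phi> n)) (UU i t) x - UU i t x) + M * n2 (\<lambda>x. conv (moll (\<phi> n)) (U t) x - U t x)) * sqrt (W t)"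
            by simp
        qed
        have "(\<lambda>n. (\<Sum>i\<in>UNIV. n2 (\<lambda>x. conv (moll (\<phi> n)) (UU i t) x - UU i t x) + M * n2 (\<lambda>x. conv (moll (\<phi> n)) (U t) x - U t x)) * sqrt (W t))
          \<longlonglongrightarrow> (\<Sum>i\<in>(UNIV::3 set). 0 + M * 0) * sqrt (W t)"
          by (intro tendsto_intros filterlim_compose[OF conv_moll_l2_tendsto[OF Ut] \<phi>] filterlim_compose[OF conv_moll_l2_tendsto[OF UUt] \<phi>])
        then show "(\<lambda>n. (\<Sum>i\<in>UNIV. n2 (\<lambda>x. conv (moll (\<phi> n)) (UU i t) x - UU i t x) + M * n2 (\<lambda>x. conv (moll (\<phi> n)) (U t) x - U t x)) * sqrt (W t))
          \<longlonglongrightarrow> 0" by simp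
      qed
    qed
  qed (use T_int in \<open>auto dest: borel_measurable_integrable\<close>)
  have E_lim: "(\<lambda>n. (n2 (conv (moll (\<phi> n)) (U t)))\<^sup>2) \<longlonglongrightarrow> (n2 (U t))\<^sup>2" if "t \<in> {a..b}" for t
    by (intro tendsto_power n2_tendsto conv_moll_l2 U_l2 that filterlim_compose[OF conv_moll_l2_tendsto \<phi>])
  have "(\<lambda>n. 2 * (LINT t|time. transport (moll (\<phi> n)) t) - 2 * (LINT t|time. dissipation (moll (\<phi> n)) t))
      \<longlonglongrightarrow> 2 * (LINT t|time. 0) - 2 * (LINT t|time. (n2 (\<Gamma> t))\<^sup>2)"
    by (intro tendsto_intros T_conv D_conv)
  moreover have "(\<lambda>n. 2 * (LINT t|time. transport (moll (\<phi> n)) t) - 2 * (LINT t|time. dissipation (moll (\<phi> n)) t))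
      \<longlonglongrightarrow> (n2 (U b))\<^sup>2 - (n2 (U a))\<^sup>2"
    unfolding energy_balance_time[OF test_function_moll moll_minus]
    using ab by (intro tendsto_diff E_lim) auto
  ultimately have "2 * (LINT t|time. 0) - 2 * (LINT t|time. (n2 (\<Gamma> t))\<^sup>2) = (n2 (U b))\<^sup>2 - (n2 (U a))\<^sup>2"
    by (rule LIMSEQ_unique)
  then show "(n2 (U b))\<^sup>2 + 2 * (LINT t|time. (n2 (\<Gamma> t))\<^sup>2) = (n2 (U a))\<^sup>2" by simp
qed

end

section \<open>Borel representatives\<close>

text \<open>Covers the case without integrability too: both integrals are then 0 by convention, so
  integrals in the definitions can be rewritten before integrability has been discussed.\<close>

lemma lebesgue_integral_representative:
  fixes p :: "'a::euclidean_space \<Rightarrow> 'b::euclidean_space"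
  assumes q: "q \<in> borel_measurable borel" and eq: "AE x in lborel. p x = q x"
  shows "p \<in> borel_measurable lebesgue" and "(LINT x|lebesgue. p x) = (LINT x|lborel. q x)"
    and "integrable lebesgue p \<longleftrightarrow> integrable lborel q"
proof -
  have q': "q \<in> borel_measurable lebesgue" using q by (simp add: measurable_completion)
  have eq': "AE x in lebesgue. q x = p x" using AE_completion[OF eq] by eventually_elim simp
  show p: "p \<in> borel_measurable lebesgue" by (rule borel_measurable_AE[OF q' eq'])
  have "(LINT x|lebesgue. p x) = (LINT x|lebesgue. q x)"
    using eq' by (intro integral_cong_AE p q') auto
  also have "\<dots> = (LINT x|lborel. q x)" using q by (intro integral_completion) simp
  finally show "(LINT x|lebesgue. p x) = (LINT x|lborel. q x)" .
  have "integrable lebesgue p \<longleftrightarrow> integrable lebesgue q"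
    using eq' by (intro integrable_cong_AE p q') auto
  also have "\<dots> \<longleftrightarrow> integrable lborel q" using q by (intro integrable_completion) simp
  finally show "integrable lebesgue p \<longleftrightarrow> integrable lborel q" .
qed

lemma borel_representative:
  fixes f :: "'a::euclidean_space \<Rightarrow> 'b::euclidean_space"
  assumes f: "f \<in> borel_measurable lebesgue"
  obtains g where "g \<in> borel_measurable borel" "AE x in lborel. f x = g x"
proof -
  have "\<exists>g\<in>borel_measurable lborel. AE x in lborel. f x \<bullet> b = g x" for b
    by (rule completion_ex_borel_measurable_real) (use f in measurable)
  then obtain g where g: "\<And>b. g b \<in> borel_measurable lborel" "\<And>b. AE x in lborel. f x \<bullet> b = g b x"
    by metis
  show ?thesis
  proof (rule that)
    show "(\<lambda>x. \<Sum>b\<in>Basis. g b x *\<^sub>R b) \<in> borel_measurable borel" using g(1) by simp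
    have "AE x in lborel. \<forall>b\<in>Basis. f x \<bullet> b = g b x"
      using g(2) by (intro AE_finite_allI) auto
    then show "AE x in lborel. f x = (\<Sum>b\<in>Basis. g b x *\<^sub>R b)"
    proof eventually_elim
      case (elim x)
      then have "(\<Sum>b\<in>Basis. g b x *\<^sub>R b) = (\<Sum>b\<in>Basis. (f x \<bullet> b) *\<^sub>R b)" by simp
      then show ?case by (simp add: euclidean_representation)
    qed
  qed
qed

lemma in_L2_representative:
  assumes q: "q \<in> borel_measurable borel" and eq: "AE x in lborel. p x = q x"
  shows "in_L2 p \<longleftrightarrow> l2 q" and "L2_norm p = n2 q"
proof -
  have m: "(\<lambda>x. (norm (q x))\<^sup>2) \<in> borel_measurable borel" using q by measurable
  have e: "AE x in lborel. (norm (p x))\<^sup>2 = (norm (q x))\<^sup>2" using eq by eventually_elim simp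
  show "in_L2 p \<longleftrightarrow> l2 q"
    using lebesgue_integral_representative(1)[OF q eq] lebesgue_integral_representative(3)[OF m e] q
    by (simp add: in_L2_def l2_def)
  show "L2_norm p = n2 q"
    using lebesgue_integral_representative(2)[OF m e] by (simp add: L2_norm_def n2_def ip_self)
qed

lemma has_L2_gradient_representative:
  assumes q: "q \<in> borel_measurable borel" and eq: "AE x in lborel. p x = q x"
    and H: "H \<in> borel_measurable borel" and eqG: "AE x in lborel. G x = H x"
  shows "has_L2_gradient p G \<longleftrightarrow> wgrad q H"
proof -
  have nth [measurable]: "(\<lambda>v::('b::euclidean_space)^'n. v $ i) \<in> borel_measurable borel" for i
    by (intro borel_measurable_continuous_onI continuous_intros)
  note [measurable] = q H
  have "(LINT x|lebesgue. p x $ i * pd j g x) = ip (\<lambda>x. q x $ i) (pd j g)"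
    "(LINT x|lebesgue. G x $ i $ j * g x) = ip (\<lambda>x. H x $ i $ j) g"
    if g: "test_function UNIV g" for g i j
  proof -
    have [measurable]: "g \<in> borel_measurable borel" "pd j g \<in> borel_measurable borel"
      using g test_function_pd test_function_measurable by blast+
    have "AE x in lborel. p x $ i * pd j g x = q x $ i * pd j g x" using eq by eventually_elim simp
    from lebesgue_integral_representative(2)[OF _ this]
    show "(LINT x|lebesgue. p x $ i * pd j g x) = ip (\<lambda>x. q x $ i) (pd j g)" by (simp add: ip_def)
    have "AE x in lborel. G x $ i $ j * g x = H x $ i $ j * g x" using eqG by eventually_elim simp
    from lebesgue_integral_representative(2)[OF _ this]
    show "(LINT x|lebesgue. G x $ i $ j * g x) = ip (\<lambda>x. H x $ i $ j) g" by (simp add: ip_def)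
  qed
  then show ?thesis
    unfolding has_L2_gradient_def wgrad_def using in_L2_representative(1)[OF H eqG] by auto
qed

section \<open>Testing in time\<close>

text \<open>Test with the mollified indicator of \<open>{s..t}\<close>; its derivative is the mollifier centred at \<open>s\<close>
  minus the one centred at \<open>t\<close>.\<close>

lemma weak_derivative_imp_integral:
  fixes g h :: "real \<Rightarrow> real"
  assumes st: "a' < s" "s \<le> t" "t < b'"
    and g: "continuous_on {a'..b'} g" and h: "continuous_on {a'..b'} h"
    and weak: "\<And>\<theta> c d. smooth \<theta> \<Longrightarrow> a' < c \<Longrightarrow> d < b' \<Longrightarrow> (\<And>r. r \<notin> {c..d} \<Longrightarrow> \<theta> r = 0) \<Longrightarrow>
       integral {a'..b'} (\<lambda>r. frechet_derivative \<theta> (at r) 1 * g r + \<theta> r * h r) = 0"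
  shows "(h has_integral (g t - g s)) {s..t}"
proof -
  \<comment> \<open>The constant continuation is continuous and bounded on the whole line, so its
    mollifications converge at \<open>s\<close> and \<open>t\<close>; for \<open>h\<close> an
    extension by 0 is enough, as it is only paired in L2. For large \<open>n\<close> neither
    extension contributes outside \<open>{a'..b'}\<close>.\<close>
  define G where "G = (\<lambda>r. g (max a' (min b' r)))"
  define H where "H = (\<lambda>r. indicat_real {a'..b'} r *\<^sub>R h r)"
  have ab': "a' \<le> b'" using st by simp
  have Gc: "continuous_on UNIV G"
    unfolding G_def by (rule continuous_on_compose2[OF g]) (use ab' in \<open>auto intro!: continuous_intros\<close>)
  have "compact (g ` {a'..b'})" "compact (h ` {a'..b'})" using g h by (auto intro: compact_continuous_image)
  then obtain B C where B: "\<And>r. r \<in> {a'..b'} \<Longrightarrow> norm (g r) \<le> B" and C: "\<And>r. r \<in> {a'..b'} \<Longrightarrow> norm (h r) \<le> C"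
    by (metis bounded_iff compact_imp_bounded imageI)
  have Gl: "loc_int G"
    by (rule loc_int_bounded[OF borel_measurable_continuous_onI[OF Gc], of B]) (use B ab' in \<open>auto simp: G_def\<close>)
  have Hm: "H \<in> borel_measurable borel"
    unfolding H_def by (rule borel_measurable_continuous_on_indicator[OF _ h]) simp
  have Hl: "l2 H"
  proof (rule l2I_bound[OF Hm])
    show "integrable lborel (\<lambda>r. indicat_real {a'..b'} r *\<^sub>R C\<^sup>2)"
      by (rule borel_integrable_compact) auto
    show "(norm (H r))\<^sup>2 \<le> indicat_real {a'..b'} r *\<^sub>R C\<^sup>2" for r
      using power_mono[OF C[of r], of 2] by (simp add: H_def indicator_def)
  qed
  define I where "I = indicat_real {s..t}"
  have Il: "l2 I"
  proof -
    have "(\<lambda>r. (norm (I r))\<^sup>2) = I" by (auto simp: fun_eq_iff I_def indicator_def)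
    then show ?thesis
      unfolding l2_def using borel_integrable_compact[of "{s..t}" "\<lambda>_. 1::real"] by (simp add: I_def)
  qed
  define \<theta> where "\<theta> = (\<lambda>n. conv (moll n) I)"
  have \<theta>s: "smooth (\<theta> n)" for n unfolding \<theta>_def by (rule smooth_conv[OF test_function_moll loc_int_l2[OF Il]])
  \<comment> \<open>Half of this distance is the margin: mollifiers of radius below
    \<open>m / 2\<close> keep the test function supported in \<open>{s - m/2..t + m/2}\<close>,
    strictly inside the interval as \<open>weak\<close> demands.\<close>
  define m where "m = min (s - a') (b' - t)"
  have m: "m > 0" "m \<le> s - a'" "m \<le> b' - t" using st by (simp_all add: m_def)
  then have m': "a' < s - m / 2" "t + m / 2 < b'" by linarith+
  have \<theta>0: "\<theta> n r = 0" if n: "inverse (real (Suc n)) < m / 2" and r: "r \<notin> {s - m/2..t + m/2}" for n r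
  proof -
    have "(\<lambda>y. moll n (r - y) *\<^sub>R I y) = (\<lambda>y. 0)"
    proof
      fix y
      show "moll n (r - y) *\<^sub>R I y = 0"
      proof (cases "y \<in> {s..t}")
        case True
        then have "norm (r - y) \<ge> inverse (real (Suc n))" using r n by auto
        then show ?thesis by (simp add: moll_eq_0)
      qed (simp add: I_def)
    qed
    then show ?thesis by (simp only: \<theta>_def conv_def integral_zero)
  qed
  \<comment> \<open>Evenness lets the mollifiers be written in \<open>s - r\<close> and
    \<open>t - r\<close>, so that integrating against \<open>G\<close> gives
    \<open>conv (moll n) G\<close> at \<open>s\<close> and at \<open>t\<close>.\<close>
  have \<theta>': "frechet_derivative (\<theta> n) (at r) 1 = moll n (s - r) - moll n (t - r)" for n r
  proof -
    have sm: "smooth (moll n :: real \<Rightarrow> real)" by (rule test_function_smooth[OF test_function_moll])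
    have "has_bochner_integral lborel (\<lambda>y. indicat_real {s..t} y *\<^sub>R frechet_derivative (moll n) (at (r - y)) 1)
       (- moll n (r - t) - - moll n (r - s))"
    proof (rule has_bochner_integral_FTC_Icc[OF st(2)])
      fix y
      have lin: "linear (frechet_derivative (moll n) (at (r - y)))" by (rule smooth_linear_frechet[OF sm])
      have "((\<lambda>y. r - y) has_derivative (\<lambda>h. - h)) (at y)" by (auto intro!: derivative_eq_intros)
      from has_derivative_minus[OF has_derivative_compose[OF this smooth_has_derivative[OF sm]]]
      have "((\<lambda>y. - moll n (r - y)) has_derivative (\<lambda>h. frechet_derivative (moll n) (at (r - y)) h)) (at y)"
        by (simp add: linear_neg[OF lin])
      moreover have "frechet_derivative (moll n) (at (r - y)) h = h *\<^sub>R frechet_derivative (moll n) (at (r - y)) 1" for h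
        using linear_cmul[OF lin, of h 1] by (simp only: real_scaleR_def mult_1_right)
      ultimately show "((\<lambda>y. - moll n (r - y)) has_vector_derivative frechet_derivative (moll n) (at (r - y)) 1) (at y within {s..t})"
        unfolding has_vector_derivative_def by (metis (no_types, lifting) ext has_derivative_at_withinI)
    next
      show "continuous_on {s..t} (\<lambda>y. frechet_derivative (moll n) (at (r - y)) 1)"
        by (rule continuous_on_compose2[OF smooth_continuous[OF smooth_frechet_derivative[OF sm]]]) (auto intro!: continuous_intros)
    qed
    then have "(LINT y|lborel. indicat_real {s..t} y *\<^sub>R frechet_derivative (moll n) (at (r - y)) 1) = moll n (r - s) - moll n (r - t)"
      by (simp add: has_bochner_integral_iff)
    then show ?thesis
      unfolding \<theta>_def frechet_derivative_conv[OF test_function_moll loc_int_l2[OF Il]]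
      using moll_minus[of n "s - r"] moll_minus[of n "t - r"]
      by (simp add: conv_def I_def mult.commute)
  qed
  have eq: "(conv (moll n) G s - conv (moll n) G t) + ip (\<theta> n) H = 0" if n: "inverse (real (Suc n)) < m / 2" for n
  proof -
    define K where "K = (\<lambda>r. frechet_derivative (\<theta> n) (at r) 1 * g r + \<theta> n r * h r)"
    have "integral {a'..b'} K = 0"
      unfolding K_def by (rule weak[OF \<theta>s m']) (rule \<theta>0[OF n])
    moreover have Kc: "continuous_on {a'..b'} K"
      unfolding K_def
      by (intro continuous_intros g h continuous_on_subset[OF smooth_continuous[OF smooth_frechet_derivative[OF \<theta>s]]]
          continuous_on_subset[OF smooth_continuous[OF \<theta>s]]) auto
    ultimately have "(LINT r|lborel. indicat_real {a'..b'} r *\<^sub>R K r) = 0"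
      using set_borel_integral_eq_integral(2)[OF borel_integrable_atLeastAtMost'[OF Kc]]
      unfolding set_lebesgue_integral_def by simp
    moreover have K_eq: "indicat_real {a'..b'} r *\<^sub>R K r = (moll n (s - r) *\<^sub>R G r - moll n (t - r) *\<^sub>R G r) + \<theta> n r * H r" for r
    proof (cases "r \<in> {a'..b'}")
      case True
      then show ?thesis by (simp add: K_def \<theta>' G_def H_def algebra_simps)
    next
      case False
      then have "inverse (real (Suc n)) \<le> norm (s - r)" "inverse (real (Suc n)) \<le> norm (t - r)"
        using n m st by auto
      then show ?thesis using False by (simp add: moll_eq_0 H_def)
    qed
    ultimately have "(LINT r|lborel. (moll n (s - r) *\<^sub>R G r - moll n (t - r) *\<^sub>R G r) + \<theta> n r * H r) = 0" unfolding K_eq by simp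
    moreover have i: "integrable lborel (\<lambda>r. moll n (y - r) *\<^sub>R G r)" for y
      by (rule conv_integrable[OF test_function_moll Gl])
    moreover have "integrable lborel (\<lambda>r. \<theta> n r * H r)"
      using l2_inner_integrable[OF conv_Young(1)[OF test_function_moll Il] Hl] by (simp add: \<theta>_def)
    ultimately show ?thesis by (simp add: conv_def ip_def)
  qed
  have "\<forall>\<^sub>F n in sequentially. inverse (real (Suc n)) < m / 2"
    by (rule order_tendstoD(2)[OF LIMSEQ_inverse_real_of_nat]) (use m in simp)
  then have ev: "\<forall>\<^sub>F n in sequentially. (conv (moll n) G s - conv (moll n) G t) + ip (\<theta> n) H = 0"
    by eventually_elim (rule eq)
  have "(\<lambda>n. (conv (moll n) G s - conv (moll n) G t) + ip (\<theta> n) H) \<longlonglongrightarrow> (G s - G t) + ip I H"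
  proof (intro tendsto_intros conv_moll_tendsto Gc Gl)
    show "(\<lambda>n. ip (\<theta> n) H) \<longlonglongrightarrow> ip I H"
      unfolding \<theta>_def
      by (rule ip_tendsto) (use conv_moll_l2_tendsto[OF Il] Il Hl in \<open>auto simp: n2_def[of "\<lambda>x. 0"] ip_def[of "\<lambda>x. 0"] intro: conv_Young(1) test_function_moll\<close>)
  qed
  from LIMSEQ_unique[OF this tendsto_eventually[OF ev]] have "(G s - G t) + ip I H = 0" .
  moreover have "G s = g s" "G t = g t" using st by (auto simp: G_def)
  moreover have hc: "continuous_on {s..t} h" by (rule continuous_on_subset[OF h]) (use st in auto)
  have "ip I H = integral {s..t} h"
  proof -
    have "ip I H = (LINT r|lborel. indicat_real {s..t} r *\<^sub>R h r)"
      unfolding ip_def by (rule Bochner_Integration.integral_cong) (use st in \<open>auto simp: I_def H_def indicator_def\<close>)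
    then show ?thesis
      using set_borel_integral_eq_integral(2)[OF borel_integrable_atLeastAtMost'[OF hc]]
      unfolding set_lebesgue_integral_def by simp
  qed
  ultimately have "integral {s..t} h = g t - g s" by simp
  then show ?thesis using integrable_integral[OF integrable_continuous_real[OF hc]] by simp
qed

lemma pd_scaleR: "smooth w \<Longrightarrow> pd i (\<lambda>y. c *\<^sub>R w y) = (\<lambda>y. c *\<^sub>R pd i w y)"
  unfolding pd_def
  by (intro ext, subst frechet_derivative_eq[OF has_derivative_scaleR_right[OF smooth_has_derivative]]) auto

lemma smooth_pd: "smooth w \<Longrightarrow> smooth (pd i w)"
  unfolding pd_def[abs_def] by (rule smooth_frechet_derivative)

lemma laplacian_scaleR: "smooth w \<Longrightarrow> laplacian (\<lambda>y. c *\<^sub>R w y) x = c *\<^sub>R laplacian w x"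
  by (simp add: laplacian_def pd_scaleR smooth_pd scaleR_sum_right)

lemma divergence_scaleR: "smooth w \<Longrightarrow> divergence (\<lambda>y. c *\<^sub>R w y) x = c * divergence w x"
  by (simp add: divergence_def pd_scaleR sum_distrib_left)

lemma convect_scaleR: "smooth w \<Longrightarrow> convect v (\<lambda>y. c *\<^sub>R w y) x = c *\<^sub>R convect v w x"
  by (simp add: convect_def pd_scaleR scaleR_sum_right mult.commute)

lemma test_function_product:
  fixes w :: "real^3 \<Rightarrow> real^3" and \<theta> :: "real \<Rightarrow> real"
  assumes w: "test_function UNIV w" and \<theta>: "smooth \<theta>" "\<And>r. r \<notin> {c..d} \<Longrightarrow> \<theta> r = 0" and cd: "0 < c" "d < T"
  shows "test_function (UNIV \<times> {0<..<T}) (\<lambda>p. \<theta> (snd p) *\<^sub>R w (fst p))"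
proof -
  let ?f = "\<lambda>p. \<theta> (snd p) *\<^sub>R w (fst p)"
  have "smooth (\<lambda>p::(real^3) \<times> real. \<theta> (0 + snd p))" "smooth (\<lambda>p::(real^3) \<times> real. w (0 + fst p))"
    by (rule smooth_affine[OF bounded_linear_snd \<theta>(1)], rule smooth_affine[OF bounded_linear_fst test_function_smooth[OF w]])
  then have "smooth ?f" by (intro smooth_scaleR) simp_all
  moreover obtain R where R: "\<And>x. norm x > R \<Longrightarrow> w x = 0" using test_function_supportE[OF w] by metis
  have sub: "{p. ?f p \<noteq> 0} \<subseteq> cball 0 R \<times> {c..d}"
    using R \<theta>(2) by (auto simp: mem_Times_iff) (meson not_le, meson atLeastAtMost_iff, meson atLeastAtMost_iff)
  have cl: "closure {p. ?f p \<noteq> 0} \<subseteq> cball 0 R \<times> {c..d}"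
    by (rule closure_minimal[OF sub]) (intro closed_Times closed_cball closed_atLeastAtMost)
  have "compact (cball (0::real^3) R \<times> {c..d})" by (intro compact_Times) auto
  then have "compact (closure {p. ?f p \<noteq> 0})"     using compact_Int_closed[OF _ closed_closure, of "cball 0 R \<times> {c..d}" "{p. ?f p \<noteq> 0}"] cl
    by (simp add: Int_absorb1)
  moreover have "cball (0::real^3) R \<times> {c..d} \<subseteq> UNIV \<times> {0<..<T}" using cd by auto
  with cl have "closure {p. ?f p \<noteq> 0} \<subseteq> UNIV \<times> {0<..<T}" by (rule order_trans)
  ultimately show ?thesis by (simp add: test_function_def smooth_def)
qed

section \<open>Strong solutions\<close>

text \<open>Continuity in the supremum norm bounds \<open>u\<close> near each time by its norm there
  plus 1, and compactness of \<open>{a..b}\<close> leaves finitely many such bounds. The pairs in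
  \<open>Q\<close> hold the radius of a neighbourhood and the bound valid on it.\<close>

lemma continuous_in_Linf_bounded:
  fixes u :: "real \<Rightarrow> real^3 \<Rightarrow> real^3"
  assumes u: "continuous_in_Linf {0<..<T} u" and ab: "{a..b} \<subseteq> {0<..<T}"
  obtains M where "M \<ge> 0" "\<And>t. t \<in> {a..b} \<Longrightarrow> AE x in lebesgue. norm (u t x) \<le> M"
proof -
  define Q where "Q = (\<lambda>t p. fst p > 0 \<and> (\<forall>s\<in>{0<..<T}. dist s t < fst p \<longrightarrow> (AE x in lebesgue. norm (u s x) \<le> snd p)))"
  have loc: "\<exists>p. Q t p" if t: "t \<in> {a..b}" for t
  proof -
    have tI: "t \<in> {0<..<T}" using t ab by auto
    have fin: "Linf_norm (u t) < \<infinity>" and lim: "((\<lambda>s. Linf_norm (\<lambda>x. u s x - u t x)) \<longlongrightarrow> 0) (at t within {0<..<T})"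
      using u tI unfolding continuous_in_Linf_def in_Linf_def by blast+
    define c where "c = enn2real (Linf_norm (u t))"
    have c: "Linf_norm (u t) = ennreal c" "c \<ge> 0" using fin by (simp_all add: c_def)
    have ct: "AE x in lebesgue. norm (u t x) \<le> c"
      using esssup_AE[of "\<lambda>x. ennreal (norm (u t x))" lebesgue]
      by eventually_elim (use c in \<open>simp add: Linf_norm_def\<close>)
    have "\<forall>\<^sub>F s in at t within {0<..<T}. Linf_norm (\<lambda>x. u s x - u t x) < 1"
      by (rule order_tendstoD(2)[OF lim]) simp
    then obtain e where e: "e > 0" "\<And>s. s \<in> {0<..<T} \<Longrightarrow> s \<noteq> t \<Longrightarrow> dist s t < e \<Longrightarrow> Linf_norm (\<lambda>x. u s x - u t x) < 1"
      unfolding eventually_at by blast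
    have "AE x in lebesgue. norm (u s x) \<le> c + 1" if s: "s \<in> {0<..<T}" "dist s t < e" for s
    proof (cases "s = t")
      case True
      show ?thesis unfolding True using ct by eventually_elim simp
    next
      case False
      have "AE x in lebesgue. ennreal (norm (u s x - u t x)) \<le> Linf_norm (\<lambda>x. u s x - u t x)"
        unfolding Linf_norm_def by (rule esssup_AE)
      then show ?thesis using ct
      proof eventually_elim
        case (elim x)
        have "ennreal (norm (u s x - u t x)) < 1" by (rule le_less_trans[OF elim(1) e(2)[OF s(1) False s(2)]])
        then have "norm (u s x - u t x) < 1" using ennreal_less_iff[of "norm (u s x - u t x)" 1] by simp
        then show ?case using elim(2) norm_triangle_ineq2[of "u s x" "u t x"] by linarith
      qed
    qed
    then show ?thesis using e(1) by (intro exI[of _ "(e, c + 1)"]) (simp add: Q_def)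
  qed
  obtain q where q: "\<forall>t\<in>{a..b}. Q t (q t)"
    using bchoice[of "{a..b}" Q] loc by blast
  define e m where "e = (\<lambda>t. fst (q t))" and "m = (\<lambda>t. snd (q t))"
  have em: "\<And>t. t \<in> {a..b} \<Longrightarrow> e t > 0"
    "\<And>t s. t \<in> {a..b} \<Longrightarrow> s \<in> {0<..<T} \<Longrightarrow> dist s t < e t \<Longrightarrow> (AE x in lebesgue. norm (u s x) \<le> m t)"
    using q unfolding e_def m_def Q_def by blast+
  have "{a..b} \<subseteq> (\<Union>t\<in>{a..b}. ball t (e t))" using em(1) by force
  then obtain C where C: "C \<subseteq> {a..b}" "finite C" "{a..b} \<subseteq> (\<Union>t\<in>C. ball t (e t))"
    using compactE_image[of "{a..b}" "{a..b}" "\<lambda>t. ball t (e t)"] by auto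
  define M where "M = Max (insert 0 (m ` C))"
  have M: "M \<ge> 0" "\<And>t. t \<in> C \<Longrightarrow> m t \<le> M" using C(2) by (auto simp: M_def)
  have "AE x in lebesgue. norm (u s x) \<le> M" if s: "s \<in> {a..b}" for s
  proof -
    obtain t where t: "t \<in> C" "dist s t < e t" using C(3) s by (auto simp: dist_commute)
    have "AE x in lebesgue. norm (u s x) \<le> m t" by (rule em(2)) (use t s C ab in auto)
    then show ?thesis by eventually_elim (use M(2)[OF t(1)] in linarith)
  qed
  with M(1) show ?thesis by (rule that)
qed

text \<open>A Borel version is set to 0 where it exceeds \<open>M\<close>, a null set; the essential
  bound thereby becomes the pointwise one required by \<open>bounded_curve\<close>.\<close>

lemma bounded_representative:
  fixes f :: "'a::euclidean_space \<Rightarrow> 'b::euclidean_space"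
  assumes f: "f \<in> borel_measurable lebesgue" and M: "M \<ge> 0" "AE x in lebesgue. norm (f x) \<le> M"
  shows "\<exists>g. g \<in> borel_measurable borel \<and> (\<forall>x. norm (g x) \<le> M) \<and> (AE x in lborel. f x = g x)"
proof -
  obtain g where [measurable]: "g \<in> borel_measurable borel" and g: "AE x in lborel. f x = g x"
    using borel_representative[OF f] by blast
  have "AE x in lborel. norm (f x) \<le> M" using M(2) by (simp add: AE_completion_iff)
  with g have "AE x in lborel. f x = (if norm (g x) \<le> M then g x else 0)" by eventually_elim auto
  then show ?thesis using M(1) by (intro exI[of _ "\<lambda>x. if norm (g x) \<le> M then g x else 0"]) auto
qed

lemma l2_continuous_on_subset: "l2_continuous_on S F \<Longrightarrow> S' \<subseteq> S \<Longrightarrow> l2_continuous_on S' F"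
  unfolding l2_continuous_on_def by (meson subset_iff)

lemma time_integral_eq:
  fixes K :: "real \<Rightarrow> real"
  assumes K: "continuous_on {a..b} K" and ab: "{a..b} \<subseteq> S"
    and A: "\<And>t. t \<in> S \<Longrightarrow> A t = (if t \<in> {a..b} then K t else 0)"
  shows "(LINT t:S|lebesgue. A t) = integral {a..b} K"
proof -
  have "(\<lambda>t. indicat_real S t *\<^sub>R A t) = (\<lambda>t. indicat_real {a..b} t *\<^sub>R K t)"
    using ab A by (auto simp: fun_eq_iff indicator_def)
  then have "(LINT t:S|lebesgue. A t) = (LINT t:{a..b}|lebesgue. K t)"
    by (simp add: set_lebesgue_integral_def)
  also have "\<dots> = integral {a..b} K"
    by (rule set_lebesgue_integral_eq_integral(2)[OF absolutely_integrable_continuous_real[OF K]])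
  finally show ?thesis .
qed

section \<open>From the space-time equation to the equation integrated over a time interval\<close>

context bounded_curve
begin

lemma ip_convect:
  assumes t: "t \<in> {a..b}" and w: "test_function UNIV w"
  shows "ip (U t) (convect (U t) w) = (\<Sum>i\<in>UNIV. ip (UU i t) (pd i w))"
    and "integrable lborel (\<lambda>x. U t x \<bullet> convect (U t) w x)"
    and "convect (U t) w \<in> borel_measurable borel"
proof -
  have eq: "U t x \<bullet> convect (U t) w x = (\<Sum>i\<in>UNIV. UU i t x \<bullet> pd i w x)" for x
    by (simp add: convect_def UU_def inner_sum_right)
  have i: "integrable lborel (\<lambda>x. UU i t x \<bullet> pd i w x)" for i
    by (intro l2_inner_integrable UU_l2 t test_function_l2 test_function_pd w)
  show "ip (U t) (convect (U t) w) = (\<Sum>i\<in>UNIV. ip (UU i t) (pd i w))" "integrable lborel (\<lambda>x. U t x \<bullet> convect (U t) w x)"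
    unfolding ip_def eq using i by auto
  have [measurable]: "pd i w \<in> borel_measurable borel" for i by (intro test_function_measurable test_function_pd w)
  have [measurable]: "(\<lambda>x. U t x $ i) \<in> borel_measurable borel" for i
    by (rule measurable_compose[OF U_measurable[OF t]], intro borel_measurable_continuous_onI continuous_intros)
  show "convect (U t) w \<in> borel_measurable borel" unfolding convect_def[abs_def] by measurable
qed

lemma convect_cont:
  assumes w: "test_function UNIV w"
  shows "continuous_on {a..b} (\<lambda>t. ip (U t) (convect (U t) w))"
proof -
  have "continuous_on {a..b} (\<lambda>t. \<Sum>i\<in>UNIV. ip (UU i t) (pd i w))"
    by (intro continuous_intros continuous_on_ip UU_cont l2_continuous_on_const test_function_l2 test_function_pd w)
  then show ?thesis by (rule continuous_on_eq) (use ip_convect(1)[OF _ w] in auto)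
qed

end

lemma test_function_laplacian_l2:
  fixes w :: "real^3 \<Rightarrow> real^3"
  shows "test_function UNIV w \<Longrightarrow> l2 (laplacian w)"
  unfolding laplacian_def[abs_def] by (intro l2_sum test_function_l2 test_function_pd)

text \<open>The pressure disappears because the spatial test field is divergence free.\<close>

lemma strong_solution_weak_form:
  assumes sol: "strong_solution T u" and curve: "bounded_curve U a b M" and sub: "{a..b} \<subseteq> {0<..<T}"
    and rep: "\<And>t. t \<in> {a..b} \<Longrightarrow> AE x in lborel. u t x = U t x"
    and w: "test_function UNIV w" "\<And>x. divergence w x = 0"
    and \<theta>: "smooth \<theta>" "\<And>r. r \<notin> {c..d} \<Longrightarrow> \<theta> r = 0" and cd: "a < c" "d < b"
  shows "integral {a..b} (\<lambda>r. frechet_derivative \<theta> (at r) 1 * ip (U r) w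
     + \<theta> r * (ip (U r) (laplacian w) + ip (U r) (convect (U r) w))) = 0"
proof -
  interpret bounded_curve U a b M by (rule curve)
  have sw: "smooth w" by (rule test_function_smooth[OF w(1)])
  define \<theta>' where "\<theta>' = (\<lambda>r. frechet_derivative \<theta> (at r) 1)"
  have ab0: "0 < a" "b < T" using sub bounded_curve.ab[OF curve] by auto
  define f where "f = (\<lambda>p. \<theta> (snd p) *\<^sub>R w (fst p))"
  have f: "test_function (UNIV \<times> {0<..<T}) f"
    unfolding f_def by (rule test_function_product[OF w(1) \<theta>]) (use cd ab0 in auto)
  have der: "(\<theta> has_vector_derivative \<theta>' r) (at r)" for r
  proof -
    have lin: "linear (frechet_derivative \<theta> (at r))" by (rule smooth_linear_frechet[OF \<theta>(1)])
    have "frechet_derivative \<theta> (at r) h = h *\<^sub>R \<theta>' r" for h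
      using linear_cmul[OF lin, of h 1] unfolding \<theta>'_def by (simp only: real_scaleR_def mult_1_right)
    then have "frechet_derivative \<theta> (at r) = (\<lambda>h. h *\<^sub>R \<theta>' r)" by blast
    then show ?thesis using smooth_has_derivative[OF \<theta>(1), of r] by (simp add: has_vector_derivative_def)
  qed
  have \<theta>'0: "\<theta>' r = 0" if "r \<notin> {c..d}" for r
  proof -
    have "(\<theta> has_vector_derivative 0) (at r)"
      by (rule has_vector_derivative_transform_within_open[OF has_vector_derivative_const, where S = "- {c..d}"])
        (use that \<theta>(2) in auto)
    then show ?thesis using der vector_derivative_unique_at by blast
  qed
  have vd: "vector_derivative (\<lambda>s. f (x, s)) (at t) = \<theta>' t *\<^sub>R w x" for x t
    unfolding f_def fst_conv snd_conv
    using has_vector_derivative_scaleR[OF der[unfolded has_real_derivative_iff_has_vector_derivative[symmetric]] has_vector_derivative_const[of "w x"]]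
    by (intro vector_derivative_at) simp
  have lap: "laplacian (\<lambda>y. f (y, t)) x = \<theta> t *\<^sub>R laplacian w x"
    and dv: "divergence (\<lambda>y. f (y, t)) x = 0"
    and cvt: "convect v (\<lambda>y. f (y, t)) x = \<theta> t *\<^sub>R convect v w x" for t x v
    unfolding f_def fst_conv snd_conv by (simp_all add: laplacian_scaleR divergence_scaleR convect_scaleR sw w(2))
  obtain p where "(LINT t:{0<..<T}|lebesgue. LINT x|lebesgue.
              u t x \<bullet> (vector_derivative (\<lambda>s. f (x, s)) (at t) + laplacian (\<lambda>y. f (y, t)) x)
              + p (x, t) * divergence (\<lambda>y. f (y, t)) x)
           = - (LINT t:{0<..<T}|lebesgue. LINT x|lebesgue.
              u t x \<bullet> convect (u t) (\<lambda>y. f (y, t)) x)"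
    using sol f unfolding strong_solution_def by blast
  then have main: "(LINT t:{0<..<T}|lebesgue. LINT x|lebesgue. u t x \<bullet> (\<theta>' t *\<^sub>R w x + \<theta> t *\<^sub>R laplacian w x))
           = - (LINT t:{0<..<T}|lebesgue. LINT x|lebesgue. u t x \<bullet> (\<theta> t *\<^sub>R convect (u t) w x))"
    unfolding vd lap dv cvt by simp
  define K1 where "K1 = (\<lambda>r. \<theta>' r * ip (U r) w + \<theta> r * ip (U r) (laplacian w))"
  define K2 where "K2 = (\<lambda>r. \<theta> r * ip (U r) (convect (U r) w))"
  have lw: "l2 w" "l2 (laplacian w)" using w(1) by (auto intro: test_function_l2 test_function_laplacian_l2)
  have c\<theta>: "continuous_on {a..b} \<theta>" "continuous_on {a..b} \<theta>'"
    unfolding \<theta>'_def using smooth_continuous[OF \<theta>(1)] smooth_continuous[OF smooth_frechet_derivative[OF \<theta>(1)]]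
    by (auto intro: continuous_on_subset)
  have cK: "continuous_on {a..b} K1" "continuous_on {a..b} K2"
    unfolding K1_def K2_def
    by (intro continuous_intros c\<theta> continuous_on_ip U_cont l2_continuous_on_const lw convect_cont w)+
  have "(LINT t:{0<..<T}|lebesgue. LINT x|lebesgue. u t x \<bullet> (\<theta>' t *\<^sub>R w x + \<theta> t *\<^sub>R laplacian w x)) = integral {a..b} K1"
  proof (rule time_integral_eq[OF cK(1) sub])
    fix t assume "t \<in> {0<..<T}"
    show "(LINT x|lebesgue. u t x \<bullet> (\<theta>' t *\<^sub>R w x + \<theta> t *\<^sub>R laplacian w x)) = (if t \<in> {a..b} then K1 t else 0)"
    proof (cases "t \<in> {a..b}")
      case True
      note [measurable] = U_measurable[OF True] l2_measurable[OF lw(1)] l2_measurable[OF lw(2)]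
      have "AE x in lborel. u t x \<bullet> (\<theta>' t *\<^sub>R w x + \<theta> t *\<^sub>R laplacian w x)
          = \<theta>' t * (U t x \<bullet> w x) + \<theta> t * (U t x \<bullet> laplacian w x)"
        using rep[OF True] by eventually_elim (simp add: inner_add_right)
      from lebesgue_integral_representative(2)[OF _ this] True show ?thesis
        using l2_inner_integrable[OF U_l2[OF True]] lw by (simp add: K1_def ip_def)
    next
      case False
      \<comment> \<open>No representative is chosen outside \<open>{a..b}\<close>; there the
        integrand vanishes because \<open>\<theta>\<close> and its derivative do.\<close>
      then have "t \<notin> {c..d}" using cd by auto
      then have "\<theta> t = 0" "\<theta>' t = 0" using \<theta>(2) \<theta>'0 by blast+
      then show ?thesis using False by (simp del: atLeastAtMost_iff)
    qed
  qed
  moreover have "(LINT t:{0<..<T}|lebesgue. LINT x|lebesgue. u t x \<bullet> (\<theta> t *\<^sub>R convect (u t) w x)) = integral {a..b} K2"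
  proof (rule time_integral_eq[OF cK(2) sub])
    fix t assume "t \<in> {0<..<T}"
    show "(LINT x|lebesgue. u t x \<bullet> (\<theta> t *\<^sub>R convect (u t) w x)) = (if t \<in> {a..b} then K2 t else 0)"
    proof (cases "t \<in> {a..b}")
      case True
      note [measurable] = U_measurable[OF True] ip_convect(3)[OF True w(1)]
      have "AE x in lborel. u t x \<bullet> (\<theta> t *\<^sub>R convect (u t) w x) = \<theta> t * (U t x \<bullet> convect (U t) w x)"
        using rep[OF True] by eventually_elim (simp add: convect_def)
      from lebesgue_integral_representative(2)[OF _ this] True show ?thesis
        using ip_convect(2)[OF True w(1)] by (simp add: K2_def ip_def)
    next
      case False
      then have "t \<notin> {c..d}" using cd by auto
      then have "\<theta> t = 0" using \<theta>(2) by blast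
      then show ?thesis using False by (simp del: atLeastAtMost_iff)
    qed
  qed
  ultimately have "integral {a..b} K1 + integral {a..b} K2 = 0" using main by simp
  then have "integral {a..b} (\<lambda>r. K1 r + K2 r) = 0"
    using cK by (subst integral_add) (auto intro: integrable_continuous_real)
  then show ?thesis by (simp add: K1_def K2_def \<theta>'_def algebra_simps)
qed

text \<open>Versions are picked for each time separately. This is harmless, since the locale speaks
  of \<open>U t\<close> at fixed times and of scalar products that depend on the L2 class and vary
  continuously with time.\<close>

lemma strong_solution_representative:
  assumes sol: "strong_solution T u" and ab: "a \<in> {0<..<T}" "b \<in> {0<..<T}" "a \<le> b"
  shows "\<exists>U M. ns_interval U a b M \<and> (\<forall>t\<in>{a..b}. AE x in lborel. u t x = U t x)"
proof -
  \<comment> \<open>A strictly larger compact interval: testing in time requires the end points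
    \<open>a\<close> and \<open>b\<close> to be interior, so bound and representatives are
    constructed on \<open>{a'..b'}\<close>.\<close>
  define a' b' where "a' = a / 2" and "b' = (b + T) / 2"
  have ab': "a' < a" "b < b'" "a' \<le> b'" and sub: "{a'..b'} \<subseteq> {0<..<T}"
    using ab by (auto simp: a'_def b'_def)
  have uL2: "continuous_in_L2 {0<..<T} u" and uLinf: "continuous_in_Linf {0<..<T} u"
    and udiv: "\<And>t. t \<in> {0<..<T} \<Longrightarrow> weakly_div_free (u t)"
    using sol unfolding strong_solution_def by blast+
  obtain M where M: "M \<ge> 0" "\<And>t. t \<in> {a'..b'} \<Longrightarrow> AE x in lebesgue. norm (u t x) \<le> M"
    using continuous_in_Linf_bounded[OF uLinf sub] by blast
  define Q where "Q = (\<lambda>t g. g \<in> borel_measurable borel \<and> (\<forall>x. norm (g x) \<le> M) \<and> (AE x in lborel. u t x = g x))"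
  have "\<exists>g. Q t g" if "t \<in> {a'..b'}" for t
    unfolding Q_def
    by (rule bounded_representative[OF _ M(1) M(2)[OF that]]) (use uL2 that sub in \<open>auto simp: continuous_in_L2_def in_L2_def\<close>)
  then obtain U where "\<forall>t\<in>{a'..b'}. Q t (U t)"
    using bchoice[of "{a'..b'}" Q] by blast
  then have U: "\<And>t. t \<in> {a'..b'} \<Longrightarrow> U t \<in> borel_measurable borel"
    "\<And>t x. t \<in> {a'..b'} \<Longrightarrow> norm (U t x) \<le> M" "\<And>t. t \<in> {a'..b'} \<Longrightarrow> AE x in lborel. u t x = U t x"
    unfolding Q_def by blast+
  have Ul: "l2 (U t)" if "t \<in> {a'..b'}" for t
    using in_L2_representative(1)[OF U(1)[OF that] U(3)[OF that]] uL2 that sub by (auto simp: continuous_in_L2_def)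
  have diff: "L2_norm (\<lambda>x. u s x - u t x) = n2 (\<lambda>x. U s x - U t x)" if st: "s \<in> {a'..b'}" "t \<in> {a'..b'}" for s t
  proof (rule in_L2_representative(2))
    show "(\<lambda>x. U s x - U t x) \<in> borel_measurable borel" using U(1) st by simp
    show "AE x in lborel. u s x - u t x = U s x - U t x" using U(3)[OF st(1)] U(3)[OF st(2)] by eventually_elim simp
  qed
  have cont: "l2_continuous_on {a'..b'} U"
    unfolding l2_continuous_on_def
  proof (intro conjI ballI allI impI Ul)
    fix X t assume t: "t \<in> {a'..b'}" "\<forall>n::nat. X n \<in> {a'..b'}" "X \<longlonglongrightarrow> t"
    have "((\<lambda>s. L2_norm (\<lambda>x. u s x - u t x)) \<longlongrightarrow> L2_norm (\<lambda>x. u t x - u t x)) (at t within {0<..<T})"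
      using uL2 t sub by (auto simp: continuous_in_L2_def L2_norm_def)
    then have "continuous (at t within {0<..<T}) (\<lambda>s. L2_norm (\<lambda>x. u s x - u t x))"
      by (simp add: continuous_within)
    moreover have "\<forall>n. X n \<in> {0<..<T}" using t sub by blast
    ultimately have "((\<lambda>s. L2_norm (\<lambda>x. u s x - u t x)) \<circ> X) \<longlonglongrightarrow> L2_norm (\<lambda>x. u t x - u t x)"
      using t(3) unfolding continuous_within_sequentially by blast
    then have "(\<lambda>n. L2_norm (\<lambda>x. u (X n) x - u t x)) \<longlonglongrightarrow> L2_norm (\<lambda>x. u t x - u t x)"
      by (simp only: o_def)
    then show "(\<lambda>n. n2 (\<lambda>x. U (X n) x - U t x)) \<longlonglongrightarrow> 0"
      using diff t by (simp add: L2_norm_def)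
  qed
  have curve: "bounded_curve U a' b' M"
    by unfold_locales (use ab' cont U in auto)
  have "ns_interval U a b M"
  proof unfold_locales
    show "a \<le> b" by fact
    show "l2_continuous_on {a..b} U" by (rule l2_continuous_on_subset[OF cont]) (use ab' in auto)
    show "norm (U t x) \<le> M" if "t \<in> {a..b}" for t x using U(2) that ab' by auto
  next
    fix t and g :: "real^3 \<Rightarrow> real" assume t: "t \<in> {a..b}" and g: "test_function UNIV g"
    then have t': "t \<in> {a'..b'}" using ab' by auto
    have sg: "smooth g" by (rule test_function_smooth[OF g])
    have [measurable]: "grad g \<in> borel_measurable borel"
      unfolding grad_def[abs_def] by (intro borel_measurable_continuous_onI continuous_on_vec_lambda continuous_pd sg)
    note [measurable] = U(1)[OF t']
    have "AE x in lborel. u t x \<bullet> grad g x = U t x \<bullet> grad g x" using U(3)[OF t'] by eventually_elim simp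
    from lebesgue_integral_representative(2)[OF _ this]
    have "(LINT x|lebesgue. u t x \<bullet> grad g x) = (LINT x|lborel. U t x \<bullet> grad g x)" by simp
    moreover have "t \<in> {0<..<T}" using t' sub by auto
    then have "(LINT x|lebesgue. u t x \<bullet> grad g x) = 0" using udiv g unfolding weakly_div_free_def by blast
    ultimately show "(LINT x|lborel. frechet_derivative g (at x) (U t x)) = 0"
      by (simp add: frechet_derivative_eq_grad sg)
  next
    fix w s t assume w: "test_function UNIV w" "\<And>x. divergence w x = 0" and st: "s \<in> {a..b}" "t \<in> {a..b}" "s \<le> t"
    interpret bounded_curve U a' b' M by (rule curve)
    show "((\<lambda>r. ip (U r) (laplacian w) + ip (U r) (convect (U r) w)) has_integral ip (U t) w - ip (U s) w) {s..t}"
    proof (rule weak_derivative_imp_integral[of a' s t b' "\<lambda>t. ip (U t) w"])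
      show "continuous_on {a'..b'} (\<lambda>t. ip (U t) w)"
        by (intro continuous_on_ip cont l2_continuous_on_const test_function_l2 w)
      show "continuous_on {a'..b'} (\<lambda>r. ip (U r) (laplacian w) + ip (U r) (convect (U r) w))"
        by (intro continuous_intros continuous_on_ip cont l2_continuous_on_const test_function_laplacian_l2 w convect_cont)
    qed (use ab' st strong_solution_weak_form[OF sol curve sub U(3) w] in auto)
  qed
  moreover have "\<forall>t\<in>{a..b}. AE x in lborel. u t x = U t x" using U(3) ab' by auto
  ultimately show ?thesis by blast
qed

text \<open>As soon as the representative has some weak gradient, the choice behind
  \<open>weak_grad (u s)\<close> is a genuine gradient, and any Borel version of it is a weak
  gradient of the representative. The energy equality for \<open>U\<close> then transfers through
  equality of norms.\<close>

lemma strong_solution_energy: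
  assumes sol: "strong_solution T u" and abT: "a \<in> {0<..<T}" "b \<in> {0<..<T}" "a \<le> b"
  shows "AE s in lebesgue. s \<in> {a..b} \<longrightarrow> in_H1 (u s)"
    and "set_integrable lebesgue {a..b} (\<lambda>s. (L2_norm (weak_grad (u s)))\<^sup>2)"
    and "(L2_norm (u b))\<^sup>2 + 2 * (LINT s:{a..b}|lebesgue. (L2_norm (weak_grad (u s)))\<^sup>2) = (L2_norm (u a))\<^sup>2"
proof -
  obtain U M where "ns_interval U a b M" and rep: "\<And>t. t \<in> {a..b} \<Longrightarrow> AE x in lborel. u t x = U t x"
    using strong_solution_representative[OF assms] by blast
  then interpret ns_interval U a b M by simp
  define L where "L = (\<lambda>s. (L2_norm (weak_grad (u s)))\<^sup>2)"
  have good: "has_L2_gradient (u t) (weak_grad (u t)) \<and> (\<exists>H. wgrad (U t) H \<and> L2_norm (weak_grad (u t)) = n2 H)"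
    if t: "t \<in> {a..b}" and G: "wgrad (U t) G" for t G
  proof -
    have "G \<in> borel_measurable borel" using G by (simp add: wgrad_def l2_def)
    then have "has_L2_gradient (u t) G"
      using has_L2_gradient_representative[OF U_measurable[OF t] rep[OF t], of G G] G by simp
    then have H: "has_L2_gradient (u t) (weak_grad (u t))" unfolding weak_grad_def by (rule someI[of "has_L2_gradient (u t)"])
    then have "weak_grad (u t) \<in> borel_measurable lebesgue" by (simp add: has_L2_gradient_def in_L2_def)
    then obtain H' where H': "H' \<in> borel_measurable borel" "AE x in lborel. weak_grad (u t) x = H' x"
      using borel_representative by blast
    have "wgrad (U t) H'" using H has_L2_gradient_representative[OF U_measurable[OF t] rep[OF t] H'] by simp
    then show ?thesis using H in_L2_representative(2)[OF H'] by blast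
  qed
  \<comment> \<open>At almost every time a Borel gradient with the same norm as
    \<open>weak_grad (u t)\<close>, chosen time by time; \<open>energy_equality\<close> allows such
    a selection.\<close>
  define \<Gamma> where "\<Gamma> = (\<lambda>t. SOME H. wgrad (U t) H \<and> L2_norm (weak_grad (u t)) = n2 H)"
  have aeab: "AE t in time. t \<in> {a..b}" by (rule AE_I2) simp
  have ae: "AE t in time. wgrad (U t) (\<Gamma> t) \<and> L t = (n2 (\<Gamma> t))\<^sup>2 \<and> in_H1 (u t)"
    using energy_equality(1) aeab
  proof eventually_elim
    case (elim t)
    then obtain G where G: "wgrad (U t) G" by blast
    have "\<exists>H. wgrad (U t) H \<and> L2_norm (weak_grad (u t)) = n2 H" using good[OF elim(2) G] by blast
    from someI_ex[OF this] have "wgrad (U t) (\<Gamma> t) \<and> L2_norm (weak_grad (u t)) = n2 (\<Gamma> t)"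
      by (simp add: \<Gamma>_def)
    moreover have "in_L2 (u t)"
      using in_L2_representative(1)[OF U_measurable[OF elim(2)] rep[OF elim(2)]] U_l2[OF elim(2)] by simp
    ultimately show ?case using good[OF elim(2) G] by (auto simp: in_H1_def L_def)
  qed
  then have "AE t in time. in_H1 (u t)" by eventually_elim simp
  then show "AE s in lebesgue. s \<in> {a..b} \<longrightarrow> in_H1 (u s)" by (simp add: AE_restrict_space_iff)
  have "AE t in time. wgrad (U t) (\<Gamma> t)" using ae by eventually_elim simp
  note E = energy_equality(2,3)[OF this]
  have L_eq: "AE t in time. (n2 (\<Gamma> t))\<^sup>2 = L t" using ae by eventually_elim simp
  have Lm: "L \<in> borel_measurable time"
    by (rule borel_measurable_lebesgue_on_AE_limit[OF borel_measurable_integrable[OF E(1)]])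
      (use L_eq in \<open>auto simp: LIMSEQ_const_iff\<close>)
  have Li: "integrable time L"
    using integrable_cong_AE[OF borel_measurable_integrable[OF E(1)] Lm L_eq] E(1) by simp
  then show "set_integrable lebesgue {a..b} (\<lambda>s. (L2_norm (weak_grad (u s)))\<^sup>2)"
    unfolding set_integrable_def L_def by (simp add: integrable_restrict_space)
  have "(LINT t|time. (n2 (\<Gamma> t))\<^sup>2) = (LINT t|time. L t)"
    by (rule integral_cong_AE[OF borel_measurable_integrable[OF E(1)] Lm L_eq])
  also have "\<dots> = (LINT s:{a..b}|lebesgue. (L2_norm (weak_grad (u s)))\<^sup>2)"
    unfolding set_lebesgue_integral_def L_def by (simp add: integral_restrict_space)
  finally have I: "(LINT t|time. (n2 (\<Gamma> t))\<^sup>2) = (LINT s:{a..b}|lebesgue. (L2_norm (weak_grad (u s)))\<^sup>2)" .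
  have N: "L2_norm (u t) = n2 (U t)" if "t \<in> {a..b}" for t
    by (rule in_L2_representative(2)[OF U_measurable[OF that] rep[OF that]])
  show "(L2_norm (u b))\<^sup>2 + 2 * (LINT s:{a..b}|lebesgue. (L2_norm (weak_grad (u s)))\<^sup>2) = (L2_norm (u a))\<^sup>2"
    using E(2) N[of a] N[of b] abT(3) unfolding I by simp
qed

text \<open>The open interval is the countable union of the closed intervals from \<open>a n\<close>
  to \<open>T - a n\<close>, on each of which the exceptional times form a null set.\<close>

lemma strong_solution_AE_H1:
  assumes sol: "strong_solution T u" and T: "T > 0"
  shows "AE s in lebesgue. s \<in> {0<..<T} \<longrightarrow> in_H1 (u s)"
proof -
  define a where "a = (\<lambda>n. inverse (real (Suc n)) * (T / 2))"
  have a: "0 < a n" "a n \<le> T / 2" for n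
    using T mult_right_mono[of "inverse (real (Suc n))" 1 "T / 2"] by (auto simp: a_def field_simps)
  have "AE s in lebesgue. s \<in> {a n..T - a n} \<longrightarrow> in_H1 (u s)" for n
    by (rule strong_solution_energy(1)[OF sol]) (use a[of n] T in auto)
  then have "AE s in lebesgue. \<forall>n. s \<in> {a n..T - a n} \<longrightarrow> in_H1 (u s)"
    by (intro AE_all_countable[THEN iffD2] allI)
  then show ?thesis
  proof eventually_elim
    case (elim s)
    show ?case
    proof
      assume s: "s \<in> {0<..<T}"
      have "a \<longlonglongrightarrow> 0" unfolding a_def by (rule tendsto_mult_left_zero[OF LIMSEQ_inverse_real_of_nat])
      then have "\<forall>\<^sub>F n in sequentially. a n < min s (T - s)"
        by (rule order_tendstoD(2)) (use s in auto)
      then obtain n where "a n < min s (T - s)" by (auto simp: eventually_sequentially)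
      then show "in_H1 (u s)" using elim[rule_format, of n] by auto
    qed
  qed
qed

text \<open>Interval integrals run over the open interval, the energy equality over the closed one;
  the two end points are a null set.\<close>

lemma interval_lebesgue_integral_Icc:
  fixes f :: "real \<Rightarrow> real"
  assumes "a \<le> b" "set_integrable lebesgue {a..b} f"
  shows "set_integrable lebesgue {a<..<b} f" "(LINT s:{a<..<b}|lebesgue. f s) = (LINT s:{a..b}|lebesgue. f s)"
proof -
  show i: "set_integrable lebesgue {a<..<b} f"
    by (rule set_integrable_subset[OF assms(2)]) auto
  have "AE s in lebesgue. s \<noteq> a" "AE s in lebesgue. s \<noteq> b"
    using AE_lborel_singleton[of a] AE_lborel_singleton[of b] by (auto intro: AE_completion)
  then have "AE s in lebesgue. indicat_real {a<..<b} s *\<^sub>R f s = indicat_real {a..b} s *\<^sub>R f s"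
    by eventually_elim (auto simp: indicator_def)
  then show "(LINT s:{a<..<b}|lebesgue. f s) = (LINT s:{a..b}|lebesgue. f s)"
    unfolding set_lebesgue_integral_def
    using i assms(2) by (intro integral_cong_AE) (auto simp: set_integrable_def)
qed

text \<open>Outside H1 the field \<open>weak_grad\<close> is unspecified, and an integral without
  integrability is 0 by convention; the first two conjuncts give the dissipation integral its
  meaning.\<close>

theorem theorem3p4:
  fixes T :: real and u :: "real \<Rightarrow> real^3 \<Rightarrow> real^3" and t1 t2 :: real
  assumes "T > 0"
    and "strong_solution T u"
    and "t1 \<in> {0<..<T}" and "t2 \<in> {0<..<T}"
  shows "(AE s in lebesgue. s \<in> {0<..<T} \<longrightarrow> in_H1 (u s)) \<and>
    interval_lebesgue_integrable lebesgue (ereal t1) (ereal t2)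
      (\<lambda>s. (L2_norm (weak_grad (u s)))\<^sup>2) \<and>
    (L2_norm (u t2))\<^sup>2
      + 2 * interval_lebesgue_integral lebesgue (ereal t1) (ereal t2)
              (\<lambda>s. (L2_norm (weak_grad (u s)))\<^sup>2)
    = (L2_norm (u t1))\<^sup>2"
proof (intro conjI)
  show "AE s in lebesgue. s \<in> {0<..<T} \<longrightarrow> in_H1 (u s)"
    by (rule strong_solution_AE_H1[OF assms(2,1)])
  have fwd: "set_integrable lebesgue {a<..<b} (\<lambda>s. (L2_norm (weak_grad (u s)))\<^sup>2)"
    "(L2_norm (u b))\<^sup>2 + 2 * (LINT s:{a<..<b}|lebesgue. (L2_norm (weak_grad (u s)))\<^sup>2) = (L2_norm (u a))\<^sup>2"
    if "a \<in> {0<..<T}" "b \<in> {0<..<T}" "a \<le> b" for a b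
    using interval_lebesgue_integral_Icc[OF that(3) strong_solution_energy(2)[OF assms(2) that]]
      strong_solution_energy(3)[OF assms(2) that] by simp_all
  show "interval_lebesgue_integrable lebesgue (ereal t1) (ereal t2) (\<lambda>s. (L2_norm (weak_grad (u s)))\<^sup>2)"
    using fwd(1)[of t1 t2] fwd(1)[of t2 t1] assms(3,4)
    by (auto simp: interval_lebesgue_integrable_def not_le less_imp_le)
  show "(L2_norm (u t2))\<^sup>2
      + 2 * interval_lebesgue_integral lebesgue (ereal t1) (ereal t2)
              (\<lambda>s. (L2_norm (weak_grad (u s)))\<^sup>2)
    = (L2_norm (u t1))\<^sup>2"
  proof (cases "t1 \<le> t2")
    case True
    then show ?thesis
      using fwd(2)[OF assms(3,4)] by (simp add: interval_lebesgue_integral_def)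
  next
    \<comment> \<open>For \<open>t2 < t1\<close> the interval integral changes sign, so the equality
      from \<open>t2\<close> to \<open>t1\<close> rearranges to the claim.\<close>
    case False
    then show ?thesis
      using fwd(2)[OF assms(4,3)] by (simp add: interval_lebesgue_integral_def)
  qed
qed

end
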